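(* Let $B$ be a cocommutative bialgebra over $k$, let $C$ be a $B$-bimodule algebra (left action $\rightharpoonup$, right action $\leftharpoonup$), and let $(C\natural B,\star)$ be their L-R-smash product. Let $T$ be a linear automorphism of the vector space $C$. Define: (i) the product $\bullet^T$ on $C$ by $f\bullet^T g=T^{-1}(T(f)\cdot T(g))$; (ii) left and right $B$-actions on $C$ by $a\rightharpoonup^T f:=T^{-1}(a\rightharpoonup T(f))$ and $f\leftharpoonup^T a:=T^{-1}(T(f)\leftharpoonup a)$; (iii) the product $\star^T$ on $C\otimes B$ by $(f\otimes a)\star^T(g\otimes b)=\mathbf T^{-1}\big(\mathbf T(f\otimes a)\star\mathbf T(g\otimes b)\big)$, where $\mathbf T:=T\otimes\mathrm{Id}$. Then $(C,\bullet^T)$ is a $B$-bimodule algebra for $\rightharpoonup^T$ and $\leftharpoonup^T$, and $\star^T$ is the L-R-smash product defined by these structures. Moreover, if $B$ is a Hopf algebra and $(C,\cdot,\Delta_C,J_C,\rightharpoonup,\leftharpoonup)$ is a Hopf algebra and a $B$-bimodule bialgebra, then $$C_T:=\big(C,\ \bullet^T,\ \Delta_C^T:=(T^{-1}\otimes T^{-1})\circ\Delta_C\circ T,\ J_C^T:=T^{-1}\circ J_C\circ T,\ \rightharpoonup^T,\ \leftharpoonup^T\big)$$ is also a Hopf algebra and a $B$-bimodule bialgebra. Consequently $$\big(C_T\natural B,\ \star^T,\ \Delta^T:=(23)\circ(\Delta_C^T\otimes\Delta_B),\ J_\star^T\big)$$ is a Hopf algebra, where $J_\star^T(f\otimes a)=\sum_{(a)}\big(J_B(a_{(1)})\rightharpoonup^T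 J_C^T(f)\leftharpoonup^T J_B(a_{(2)})\big)\otimes J_B(a_{(3)})$. Also, $$\Delta^T=(\mathbf T^{-1}\otimes\mathbf T^{-1})\circ(23)\circ(\Delta_C\otimes\Delta_B)\circ\mathbf T\qquad\text{and}\qquad J_\star^T=\mathbf T^{-1}\circ J_\star\circ\mathbf T,$$ where $J_\star(f\otimes a)=\sum_{(a)}\big(J_B(a_{(1)})\rightharpoonup J_C(f)\leftharpoonup J_B(a_{(2)})\big)\otimes J_B(a_{(3)})$.
   Context: All vector spaces, algebras, coalgebras, etc. are over $k=\mathbb R$ or $\mathbb C$. Sweedler notation: $\Delta(b)=\sum_{(b)}b_{(1)}\otimes b_{(2)}$. A $B$-bimodule algebra is an algebra $C$ that is a $B$-bimodule (left action $\rightharpoonup$, right action $\leftharpoonup$, commuting with each other) and is a $B$-module algebra for both actions: $a\rightharpoonup(fg)=\sum_{(a)}(a_{(1)}\rightharpoonup f)(a_{(2)}\rightharpoonup g)$, $a\rightharpoonup 1_C=\epsilon_B(a)1_C$, $(fg)\leftharpoonup a=\sum_{(a)}(f\leftharpoonup a_{(1)})(g\leftharpoonup a_{(2)})$, $1_C\leftharpoonup a=\epsilon_B(a)1_C$. A $B$-bimodule bialgebra is a bialgebra $C$ that is a $B$-bimodule algebra and for which both actions are also module-coalgebra structures: $\Delta_C(a\rightharpoonup f)=\sum(a_{(1)}\rightharpoonup f_{(1)})\otimes(a_{(2)}\rightharpoonup f_{(2)})$, $\epsilon_C(a\rightharpoonup f)=\epsilon_B(a)\epsilon_C(f)$, and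 similarly for $\leftharpoonup$. For $B$ a cocommutative bialgebra and $C$ a $B$-bimodule algebra, the L-R-smash product $C\natural B$ is the (associative) algebra on the vector space $C\otimes B$ with multiplication $$(f\otimes a)\star(g\otimes b)=\sum_{(a)(b)}(f\leftharpoonup b_{(1)})(a_{(1)}\rightharpoonup g)\otimes a_{(2)}b_{(2)},\qquad f,g\in C,\ a,b\in B.$$ The map $(23):C\otimes C\otimes B\otimes B\to C\otimes B\otimes C\otimes B$ is $c_1\otimes c_2\otimes b_1\otimes b_2\mapsto c_1\otimes b_1\otimes c_2\otimes b_2$. The unit of $(C,\bullet^T)$ is $T^{-1}(1_C)$, the counit of $C_T$ is $\epsilon_C\circ T$, and the counit of $C_T\natural B$ is $(\epsilon_C\circ T)\otimes\epsilon_B$. *)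

theory Defs
  imports Complex_Main "HOL-Library.Function_Algebras"
begin

text \<open>
  The scalars of the main result form a type of class \<open>real_normed_field\<close>: its instances
  are, up to isomorphism, exactly the real and the complex numbers.  The definitions make
  sense over any field.

  A vector space is a subspace (its carrier) of an ambient type on which the scaling makes the
  whole type a vector space.  Carriers are needed because a tensor product depends on the scalings
  of its factors and therefore cannot be a type of its own.  All maps between such spaces
  are only meaningful on carriers.
\<close>

record ('k, 'v) vsp =
  carrier :: "'v set"
  scale :: "'k \<Rightarrow> 'v \<Rightarrow> 'v"

definition vspace :: "('k::field, 'v::ab_group_add, 'm) vsp_scheme \<Rightarrow> bool" where
  "vspace V \<longleftrightarrow> vector_space (scale V) \<and> module.subspace (scale V) (carrier V)"

definition linear_map ::
  "('k::field, 'v::ab_group_add, 'm) vsp_scheme \<Rightarrow> ('k, 'w::ab_group_add, 'n) vsp_scheme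
    \<Rightarrow> ('v \<Rightarrow> 'w) \<Rightarrow> bool" where
  "linear_map V W f \<longleftrightarrow>
     (\<forall>x\<in>carrier V. f x \<in> carrier W) \<and>
     (\<forall>x\<in>carrier V. \<forall>y\<in>carrier V. f (x + y) = f x + f y) \<and>
     (\<forall>c. \<forall>x\<in>carrier V. f (scale V c x) = scale W c (f x))"

definition bilinear_map ::
  "('k::field, 'v::ab_group_add, 'm) vsp_scheme \<Rightarrow> ('k, 'w::ab_group_add, 'n) vsp_scheme
    \<Rightarrow> ('k, 'u::ab_group_add, 'l) vsp_scheme \<Rightarrow> ('v \<Rightarrow> 'w \<Rightarrow> 'u) \<Rightarrow> bool" where
  "bilinear_map V W U h \<longleftrightarrow>
     (\<forall>v\<in>carrier V. linear_map W U (h v)) \<and>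
     (\<forall>w\<in>carrier W. linear_map V U (\<lambda>v. h v w))"

definition ground :: "('k::field, 'k) vsp" where
  "ground = \<lparr>carrier = UNIV, scale = (*)\<rparr>"


subsection \<open>Tensor products\<close>

text \<open>
  The elementary tensor of \<open>v\<close> and \<open>w\<close> is realised as the evaluation functional
  \<open>\<phi> \<mapsto> \<phi> v w\<close> on the bilinear forms on \<open>V \<times> W\<close> (extended by \<open>0\<close> to all functions), and the tensor
  product \<open>V \<otimes> W\<close> is the linear span of the elementary tensors.
  Lemmas \<open>bilinear_tens\<close>, \<open>linear_tlift\<close>, \<open>tlift_tens\<close> and \<open>tensor_ext\<close> below are its universal property.
\<close>

type_synonym ('v, 'w, 'k) tens = "('v \<Rightarrow> 'w \<Rightarrow> 'k) \<Rightarrow> 'k"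

definition tens ::
  "('k::field, 'v::ab_group_add, 'm) vsp_scheme \<Rightarrow> ('k, 'w::ab_group_add, 'n) vsp_scheme
    \<Rightarrow> 'v \<Rightarrow> 'w \<Rightarrow> ('v, 'w, 'k) tens" where
  "tens V W v w = (\<lambda>\<phi>. if bilinear_map V W ground \<phi> then \<phi> v w else 0)"

definition fscale :: "'k::field \<Rightarrow> ('x \<Rightarrow> 'k) \<Rightarrow> 'x \<Rightarrow> 'k" where
  "fscale c F = (\<lambda>x. c * F x)"

definition tensor ::
  "('k::field, 'v::ab_group_add, 'm) vsp_scheme \<Rightarrow> ('k, 'w::ab_group_add, 'n) vsp_scheme
    \<Rightarrow> ('k, ('v, 'w, 'k) tens) vsp"  (infixr \<open>\<otimes>\<close> 70) where
  "V \<otimes> W = \<lparr>carrier = module.span fscale {tens V W v w | v w. v \<in> carrier V \<and> w \<in> carrier W},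
             scale = fscale\<rparr>"

text \<open>
  The linear map on \<open>V \<otimes> W\<close> induced by a bilinear map \<open>h\<close>.  In Sweedler notation,
  \<open>\<Sum> h a\<^sub>(\<^sub>1\<^sub>) a\<^sub>(\<^sub>2\<^sub>)\<close> is \<open>tlift B B h (\<Delta> a)\<close>.
\<close>

definition tlift ::
  "('k::field, 'v::ab_group_add, 'm) vsp_scheme \<Rightarrow> ('k, 'w::ab_group_add, 'n) vsp_scheme
    \<Rightarrow> ('v \<Rightarrow> 'w \<Rightarrow> 'u::ab_group_add) \<Rightarrow> ('v, 'w, 'k) tens \<Rightarrow> 'u" where
  "tlift V W h x = (THE u. \<exists>ps. set ps \<subseteq> carrier V \<times> carrier W \<and>
     x = (\<Sum>(v, w)\<leftarrow>ps. tens V W v w) \<and> u = (\<Sum>(v, w)\<leftarrow>ps. h v w))"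

definition tmap ::
  "('k::field, 'v::ab_group_add, 'm) vsp_scheme \<Rightarrow> ('k, 'w::ab_group_add, 'n) vsp_scheme
    \<Rightarrow> ('k, 'v'::ab_group_add, 'm') vsp_scheme \<Rightarrow> ('k, 'w'::ab_group_add, 'n') vsp_scheme
    \<Rightarrow> ('v \<Rightarrow> 'v') \<Rightarrow> ('w \<Rightarrow> 'w') \<Rightarrow> ('v, 'w, 'k) tens \<Rightarrow> ('v', 'w', 'k) tens" where
  "tmap V W V' W' f g = tlift V W (\<lambda>v w. tens V' W' (f v) (g w))"

definition tswap ::
  "('k::field, 'v::ab_group_add, 'm) vsp_scheme \<Rightarrow> ('k, 'w::ab_group_add, 'n) vsp_scheme
    \<Rightarrow> ('v, 'w, 'k) tens \<Rightarrow> ('w, 'v, 'k) tens" where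
  "tswap V W = tlift V W (\<lambda>v w. tens W V w v)"

definition tassoc ::
  "('k::field, 'u::ab_group_add, 'l) vsp_scheme \<Rightarrow> ('k, 'v::ab_group_add, 'm) vsp_scheme
    \<Rightarrow> ('k, 'w::ab_group_add, 'n) vsp_scheme
    \<Rightarrow> (('u, 'v, 'k) tens, 'w, 'k) tens \<Rightarrow> ('u, ('v, 'w, 'k) tens, 'k) tens" where
  "tassoc U V W = tlift (U \<otimes> V) W
     (\<lambda>x w. tlift U V (\<lambda>u v. tens U (V \<otimes> W) u (tens V W v w)) x)"

definition flip23 ::
  "('k::field, 'v::ab_group_add, 'm) vsp_scheme \<Rightarrow> ('k, 'w::ab_group_add, 'n) vsp_scheme
    \<Rightarrow> (('v, 'v, 'k) tens, ('w, 'w, 'k) tens, 'k) tens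
    \<Rightarrow> (('v, 'w, 'k) tens, ('v, 'w, 'k) tens, 'k) tens" where
  "flip23 V W = tlift (V \<otimes> V) (W \<otimes> W) (\<lambda>x y.
     tlift V V (\<lambda>v1 v2. tlift W W (\<lambda>w1 w2.
       tens (V \<otimes> W) (V \<otimes> W) (tens V W v1 w1) (tens V W v2 w2)) y) x)"


subsection \<open>Algebras, coalgebras, bialgebras, Hopf algebras\<close>

record ('k, 'v) alg = "('k, 'v) vsp" +
  mult :: "'v \<Rightarrow> 'v \<Rightarrow> 'v"
  one :: 'v

record ('k, 'v) bialg = "('k, 'v) alg" +
  comult :: "'v \<Rightarrow> ('v, 'v, 'k) tens"
  counit :: "'v \<Rightarrow> 'k"

record ('k, 'v) hopf = "('k, 'v) bialg" +
  antipode :: "'v \<Rightarrow> 'v"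

definition algebra :: "('k::field, 'v::ab_group_add, 'm) alg_scheme \<Rightarrow> bool" where
  "algebra A \<longleftrightarrow> vspace A \<and> bilinear_map A A A (mult A) \<and>
     (\<forall>x\<in>carrier A. \<forall>y\<in>carrier A. \<forall>z\<in>carrier A.
        mult A (mult A x y) z = mult A x (mult A y z)) \<and>
     one A \<in> carrier A \<and>
     (\<forall>x\<in>carrier A. mult A (one A) x = x \<and> mult A x (one A) = x)"

definition coalgebra :: "('k::field, 'v::ab_group_add, 'm) bialg_scheme \<Rightarrow> bool" where
  "coalgebra A \<longleftrightarrow> vspace A \<and>
     linear_map A (A \<otimes> A) (comult A) \<and> linear_map A ground (counit A) \<and>
     (\<forall>x\<in>carrier A.
        tassoc A A A (tmap A A (A \<otimes> A) A (comult A) id (comult A x))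
          = tmap A A A (A \<otimes> A) id (comult A) (comult A x)) \<and>
     (\<forall>x\<in>carrier A. tlift A A (\<lambda>x1 x2. scale A (counit A x1) x2) (comult A x) = x) \<and>
     (\<forall>x\<in>carrier A. tlift A A (\<lambda>x1 x2. scale A (counit A x2) x1) (comult A x) = x)"

definition tensor_mult ::
  "('k::field, 'v::ab_group_add, 'm) alg_scheme \<Rightarrow> ('k, 'w::ab_group_add, 'n) alg_scheme
    \<Rightarrow> ('v, 'w, 'k) tens \<Rightarrow> ('v, 'w, 'k) tens \<Rightarrow> ('v, 'w, 'k) tens" where
  "tensor_mult A A' x y = tlift A A' (\<lambda>a a'. tlift A A' (\<lambda>b b'.
     tens A A' (mult A a b) (mult A' a' b')) y) x"

definition bialgebra :: "('k::field, 'v::ab_group_add, 'm) bialg_scheme \<Rightarrow> bool" where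
  "bialgebra A \<longleftrightarrow> algebra A \<and> coalgebra A \<and>
     comult A (one A) = tens A A (one A) (one A) \<and> counit A (one A) = 1 \<and>
     (\<forall>x\<in>carrier A. \<forall>y\<in>carrier A.
        comult A (mult A x y) = tensor_mult A A (comult A x) (comult A y) \<and>
        counit A (mult A x y) = counit A x * counit A y)"

definition cocommutative :: "('k::field, 'v::ab_group_add, 'm) bialg_scheme \<Rightarrow> bool" where
  "cocommutative A \<longleftrightarrow> (\<forall>x\<in>carrier A. tswap A A (comult A x) = comult A x)"

definition hopf_algebra :: "('k::field, 'v::ab_group_add, 'm) hopf_scheme \<Rightarrow> bool" where
  "hopf_algebra A \<longleftrightarrow> bialgebra A \<and> linear_map A A (antipode A) \<and>
     (\<forall>x\<in>carrier A.
        tlift A A (\<lambda>x1 x2. mult A (antipode A x1) x2) (comult A x) = scale A (counit A x) (one A) \<and>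
        tlift A A (\<lambda>x1 x2. mult A x1 (antipode A x2)) (comult A x) = scale A (counit A x) (one A))"


subsection \<open>Bimodule algebras and bimodule bialgebras\<close>

text \<open>
  Throughout, \<open>l a f\<close> is \<open>a \<rightharpoonup> f\<close> and \<open>r f a\<close> is \<open>f \<leftharpoonup> a\<close>.
\<close>

definition bimodule ::
  "('k::field, 'b::ab_group_add, 'm) alg_scheme \<Rightarrow> ('k, 'c::ab_group_add, 'n) vsp_scheme
    \<Rightarrow> ('b \<Rightarrow> 'c \<Rightarrow> 'c) \<Rightarrow> ('c \<Rightarrow> 'b \<Rightarrow> 'c) \<Rightarrow> bool" where
  "bimodule B C l r \<longleftrightarrow>
     vspace C \<and> bilinear_map B C C l \<and> bilinear_map C B C r \<and>
     (\<forall>f\<in>carrier C. l (one B) f = f \<and> r f (one B) = f) \<and>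
     (\<forall>a\<in>carrier B. \<forall>b\<in>carrier B. \<forall>f\<in>carrier C.
        l (mult B a b) f = l a (l b f) \<and>
        r f (mult B a b) = r (r f a) b \<and>
        r (l a f) b = l a (r f b))"

definition bimodule_algebra ::
  "('k::field, 'b::ab_group_add, 'm) bialg_scheme \<Rightarrow> ('k, 'c::ab_group_add, 'n) alg_scheme
    \<Rightarrow> ('b \<Rightarrow> 'c \<Rightarrow> 'c) \<Rightarrow> ('c \<Rightarrow> 'b \<Rightarrow> 'c) \<Rightarrow> bool" where
  "bimodule_algebra B C l r \<longleftrightarrow> algebra C \<and> bimodule B C l r \<and>
     (\<forall>a\<in>carrier B. \<forall>f\<in>carrier C. \<forall>g\<in>carrier C.
        l a (mult C f g) = tlift B B (\<lambda>a1 a2. mult C (l a1 f) (l a2 g)) (comult B a) \<and>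
        r (mult C f g) a = tlift B B (\<lambda>a1 a2. mult C (r f a1) (r g a2)) (comult B a)) \<and>
     (\<forall>a\<in>carrier B.
        l a (one C) = scale C (counit B a) (one C) \<and>
        r (one C) a = scale C (counit B a) (one C))"

definition bimodule_bialgebra ::
  "('k::field, 'b::ab_group_add, 'm) bialg_scheme \<Rightarrow> ('k, 'c::ab_group_add, 'n) bialg_scheme
    \<Rightarrow> ('b \<Rightarrow> 'c \<Rightarrow> 'c) \<Rightarrow> ('c \<Rightarrow> 'b \<Rightarrow> 'c) \<Rightarrow> bool" where
  "bimodule_bialgebra B C l r \<longleftrightarrow> bialgebra C \<and> bimodule_algebra B C l r \<and>
     (\<forall>a\<in>carrier B. \<forall>f\<in>carrier C.
        comult C (l a f) = tlift B B (\<lambda>a1 a2. tlift C C (\<lambda>f1 f2.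
          tens C C (l a1 f1) (l a2 f2)) (comult C f)) (comult B a) \<and>
        counit C (l a f) = counit B a * counit C f \<and>
        comult C (r f a) = tlift B B (\<lambda>a1 a2. tlift C C (\<lambda>f1 f2.
          tens C C (r f1 a1) (r f2 a2)) (comult C f)) (comult B a) \<and>
        counit C (r f a) = counit C f * counit B a)"


subsection \<open>The L-R-smash product\<close>

definition lr_mult ::
  "('k::field, 'b::ab_group_add, 'm) bialg_scheme \<Rightarrow> ('k, 'c::ab_group_add, 'n) alg_scheme
    \<Rightarrow> ('b \<Rightarrow> 'c \<Rightarrow> 'c) \<Rightarrow> ('c \<Rightarrow> 'b \<Rightarrow> 'c)
    \<Rightarrow> ('c, 'b, 'k) tens \<Rightarrow> ('c, 'b, 'k) tens \<Rightarrow> ('c, 'b, 'k) tens" where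
  "lr_mult B C l r x y =
     tlift C B (\<lambda>f a. tlift C B (\<lambda>g b.
       tlift B B (\<lambda>a1 a2. tlift B B (\<lambda>b1 b2.
         tens C B (mult C (r f b1) (l a1 g)) (mult B a2 b2)) (comult B b)) (comult B a)) y) x"

definition lr_comult ::
  "('k::field, 'b::ab_group_add, 'm) bialg_scheme \<Rightarrow> ('k, 'c::ab_group_add, 'n) bialg_scheme
    \<Rightarrow> ('c, 'b, 'k) tens \<Rightarrow> (('c, 'b, 'k) tens, ('c, 'b, 'k) tens, 'k) tens" where
  "lr_comult B C x = flip23 C B (tmap C B (C \<otimes> C) (B \<otimes> B) (comult C) (comult B) x)"

definition lr_counit ::
  "('k::field, 'b::ab_group_add, 'm) bialg_scheme \<Rightarrow> ('k, 'c::ab_group_add, 'n) bialg_scheme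
    \<Rightarrow> ('c, 'b, 'k) tens \<Rightarrow> 'k" where
  "lr_counit B C = tlift C B (\<lambda>f a. counit C f * counit B a)"

text \<open>The threefold Sweedler sum is taken along \<open>(id \<otimes> \<Delta>) \<circ> \<Delta>\<close>.\<close>

definition lr_antipode ::
  "('k::field, 'b::ab_group_add, 'm) hopf_scheme \<Rightarrow> ('k, 'c::ab_group_add, 'n) hopf_scheme
    \<Rightarrow> ('b \<Rightarrow> 'c \<Rightarrow> 'c) \<Rightarrow> ('c \<Rightarrow> 'b \<Rightarrow> 'c)
    \<Rightarrow> ('c, 'b, 'k) tens \<Rightarrow> ('c, 'b, 'k) tens" where
  "lr_antipode B C l r = tlift C B (\<lambda>f a.
     tlift B B (\<lambda>a1 a'. tlift B B (\<lambda>a2 a3.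
       tens C B (r (l (antipode B a1) (antipode C f)) (antipode B a2)) (antipode B a3))
       (comult B a')) (comult B a))"

definition lr_smash ::
  "('k::field, 'b::ab_group_add, 'm) hopf_scheme \<Rightarrow> ('k, 'c::ab_group_add, 'n) hopf_scheme
    \<Rightarrow> ('b \<Rightarrow> 'c \<Rightarrow> 'c) \<Rightarrow> ('c \<Rightarrow> 'b \<Rightarrow> 'c) \<Rightarrow> ('k, ('c, 'b, 'k) tens) hopf" where
  "lr_smash B C l r =
     \<lparr>carrier = carrier (C \<otimes> B), scale = scale (C \<otimes> B),
      mult = lr_mult B C l r, one = tens C B (one C) (one B),
      comult = lr_comult B C, counit = lr_counit B C, antipode = lr_antipode B C l r\<rparr>"


subsection \<open>Transport along a linear automorphism of \<open>C\<close>\<close>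

definition linear_automorphism ::
  "('k::field, 'v::ab_group_add, 'm) vsp_scheme \<Rightarrow> ('v \<Rightarrow> 'v) \<Rightarrow> bool" where
  "linear_automorphism V T \<longleftrightarrow> linear_map V V T \<and> bij_betw T (carrier V) (carrier V)"

abbreviation inv_on :: "('k, 'v, 'm) vsp_scheme \<Rightarrow> ('v \<Rightarrow> 'w) \<Rightarrow> 'w \<Rightarrow> 'v" where
  "inv_on V T \<equiv> inv_into (carrier V) T"

definition transport ::
  "('k::field, 'c::ab_group_add) hopf \<Rightarrow> ('c \<Rightarrow> 'c) \<Rightarrow> ('k, 'c) hopf" where
  "transport C T =
     \<lparr>carrier = carrier C, scale = scale C,
      mult = (\<lambda>f g. inv_on C T (mult C (T f) (T g))),
      one = inv_on C T (one C),
      comult = (\<lambda>f. tmap C C C C (inv_on C T) (inv_on C T) (comult C (T f))),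
      counit = (\<lambda>f. counit C (T f)),
      antipode = (\<lambda>f. inv_on C T (antipode C (T f)))\<rparr>"

definition transport_left ::
  "('k, 'c, 'm) vsp_scheme \<Rightarrow> ('c \<Rightarrow> 'c) \<Rightarrow> ('b \<Rightarrow> 'c \<Rightarrow> 'c) \<Rightarrow> 'b \<Rightarrow> 'c \<Rightarrow> 'c" where
  "transport_left C T l = (\<lambda>a f. inv_on C T (l a (T f)))"

definition transport_right ::
  "('k, 'c, 'm) vsp_scheme \<Rightarrow> ('c \<Rightarrow> 'c) \<Rightarrow> ('c \<Rightarrow> 'b \<Rightarrow> 'c) \<Rightarrow> 'c \<Rightarrow> 'b \<Rightarrow> 'c" where
  "transport_right C T r = (\<lambda>f a. inv_on C T (r (T f) a))"

definition extend_id ::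
  "('k::field, 'b::ab_group_add, 'm) vsp_scheme \<Rightarrow> ('k, 'c::ab_group_add, 'n) vsp_scheme
    \<Rightarrow> ('c \<Rightarrow> 'c) \<Rightarrow> ('c, 'b, 'k) tens \<Rightarrow> ('c, 'b, 'k) tens" where
  "extend_id B C T = tmap C B C B T id"

definition transport_star ::
  "('k::field, 'b::ab_group_add, 'm) bialg_scheme \<Rightarrow> ('k, 'c::ab_group_add, 'n) alg_scheme
    \<Rightarrow> ('b \<Rightarrow> 'c \<Rightarrow> 'c) \<Rightarrow> ('c \<Rightarrow> 'b \<Rightarrow> 'c) \<Rightarrow> ('c \<Rightarrow> 'c)
    \<Rightarrow> ('c, 'b, 'k) tens \<Rightarrow> ('c, 'b, 'k) tens \<Rightarrow> ('c, 'b, 'k) tens" where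
  "transport_star B C l r T x y =
     inv_on (C \<otimes> B) (extend_id B C T)
       (lr_mult B C l r (extend_id B C T x) (extend_id B C T y))"


subsection \<open>The universal property of the tensor product\<close>

lemma vector_space_fscale: "vector_space (fscale :: 'k::field \<Rightarrow> _)"
  by unfold_locales (auto simp: fscale_def fun_eq_iff algebra_simps)

lemma vspace_tensor:
  fixes V :: "('k::field, 'v::ab_group_add, 'm) vsp_scheme"
    and W :: "('k, 'w::ab_group_add, 'n) vsp_scheme"
  shows "vspace (V \<otimes> W)"
proof -
  interpret fs: vector_space "fscale :: 'k \<Rightarrow> _" by (rule vector_space_fscale)
  show ?thesis by (simp add: vspace_def tensor_def vector_space_fscale)
qed

lemma tens_carrier:
  fixes V :: "('k::field, 'v::ab_group_add, 'm) vsp_scheme"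
    and W :: "('k, 'w::ab_group_add, 'n) vsp_scheme"
  shows "v \<in> carrier V \<Longrightarrow> w \<in> carrier W \<Longrightarrow> tens V W v w \<in> carrier (V \<otimes> W)"
proof -
  interpret fs: vector_space "fscale :: 'k \<Rightarrow> _" by (rule vector_space_fscale)
  show "v \<in> carrier V \<Longrightarrow> w \<in> carrier W \<Longrightarrow> tens V W v w \<in> carrier (V \<otimes> W)"
    by (auto simp: tensor_def intro!: fs.span_base)
qed

lemma bilinear_tens: "bilinear_map V W (V \<otimes> W) (tens V W)"
  unfolding bilinear_map_def [of V W "V \<otimes> W"] linear_map_def
  by (auto simp: tens_carrier)
     (auto simp: tens_def fun_eq_iff tensor_def fscale_def bilinear_map_def linear_map_def ground_def)

lemma tensor_rep:
  fixes V :: "('k::field, 'v::ab_group_add, 'm) vsp_scheme"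
    and W :: "('k, 'w::ab_group_add, 'n) vsp_scheme"
  assumes "vspace V" "x \<in> carrier (V \<otimes> W)"
  obtains ps where "set ps \<subseteq> carrier V \<times> carrier W" "x = (\<Sum>(v, w)\<leftarrow>ps. tens V W v w)"
proof -
  interpret fs: vector_space "fscale :: 'k \<Rightarrow> _" by (rule vector_space_fscale)
  interpret V: vector_space "scale V" using assms by (simp add: vspace_def)
  have sV: "V.subspace (carrier V)" using assms by (simp add: vspace_def)
  have "x \<in> fs.span {tens V W v w | v w. v \<in> carrier V \<and> w \<in> carrier W}"
    using assms by (simp add: tensor_def)
  then have "\<exists>ps. set ps \<subseteq> carrier V \<times> carrier W \<and> x = (\<Sum>(v, w)\<leftarrow>ps. tens V W v w)"
  proof (induction rule: fs.span_induct_alt)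
    case base
    show ?case by (rule exI [of _ "[]"]) simp
  next
    case (step c x y)
    then obtain v w ps where *: "v \<in> carrier V" "w \<in> carrier W" "x = tens V W v w"
      "set ps \<subseteq> carrier V \<times> carrier W" "y = (\<Sum>(v, w)\<leftarrow>ps. tens V W v w)" by blast
    have "fscale c x = tens V W (scale V c v) w"
      using bilinear_tens [of V W] * by (auto simp: bilinear_map_def linear_map_def tensor_def)
    moreover have "scale V c v \<in> carrier V" using sV * by (simp add: V.subspace_scale)
    ultimately show ?case using * by (intro exI [of _ "(scale V c v, w) # ps"]) auto
  qed
  then show ?thesis using that by blast
qed

lemma tlift_rep:
  fixes V :: "('k::field, 'v::ab_group_add, 'm) vsp_scheme"
    and W :: "('k, 'w::ab_group_add, 'n) vsp_scheme"
  assumes U: "vspace U" and h: "bilinear_map V W U h"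
    and ps: "set ps \<subseteq> carrier V \<times> carrier W" "x = (\<Sum>(v, w)\<leftarrow>ps. tens V W v w)"
  shows "tlift V W h x = (\<Sum>(v, w)\<leftarrow>ps. h v w)"
  unfolding tlift_def
proof (rule the_equality)
  show "\<exists>qs. set qs \<subseteq> carrier V \<times> carrier W \<and> x = (\<Sum>(v, w)\<leftarrow>qs. tens V W v w) \<and>
    (\<Sum>(v, w)\<leftarrow>ps. h v w) = (\<Sum>(v, w)\<leftarrow>qs. h v w)"
    using ps by blast
next
  fix u
  assume "\<exists>qs. set qs \<subseteq> carrier V \<times> carrier W \<and> x = (\<Sum>(v, w)\<leftarrow>qs. tens V W v w) \<and>
    u = (\<Sum>(v, w)\<leftarrow>qs. h v w)"
  then obtain qs where qs: "set qs \<subseteq> carrier V \<times> carrier W"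
    "x = (\<Sum>(v, w)\<leftarrow>qs. tens V W v w)" "u = (\<Sum>(v, w)\<leftarrow>qs. h v w)" by blast
  interpret U: vector_space "scale U" using U by (simp add: vspace_def)
  interpret K: vector_space "(*) :: 'k \<Rightarrow> 'k \<Rightarrow> 'k" by unfold_locales (auto simp: algebra_simps)
  interpret UK: vector_space_pair "scale U" "(*) :: 'k \<Rightarrow> 'k \<Rightarrow> 'k" ..
  define d where "d = u - (\<Sum>(v, w)\<leftarrow>ps. h v w)"
  have zero: "g d = 0" if g: "Vector_Spaces.linear (scale U) (*) g" for g
  proof -
    interpret g: Vector_Spaces.linear "scale U" "(*)" g by (rule g)
    have "bilinear_map V W ground (\<lambda>v w. g (h v w))"
      using h by (auto simp: bilinear_map_def linear_map_def ground_def g.add g.scale)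
    then have ev: "(\<Sum>(v, w)\<leftarrow>rs. tens V W v w) (\<lambda>v w. g (h v w)) = g (\<Sum>(v, w)\<leftarrow>rs. h v w)" for rs
      by (induction rs) (auto simp: tens_def g.add g.zero)
    show ?thesis using ev [of ps] ev [of qs] ps qs by (simp add: d_def g.diff)
  qed
  have "d = 0"
  proof (rule ccontr)
    assume "d \<noteq> 0"
    then have "U.independent {d}" by (simp add: U.dependent_single)
    from UK.linear_independent_extend [OF this, of "\<lambda>_. 1"]
    obtain g where "Vector_Spaces.linear (scale U) (*) g" "g d = 1" by auto
    with zero [of g] show False by simp
  qed
  then show "u = (\<Sum>(v, w)\<leftarrow>ps. h v w)" by (simp add: d_def)
qed

lemma tlift_tens:
  assumes "vspace U" "bilinear_map V W U h" "v \<in> carrier V" "w \<in> carrier W"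
  shows "tlift V W h (tens V W v w) = h v w"
  using tlift_rep [OF assms(1,2), of "[(v, w)]"] assms by simp

lemma linear_tlift:
  fixes V :: "('k::field, 'v::ab_group_add, 'm) vsp_scheme"
    and W :: "('k, 'w::ab_group_add, 'n) vsp_scheme"
  assumes V: "vspace V" and U: "vspace U" and h: "bilinear_map V W U h"
  shows "linear_map (V \<otimes> W) U (tlift V W h)"
  unfolding linear_map_def
proof (intro conjI ballI allI)
  interpret V: vector_space "scale V" using V by (simp add: vspace_def)
  interpret U: vector_space "scale U" using U by (simp add: vspace_def)
  interpret fs: vector_space "fscale :: 'k \<Rightarrow> _" by (rule vector_space_fscale)
  have sV: "V.subspace (carrier V)" using V by (simp add: vspace_def)
  have sU: "U.subspace (carrier U)" using U by (simp add: vspace_def)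
  fix x assume "x \<in> carrier (V \<otimes> W)"
  then obtain ps where ps: "set ps \<subseteq> carrier V \<times> carrier W" "x = (\<Sum>(v, w)\<leftarrow>ps. tens V W v w)"
    using tensor_rep [OF V] by blast
  have "(\<Sum>(v, w)\<leftarrow>ps. h v w) \<in> carrier U"
    using ps(1) h by (induction ps)
      (auto simp: bilinear_map_def linear_map_def U.subspace_0 [OF sU] intro!: U.subspace_add [OF sU])
  then show "tlift V W h x \<in> carrier U" using tlift_rep [OF U h ps] by simp
  { fix y assume "y \<in> carrier (V \<otimes> W)"
    then obtain qs where qs: "set qs \<subseteq> carrier V \<times> carrier W" "y = (\<Sum>(v, w)\<leftarrow>qs. tens V W v w)"
      using tensor_rep [OF V] by blast
    show "tlift V W h (x + y) = tlift V W h x + tlift V W h y"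
      using tlift_rep [OF U h ps] tlift_rep [OF U h qs] tlift_rep [OF U h, of "ps @ qs" "x + y"] ps qs
      by simp }
  fix c
  let ?cs = "map (\<lambda>(v, w). (scale V c v, w)) ps"
  have "set ?cs \<subseteq> carrier V \<times> carrier W"
    using ps(1) sV by (auto simp: V.subspace_scale)
  moreover have "fscale c (\<Sum>(v, w)\<leftarrow>ps. tens V W v w) = (\<Sum>(v, w)\<leftarrow>?cs. tens V W v w)"
    using ps(1) bilinear_tens [of V W] by (induction ps)
      (auto simp: fs.scale_right_distrib bilinear_map_def linear_map_def tensor_def)
  moreover have "scale U c (\<Sum>(v, w)\<leftarrow>ps. h v w) = (\<Sum>(v, w)\<leftarrow>?cs. h v w)"
    using ps(1) h by (induction ps)
      (auto simp: U.scale_right_distrib bilinear_map_def linear_map_def)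
  ultimately show "tlift V W h (scale (V \<otimes> W) c x) = scale U c (tlift V W h x)"
    using tlift_rep [OF U h ps] tlift_rep [OF U h, of ?cs "fscale c x"] ps(2)
    by (simp add: tensor_def)
qed

lemma tensor_ext:
  fixes V :: "('k::field, 'v::ab_group_add, 'm) vsp_scheme"
    and W :: "('k, 'w::ab_group_add, 'n) vsp_scheme"
  assumes V: "vspace V" and f: "linear_map (V \<otimes> W) U f" and g: "linear_map (V \<otimes> W) U g"
    and eq: "\<And>v w. v \<in> carrier V \<Longrightarrow> w \<in> carrier W \<Longrightarrow> f (tens V W v w) = g (tens V W v w)"
    and x: "x \<in> carrier (V \<otimes> W)"
  shows "f x = g x"
proof -
  interpret fs: vector_space "fscale :: 'k \<Rightarrow> _" by (rule vector_space_fscale)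
  have s: "fs.subspace (carrier (V \<otimes> W))" using vspace_tensor [of V W]
    by (simp add: vspace_def tensor_def)
  have z: "k 0 = 0" if "linear_map (V \<otimes> W) U k" for k
  proof -
    have "k (0 + 0) = k 0 + k 0" using that fs.subspace_0 [OF s] unfolding linear_map_def by blast
    then show ?thesis by simp
  qed
  obtain ps where ps: "set ps \<subseteq> carrier V \<times> carrier W" "x = (\<Sum>(v, w)\<leftarrow>ps. tens V W v w)"
    using tensor_rep [OF V x] by blast
  have "(\<Sum>(v, w)\<leftarrow>ps. tens V W v w) \<in> carrier (V \<otimes> W) \<and>
    f (\<Sum>(v, w)\<leftarrow>ps. tens V W v w) = g (\<Sum>(v, w)\<leftarrow>ps. tens V W v w)"
    using ps(1)
  proof (induction ps)
    case Nil
    show ?case using z [OF f] z [OF g] fs.subspace_0 [OF s] by (simp add: zero_fun_def)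
  next
    case (Cons p ps)
    obtain v w where p: "p = (v, w)" by force
    let ?t = "tens V W v w" and ?s = "\<Sum>(v, w)\<leftarrow>ps. tens V W v w"
    have 1: "?t \<in> carrier (V \<otimes> W)" "f ?t = g ?t"
      using Cons.prems eq by (auto simp: p intro: tens_carrier)
    have 2: "?s \<in> carrier (V \<otimes> W)" "f ?s = g ?s"
      using Cons by auto
    have "?t + ?s \<in> carrier (V \<otimes> W)"
      using 1 2 by (blast intro: fs.subspace_add [OF s])
    moreover have "f (?t + ?s) = g (?t + ?s)"
    proof -
      have "f (?t + ?s) = f ?t + f ?s" using f 1 2 unfolding linear_map_def by blast
      moreover have "g (?t + ?s) = g ?t + g ?s" using g 1 2 unfolding linear_map_def by blast
      ultimately show ?thesis using 1 2 by metis
    qed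
    moreover have "(\<Sum>(v, w)\<leftarrow>p # ps. tens V W v w) = ?t + ?s"
      by (simp only: p list.map sum_list.Cons prod.case)
    ultimately show ?case by metis
  qed
  then show ?thesis using ps(2) by simp
qed

end

theory Submission
  imports Defs
begin

text \<open>
  The map \<open>T\<close> is by construction an isomorphism onto \<open>C\<close> from the transported structure \<open>C\<^sub>T\<close>, so every
  axiom of \<open>C\<^sub>T\<close> is an axiom of \<open>C\<close> conjugated by \<open>T\<close>, and \<open>T \<otimes> id\<close> carries the L-R-smash product
  of \<open>C\<^sub>T\<close> to that of \<open>C\<close>.  The substance is that \<open>C \<natural> B\<close> is a Hopf algebra for every bimodule
  bialgebra \<open>C\<close> over a cocommutative \<open>B\<close>.  There, each identity on elementary tensors expands into
  Sweedler sums on both sides; since \<open>B\<close> is cocommutative, the legs of an iterated coproduct may be permuted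
  until both sides agree or until the antipode axiom contracts two adjacent legs.
\<close>

section \<open>Linear maps between carriers\<close>

text \<open>All maps are meaningful on carriers only, and the value of a Sweedler sum is independent
  of the chosen list only for bilinear summands. Every rewriting step therefore carries two
  obligations: linearity in each leg, and membership of each term in a carrier. The collections
  \<open>lin\<close>, \<open>closed\<close> and their extensions discharge both by following the
  syntax of the summand. The Hopf structure on the smash product of \<open>C\<^sub>T\<close> is not
  obtained by conjugating that of \<open>C\<close>. The general result is proved for an abstract
  record \<open>H\<close> whose product is prescribed only on the carrier of C \<otimes> B, so it
  applies directly to the record with product \<open>transport_star\<close>, which is known to agree
  with \<open>lr_mult\<close> of the transported data only there. Conjugation is left for
  \<open>C\<^sub>T\<close> itself, for its product and for the closing formulas for coproduct and
  antipode. Cocommutativity acts in a second way besides permuting legs: it makes the antipode of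
  \<open>B\<close> a coalgebra map. This is what allows the last leg of \<open>lr_antipode\<close>,
  which sits under the antipode of \<open>B\<close>, to be split when it is multiplied by another
  element.\<close>

lemma vspace_closed:
  assumes "vspace V"
  shows "0 \<in> carrier V"
    and "x \<in> carrier V \<Longrightarrow> y \<in> carrier V \<Longrightarrow> x + y \<in> carrier V"
    and "x \<in> carrier V \<Longrightarrow> scale V c x \<in> carrier V"
proof -
  interpret vector_space "scale V" using assms by (simp add: vspace_def)
  have s: "subspace (carrier V)" using assms by (simp add: vspace_def)
  show "0 \<in> carrier V" by (rule subspace_0 [OF s])
  show "x \<in> carrier V \<Longrightarrow> y \<in> carrier V \<Longrightarrow> x + y \<in> carrier V" by (rule subspace_add [OF s])
  show "x \<in> carrier V \<Longrightarrow> scale V c x \<in> carrier V" by (rule subspace_scale [OF s])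
qed

lemma vspace_scale:
  assumes "vspace V"
  shows "scale V c (x + y) = scale V c x + scale V c y"
    and "scale V (c + d) x = scale V c x + scale V d x"
    and "scale V c (scale V d x) = scale V (c * d) x"
    and "scale V 1 x = x"
    and "scale V c 0 = 0"
proof -
  interpret vector_space "scale V" using assms by (simp add: vspace_def)
  show "scale V c (x + y) = scale V c x + scale V c y" by (rule scale_right_distrib)
  show "scale V (c + d) x = scale V c x + scale V d x" by (rule scale_left_distrib)
  show "scale V c (scale V d x) = scale V (c * d) x" by (rule scale_scale)
  show "scale V 1 x = x" by (rule scale_one)
  show "scale V c 0 = 0" by (rule scale_zero_right)
qed

lemma vspace_sum_list:
  "vspace V \<Longrightarrow> (\<And>p. p \<in> set ps \<Longrightarrow> f p \<in> carrier V) \<Longrightarrow> (\<Sum>p\<leftarrow>ps. f p) \<in> carrier V"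
  by (induction ps) (auto simp: vspace_closed)

lemma vspace_ground: "vspace ground"
proof -
  interpret vector_space "(*) :: 'a \<Rightarrow> 'a \<Rightarrow> 'a" by unfold_locales (auto simp: algebra_simps)
  show ?thesis by (simp add: vspace_def ground_def vector_space_axioms)
qed

lemma ground_simps [simp]: "carrier ground = UNIV" "scale ground = (*)"
  by (simp_all add: ground_def)

lemma linear_mapD:
  assumes "linear_map V U f"
  shows "x \<in> carrier V \<Longrightarrow> f x \<in> carrier U"
    and "x \<in> carrier V \<Longrightarrow> y \<in> carrier V \<Longrightarrow> f (x + y) = f x + f y"
    and "x \<in> carrier V \<Longrightarrow> f (scale V c x) = scale U c (f x)"
  using assms by (auto simp: linear_map_def)

lemma linear_map_cong:
  assumes "linear_map V U g" "vspace V" "\<And>x. x \<in> carrier V \<Longrightarrow> f x = g x"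
  shows "linear_map V U f"
  using assms by (simp add: linear_map_def vspace_closed)

lemma linear_map_zero:
  assumes "vspace V" "linear_map V U f" shows "f 0 = 0"
  using linear_mapD(2) [OF assms(2), of 0 0] vspace_closed(1) [OF assms(1)] by simp

lemma linear_map_sum_list:
  assumes "vspace V" "linear_map V U f" "\<And>p. p \<in> set ps \<Longrightarrow> g p \<in> carrier V"
  shows "f (\<Sum>p\<leftarrow>ps. g p) = (\<Sum>p\<leftarrow>ps. f (g p))"
  using assms(3)
proof (induction ps)
  case Nil
  show ?case using linear_map_zero [OF assms(1,2)] by simp
next
  case (Cons p ps)
  then have "f (g p + (\<Sum>p\<leftarrow>ps. g p)) = f (g p) + f (\<Sum>p\<leftarrow>ps. g p)"
    by (intro linear_mapD(2) [OF assms(2)] vspace_sum_list [OF assms(1)]) auto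
  with Cons show ?case by simp
qed

lemma linear_map_id: "linear_map V V (\<lambda>x. x)"
  by (simp add: linear_map_def)

lemma linear_map_comp:
  "linear_map V W g \<Longrightarrow> linear_map X V f \<Longrightarrow> linear_map X W (\<lambda>x. g (f x))"
  by (simp add: linear_map_def)

lemma linear_map_sum:
  assumes "vspace U" "\<And>p. p \<in> set ps \<Longrightarrow> linear_map V U (\<lambda>x. f x p)"
  shows "linear_map V U (\<lambda>x. \<Sum>p\<leftarrow>ps. f x p)"
  using assms(2)
proof (induction ps)
  case Nil
  show ?case using assms(1) by (simp add: linear_map_def vspace_closed vspace_scale)
next
  case (Cons p ps)
  then have "linear_map V U (\<lambda>x. \<Sum>p\<leftarrow>ps. f x p)" and "linear_map V U (\<lambda>x. f x p)" by auto
  then show ?case using assms(1)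
    by (auto simp: linear_map_def vspace_closed vspace_scale algebra_simps)
qed

lemma linear_map_scale:
  "vspace U \<Longrightarrow> linear_map V U f \<Longrightarrow> linear_map V U (\<lambda>x. scale U c (f x))"
  by (auto simp: linear_map_def vspace_closed vspace_scale mult.commute)

lemma linear_map_scale_left:
  "vspace U \<Longrightarrow> linear_map V ground f \<Longrightarrow> u \<in> carrier U \<Longrightarrow> linear_map V U (\<lambda>x. scale U (f x) u)"
  by (auto simp: linear_map_def vspace_closed vspace_scale)

lemma linear_map_times:
  "linear_map V ground f \<Longrightarrow> linear_map V ground (\<lambda>x. c * f x)"
  "linear_map V ground f \<Longrightarrow> linear_map V ground (\<lambda>x. f x * c)"
  by (auto simp: linear_map_def algebra_simps)

section \<open>Bilinear maps and the maps they induce on tensor products\<close>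

lemma bilinear_mapI:
  assumes "\<And>v. v \<in> carrier V \<Longrightarrow> linear_map W U (\<lambda>w. h v w)"
    and "\<And>w. w \<in> carrier W \<Longrightarrow> linear_map V U (\<lambda>v. h v w)"
  shows "bilinear_map V W U h"
  using assms by (simp add: bilinear_map_def)

lemma bilinear_map_linear:
  assumes "bilinear_map V W U h"
  shows "linear_map X V f \<Longrightarrow> w \<in> carrier W \<Longrightarrow> linear_map X U (\<lambda>x. h (f x) w)"
    and "v \<in> carrier V \<Longrightarrow> linear_map X W g \<Longrightarrow> linear_map X U (\<lambda>x. h v (g x))"
  using assms linear_map_comp [of V U "\<lambda>v. h v w" X f] linear_map_comp [of W U "h v" X g]
  by (auto simp: bilinear_map_def)

lemma bilinear_map_closed:
  "bilinear_map V W U h \<Longrightarrow> v \<in> carrier V \<Longrightarrow> w \<in> carrier W \<Longrightarrow> h v w \<in> carrier U"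
  by (auto simp: bilinear_map_def linear_map_def)

lemmas linear_map_tens = bilinear_map_linear [OF bilinear_tens]

text \<open>Here the tensor \<open>t\<close> is fixed and the bilinear map varies with
  \<open>x\<close>. One list representing \<open>t\<close> serves every \<open>x\<close>, so the
  value is a finite sum of terms linear in \<open>x\<close>. The opposite case, a fixed map and a
  varying tensor, is \<open>linear_tlift\<close>.\<close>

lemma linear_map_tlift:
  assumes "vspace V" "vspace U"
    and "\<And>v w. v \<in> carrier V \<Longrightarrow> w \<in> carrier W \<Longrightarrow> linear_map X U (\<lambda>x. h x v w)"
    and "\<And>x. x \<in> carrier X \<Longrightarrow> bilinear_map V W U (h x)"
    and "vspace X" "t \<in> carrier (V \<otimes> W)"
  shows "linear_map X U (\<lambda>x. tlift V W (h x) t)"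
proof -
  obtain ps where ps: "set ps \<subseteq> carrier V \<times> carrier W" "t = (\<Sum>(v, w)\<leftarrow>ps. tens V W v w)"
    using tensor_rep [OF assms(1,6)] by blast
  have "linear_map X U (\<lambda>x. \<Sum>(v, w)\<leftarrow>ps. h x v w)"
    using ps(1) by (auto intro!: linear_map_sum assms)
  then show ?thesis
    by (rule linear_map_cong) (simp_all add: assms(5) tlift_rep [OF assms(2) assms(4) ps])
qed

lemma tensor_ext2:
  assumes "vspace V" "vspace V'"
    and "bilinear_map (V \<otimes> W) (V' \<otimes> W') U f" "bilinear_map (V \<otimes> W) (V' \<otimes> W') U g"
    and "\<And>v w v' w'. v \<in> carrier V \<Longrightarrow> w \<in> carrier W \<Longrightarrow> v' \<in> carrier V' \<Longrightarrow> w' \<in> carrier W' \<Longrightarrow>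
      f (tens V W v w) (tens V' W' v' w') = g (tens V W v w) (tens V' W' v' w')"
    and "x \<in> carrier (V \<otimes> W)" "y \<in> carrier (V' \<otimes> W')"
  shows "f x y = g x y"
proof -
  have 1: "f (tens V W v w) y = g (tens V W v w) y" if vw: "v \<in> carrier V" "w \<in> carrier W" for v w
  proof (rule tensor_ext [OF assms(2) _ _ _ assms(7)])
    show "linear_map (V' \<otimes> W') U (f (tens V W v w))" "linear_map (V' \<otimes> W') U (g (tens V W v w))"
      using assms(3,4) tens_carrier [OF vw] by (auto simp: bilinear_map_def)
  qed (rule assms(5) [OF vw])
  show ?thesis
  proof (rule tensor_ext [where f = "\<lambda>x. f x y" and g = "\<lambda>x. g x y", OF assms(1) _ _ 1 assms(6)])
    show "linear_map (V \<otimes> W) U (\<lambda>x. f x y)" "linear_map (V \<otimes> W) U (\<lambda>x. g x y)"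
      using assms(3,4,7) by (auto simp: bilinear_map_def)
  qed
qed

text \<open>The definite description behind \<open>tlift\<close> evaluates \<open>h\<close> only at
  pairs from the carriers, so both sides describe the same element, whatever \<open>x\<close>
  is.\<close>

lemma tlift_cong:
  assumes "\<And>v w. v \<in> carrier V \<Longrightarrow> w \<in> carrier W \<Longrightarrow> h v w = h' v w"
  shows "tlift V W h x = tlift V W h' x"
proof -
  have *: "(\<Sum>(v, w)\<leftarrow>ps. h v w) = (\<Sum>(v, w)\<leftarrow>ps. h' v w)"
    if "set ps \<subseteq> carrier V \<times> carrier W" for ps
    using that assms by (intro arg_cong [of _ _ sum_list] map_cong refl) auto
  show ?thesis unfolding tlift_def by (metis (no_types, lifting) *)
qed

text \<open>Two nested lifts of a map that is bilinear in each of its two pairs of arguments. Both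
  \<open>flip23\<close> and the smash product have this shape.\<close>

lemma bilinear_tlift_tlift:
  assumes V: "vspace V" and W: "vspace W" and V': "vspace V'" and U: "vspace U"
    and k: "\<And>v w. v \<in> carrier V \<Longrightarrow> w \<in> carrier W \<Longrightarrow> bilinear_map V' W' U (k v w)"
    and k': "\<And>v' w'. v' \<in> carrier V' \<Longrightarrow> w' \<in> carrier W' \<Longrightarrow> bilinear_map V W U (\<lambda>v w. k v w v' w')"
  shows "bilinear_map (V \<otimes> W) (V' \<otimes> W') U (\<lambda>x y. tlift V W (\<lambda>v w. tlift V' W' (k v w) y) x)"
    and "v \<in> carrier V \<Longrightarrow> w \<in> carrier W \<Longrightarrow> y \<in> carrier (V' \<otimes> W') \<Longrightarrow>
      tlift V W (\<lambda>v w. tlift V' W' (k v w) y) (tens V W v w) = tlift V' W' (k v w) y"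
proof -
  have 1: "linear_map (V' \<otimes> W') U (tlift V' W' (k v w))" if "v \<in> carrier V" "w \<in> carrier W" for v w
    using that by (intro linear_tlift V' U k)
  have 2: "bilinear_map V W U (\<lambda>v w. tlift V' W' (k v w) y)" if "y \<in> carrier (V' \<otimes> W')" for y
    using that k' by (intro bilinear_mapI linear_map_tlift V W V' U k) (auto simp: bilinear_map_def)
  show "bilinear_map (V \<otimes> W) (V' \<otimes> W') U (\<lambda>x y. tlift V W (\<lambda>v w. tlift V' W' (k v w) y) x)"
    by (intro bilinear_mapI linear_tlift linear_map_tlift 1 2 V U vspace_tensor)
  show "tlift V W (\<lambda>v w. tlift V' W' (k v w) y) (tens V W v w) = tlift V' W' (k v w) y"
    if "v \<in> carrier V" "w \<in> carrier W" "y \<in> carrier (V' \<otimes> W')"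
    by (rule tlift_tens [OF U 2 [OF that(3)] that(1,2)])
qed

text \<open>Tensor constructions see a record only through its carrier and scaling. The transported
  \<open>C\<^sub>T\<close> shares these with \<open>C\<close>, and the smash product record shares
  them with C \<otimes> B, so tensors over the different records can be identified.\<close>

lemma tensor_vsp_cong:
  assumes "carrier V = carrier V'" "scale V = scale V'" "carrier W = carrier W'" "scale W = scale W'"
  shows "tens V W = tens V' W'" "V \<otimes> W = V' \<otimes> W'" "tlift V W = tlift V' W'"
proof -
  have b: "bilinear_map V W ground = bilinear_map V' W' ground"
    using assms by (auto simp: bilinear_map_def linear_map_def fun_eq_iff)
  show t: "tens V W = tens V' W'" by (simp add: tens_def b fun_eq_iff)
  show "V \<otimes> W = V' \<otimes> W'" "tlift V W = tlift V' W'"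
    by (simp_all add: tensor_def tlift_def t assms fun_eq_iff)
qed

lemma tmap_tens:
  assumes "linear_map V V' f" "linear_map W W' g" "v \<in> carrier V" "w \<in> carrier W"
  shows "tmap V W V' W' f g (tens V W v w) = tens V' W' (f v) (g w)"
  unfolding tmap_def using assms
  by (intro tlift_tens [OF vspace_tensor [of V' W']])
    (auto intro!: bilinear_mapI linear_map_tens simp: linear_mapD)

lemma linear_tmap:
  assumes "vspace V" "linear_map V V' f" "linear_map W W' g"
  shows "linear_map (V \<otimes> W) (V' \<otimes> W') (tmap V W V' W' f g)"
  unfolding tmap_def using assms
  by (intro linear_tlift vspace_tensor)
    (auto intro!: bilinear_mapI linear_map_tens simp: linear_mapD)

lemma flip23_tens:
  assumes V: "vspace V" and W: "vspace W"
  shows "linear_map ((V \<otimes> V) \<otimes> (W \<otimes> W)) ((V \<otimes> W) \<otimes> (V \<otimes> W)) (flip23 V W)"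
    and "x \<in> carrier (V \<otimes> V) \<Longrightarrow> y \<in> carrier (W \<otimes> W) \<Longrightarrow>
      flip23 V W (tens (V \<otimes> V) (W \<otimes> W) x y) = tlift V V (\<lambda>v1 v2. tlift W W (\<lambda>w1 w2.
       tens (V \<otimes> W) (V \<otimes> W) (tens V W v1 w1) (tens V W v2 w2)) y) x"
proof -
  have b: "bilinear_map (V \<otimes> V) (W \<otimes> W) ((V \<otimes> W) \<otimes> (V \<otimes> W))
    (\<lambda>x y. tlift V V (\<lambda>v1 v2. tlift W W (\<lambda>w1 w2.
       tens (V \<otimes> W) (V \<otimes> W) (tens V W v1 w1) (tens V W v2 w2)) y) x)"
    by (intro bilinear_tlift_tlift V W vspace_tensor bilinear_mapI linear_map_tens linear_map_id tens_carrier)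
  show "linear_map ((V \<otimes> V) \<otimes> (W \<otimes> W)) ((V \<otimes> W) \<otimes> (V \<otimes> W)) (flip23 V W)"
    unfolding flip23_def by (intro linear_tlift vspace_tensor b)
  show "x \<in> carrier (V \<otimes> V) \<Longrightarrow> y \<in> carrier (W \<otimes> W) \<Longrightarrow>
      flip23 V W (tens (V \<otimes> V) (W \<otimes> W) x y) = tlift V V (\<lambda>v1 v2. tlift W W (\<lambda>w1 w2.
       tens (V \<otimes> W) (V \<otimes> W) (tens V W v1 w1) (tens V W v2 w2)) y) x"
    unfolding flip23_def by (intro tlift_tens [OF vspace_tensor b])
qed

section \<open>Sweedler sums\<close>

text \<open>Fixing one list of elementary tensors for each coproduct turns \<open>\<Sum> h a\<^sub>(\<^sub>1\<^sub>) a\<^sub>(\<^sub>2\<^sub>)\<close> into a plain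
  finite sum.  Its value is independent of the choice only if \<open>h\<close> is bilinear, but sums may be
  interchanged without any linearity.\<close>

definition coprod_list ::
  "('k::field, 'v::ab_group_add, 'm) bialg_scheme \<Rightarrow> 'v \<Rightarrow> ('v \<times> 'v) list" where
  "coprod_list A a =
     (if \<exists>ps. set ps \<subseteq> carrier A \<times> carrier A \<and> comult A a = (\<Sum>(x, y)\<leftarrow>ps. tens A A x y)
      then SOME ps. set ps \<subseteq> carrier A \<times> carrier A \<and> comult A a = (\<Sum>(x, y)\<leftarrow>ps. tens A A x y)
      else [])"

definition sweedler ::
  "('k::field, 'v::ab_group_add, 'm) bialg_scheme \<Rightarrow> 'v \<Rightarrow> ('v \<Rightarrow> 'v \<Rightarrow> 'u::ab_group_add) \<Rightarrow> 'u" where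
  "sweedler A a h = (\<Sum>(x, y)\<leftarrow>coprod_list A a. h x y)"

text \<open>The fallback \<open>[]\<close> makes this unconditional: bound legs lie in the carrier
  even where \<open>comult A a\<close> has no representation by elementary tensors.\<close>

lemma coprod_list_carrier: "set (coprod_list A a) \<subseteq> carrier A \<times> carrier A"
  unfolding coprod_list_def by (auto dest: someI_ex) (metis (mono_tags, lifting) someI_ex SigmaD1 subsetD,
   metis (mono_tags, lifting) someI_ex SigmaD2 subsetD)

text \<open>As a congruence rule this hands the simplifier the carrier memberships of the bound
  legs, so that conditional algebra laws can fire underneath Sweedler sums.\<close>

lemma sweedler_cong [cong]:
  assumes "A = A'" "a = a'" "\<And>x y. x \<in> carrier A \<Longrightarrow> y \<in> carrier A \<Longrightarrow> h x y = h' x y"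
  shows "sweedler A a h = sweedler A' a' h'"
  unfolding sweedler_def assms(1,2) [symmetric] using coprod_list_carrier [of A a] assms(3)
  by (intro arg_cong [of _ _ sum_list] map_cong refl) auto

lemmas sweedler_cong' = sweedler_cong [OF refl refl]

lemma sweedler_closed:
  assumes "vspace U" "\<And>x y. x \<in> carrier A \<Longrightarrow> y \<in> carrier A \<Longrightarrow> h x y \<in> carrier U"
  shows "sweedler A a h \<in> carrier U"
  unfolding sweedler_def using coprod_list_carrier [of A a] assms(2)
  by (auto intro!: vspace_sum_list [OF assms(1)])

lemma linear_sweedler:
  assumes "linear_map V U f" "vspace V" "\<And>x y. x \<in> carrier A \<Longrightarrow> y \<in> carrier A \<Longrightarrow> h x y \<in> carrier V"
  shows "f (sweedler A a h) = sweedler A a (\<lambda>x y. f (h x y))"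
proof -
  have "f (sweedler A a h) = (\<Sum>p\<leftarrow>coprod_list A a. f (case p of (x, y) \<Rightarrow> h x y))"
    unfolding sweedler_def using coprod_list_carrier [of A a] assms(3)
    by (intro linear_map_sum_list [OF assms(2,1)]) auto
  then show ?thesis by (simp add: sweedler_def case_prod_unfold)
qed

lemma sweedler_swap:
  "sweedler A a (\<lambda>x y. sweedler A' b (\<lambda>u v. h x y u v)) =
   sweedler A' b (\<lambda>u v. sweedler A a (\<lambda>x y. h x y u v))"
proof -
  have "(\<Sum>p\<leftarrow>ps. \<Sum>q\<leftarrow>qs. f p q) = (\<Sum>q\<leftarrow>qs. \<Sum>p\<leftarrow>ps. f p q)"
    for ps :: "'p list" and qs :: "'q list" and f :: "_ \<Rightarrow> _ \<Rightarrow> 'r::ab_group_add"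
    by (induction ps) (simp_all add: sum_list_addf)
  then show ?thesis by (simp add: sweedler_def case_prod_unfold)
qed

text \<open>The list of the inner sum depends on \<open>w\<close>, so the two sums over the legs of
  \<open>a\<close> must stay nested; the sum over \<open>b\<close> is carried past both at once. The
  primed variant does the same when the left leg is the one split again.\<close>

lemma sweedler_swap2:
  "sweedler A a (\<lambda>x w. sweedler A w (\<lambda>y z. sweedler A' b (\<lambda>u v. h x y z u v))) =
   sweedler A' b (\<lambda>u v. sweedler A a (\<lambda>x w. sweedler A w (\<lambda>y z. h x y z u v)))"
  by (subst (2) sweedler_swap, intro sweedler_cong' sweedler_swap)

lemma sweedler_swap2':
  "sweedler A a (\<lambda>w z. sweedler A w (\<lambda>x y. sweedler A' b (\<lambda>u v. h x y z u v))) =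
   sweedler A' b (\<lambda>u v. sweedler A a (\<lambda>w z. sweedler A w (\<lambda>x y. h x y z u v)))"
  by (subst (2) sweedler_swap, intro sweedler_cong' sweedler_swap)

section \<open>Linearity of Sweedler sums\<close>

lemma linear_map_sweedler_fun:
  assumes "\<And>p q. p \<in> carrier A \<Longrightarrow> q \<in> carrier A \<Longrightarrow> linear_map X U (\<lambda>x. h x p q)" "vspace U"
  shows "linear_map X U (\<lambda>x. sweedler A a (\<lambda>p q. h x p q))"
  unfolding sweedler_def using coprod_list_carrier [of A a] assms
  by (auto intro!: linear_map_sum)

text \<open>The fragment of the coalgebra axioms that makes Sweedler sums compute the coproduct. The
  coalgebra axioms for the smash product and for \<open>C\<^sub>T\<close> are themselves proved by
  Sweedler calculations, so the calculus has to be available before them.\<close>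

definition precoalgebra :: "('k::field, 'v::ab_group_add, 'm) bialg_scheme \<Rightarrow> bool" where
  "precoalgebra A \<longleftrightarrow> vspace A \<and> linear_map A (A \<otimes> A) (comult A)"

lemma comult_coprod_list:
  assumes "precoalgebra A" "a \<in> carrier A"
  shows "comult A a = (\<Sum>(x, y)\<leftarrow>coprod_list A a. tens A A x y)"
proof -
  have "\<exists>ps. set ps \<subseteq> carrier A \<times> carrier A \<and> comult A a = (\<Sum>(x, y)\<leftarrow>ps. tens A A x y)"
    using assms by (metis precoalgebra_def linear_mapD(1) tensor_rep)
  from someI_ex [OF this] this show ?thesis by (simp add: coprod_list_def)
qed

lemma tlift_comult:
  assumes "precoalgebra A" "vspace U" "bilinear_map A A U h" "a \<in> carrier A"
  shows "tlift A A h (comult A a) = sweedler A a h"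
  unfolding sweedler_def
  by (rule tlift_rep [OF assms(2,3) coprod_list_carrier comult_coprod_list [OF assms(1,4)]])

lemma comult_sweedler:
  "precoalgebra A \<Longrightarrow> a \<in> carrier A \<Longrightarrow> comult A a = sweedler A a (tens A A)"
  by (simp add: comult_coprod_list sweedler_def)

text \<open>When the element being split varies, the chosen lists do not depend on it linearly. The
  sum is therefore replaced by the linear map \<open>tlift A A h\<close> applied to the coproduct,
  which is where bilinearity of \<open>h\<close> enters; in \<open>linear_map_sweedler_fun\<close>
  the list is fixed and termwise linearity suffices.\<close>

lemma linear_map_sweedler:
  assumes "precoalgebra A" "linear_map X A f"
    and "\<And>y. y \<in> carrier A \<Longrightarrow> linear_map A U (\<lambda>x. h x y)"
    and "\<And>x. x \<in> carrier A \<Longrightarrow> linear_map A U (\<lambda>y. h x y)"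
    and "vspace U" "vspace X"
  shows "linear_map X U (\<lambda>x. sweedler A (f x) h)"
proof -
  have h: "bilinear_map A A U h" using assms by (auto intro: bilinear_mapI)
  have "linear_map A U (\<lambda>x. tlift A A h (comult A x))"
    using assms(1,5) h by (intro linear_map_comp [OF linear_tlift]) (auto simp: precoalgebra_def)
  then have "linear_map A U (\<lambda>x. sweedler A x h)"
    using assms(1) by (elim linear_map_cong)
      (simp_all add: precoalgebra_def tlift_comult [OF assms(1,5) h])
  then show ?thesis by (rule linear_map_comp) (rule assms(2))
qed

lemma coalgebra_precoalgebra: "coalgebra A \<Longrightarrow> precoalgebra A"
  by (simp add: coalgebra_def precoalgebra_def)

section \<open>Coassociativity, counit and cocommutativity in Sweedler form\<close>

text \<open>Both composites of the coassociativity axiom become nested sums of the universal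
  trilinear expression u \<otimes> (v \<otimes> z). The translation is read one way to extract
  \<open>sweedler_coassoc\<close> from a coalgebra, and the other way to obtain
  \<open>coalgebraI\<close>.\<close>

lemma comult_assoc_sweedler:
  assumes A: "precoalgebra A" and a: "a \<in> carrier A"
  shows "tassoc A A A (tmap A A (A \<otimes> A) A (comult A) id (comult A a)) =
      sweedler A a (\<lambda>x z. sweedler A x (\<lambda>u v. tens A (A \<otimes> A) u (tens A A v z)))" (is ?L)
    and "tmap A A A (A \<otimes> A) id (comult A) (comult A a) =
      sweedler A a (\<lambda>u y. sweedler A y (\<lambda>v z. tens A (A \<otimes> A) u (tens A A v z)))" (is ?R)
proof -
  have v: "vspace A" and c: "linear_map A (A \<otimes> A) (comult A)"
    using A by (auto simp: precoalgebra_def)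
  note lin = linear_map_tens linear_map_id linear_map_comp [OF c]
  let ?g = "\<lambda>x z. tlift A A (\<lambda>u v. tens A (A \<otimes> A) u (tens A A v z)) x"
  have g: "bilinear_map (A \<otimes> A) A (A \<otimes> (A \<otimes> A)) ?g"
  proof (rule bilinear_mapI)
    fix x assume "x \<in> carrier (A \<otimes> A)"
    then show "linear_map A (A \<otimes> (A \<otimes> A)) (?g x)"
      by (intro linear_map_tlift bilinear_mapI lin)
        (auto simp: vspace_tensor tens_carrier v)
  next
    fix z assume "z \<in> carrier A"
    then show "linear_map (A \<otimes> A) (A \<otimes> (A \<otimes> A)) (\<lambda>x. ?g x z)"
      by (intro linear_tlift bilinear_mapI lin) (auto simp: vspace_tensor tens_carrier v)
  qed
  have 1: "tmap A A (A \<otimes> A) A (comult A) id (comult A a) =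
      sweedler A a (\<lambda>x z. tens (A \<otimes> A) A (comult A x) z)"
    unfolding tmap_def id_apply
    by (intro tlift_comult [OF A _ _ a, where U = "(A \<otimes> A) \<otimes> A"] bilinear_mapI lin)
      (auto simp: vspace_tensor linear_mapD(1) [OF c])
  have "tassoc A A A (tmap A A (A \<otimes> A) A (comult A) id (comult A a)) =
      sweedler A a (\<lambda>x z. ?g (comult A x) z)"
    unfolding 1 tassoc_def
    by (subst linear_sweedler [OF linear_tlift [OF vspace_tensor vspace_tensor g]])
      (auto simp: vspace_tensor tens_carrier linear_mapD(1) [OF c] tlift_tens [OF vspace_tensor g]
       cong: sweedler_cong)
  also have "\<dots> = sweedler A a (\<lambda>x z. sweedler A x (\<lambda>u v. tens A (A \<otimes> A) u (tens A A v z)))"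
    by (intro sweedler_cong refl tlift_comult [OF A, where U = "A \<otimes> (A \<otimes> A)"]
        bilinear_mapI lin)
      (auto simp: vspace_tensor tens_carrier)
  finally show ?L .
  have "tmap A A A (A \<otimes> A) id (comult A) (comult A a) =
      sweedler A a (\<lambda>u y. tens A (A \<otimes> A) u (comult A y))"
    unfolding tmap_def id_apply
    by (intro tlift_comult [OF A _ _ a, where U = "A \<otimes> (A \<otimes> A)"] bilinear_mapI lin)
      (auto simp: vspace_tensor linear_mapD(1) [OF c])
  also have "\<dots> = sweedler A a (\<lambda>u y. sweedler A y (\<lambda>v z. tens A (A \<otimes> A) u (tens A A v z)))"
  proof (intro sweedler_cong refl)
    fix u y assume *: "u \<in> carrier A" "y \<in> carrier A"
    have "linear_map (A \<otimes> A) (A \<otimes> (A \<otimes> A)) (tens A (A \<otimes> A) u)"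
      using * by (intro lin)
    then show "tens A (A \<otimes> A) u (comult A y) = sweedler A y (\<lambda>v z. tens A (A \<otimes> A) u (tens A A v z))"
      using * by (simp add: comult_sweedler [OF A] linear_sweedler vspace_tensor tens_carrier)
  qed
  finally show ?R .
qed

lemma coalgebraI:
  assumes A: "precoalgebra A" "linear_map A ground (counit A)"
    and "\<And>a. a \<in> carrier A \<Longrightarrow>
      sweedler A a (\<lambda>x z. sweedler A x (\<lambda>u v. tens A (A \<otimes> A) u (tens A A v z))) =
      sweedler A a (\<lambda>u y. sweedler A y (\<lambda>v z. tens A (A \<otimes> A) u (tens A A v z)))"
    and "\<And>a. a \<in> carrier A \<Longrightarrow> sweedler A a (\<lambda>x y. scale A (counit A x) y) = a"
    and "\<And>a. a \<in> carrier A \<Longrightarrow> sweedler A a (\<lambda>x y. scale A (counit A y) x) = a"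
  shows "coalgebra A"
proof -
  have v: "vspace A" and c: "linear_map A (A \<otimes> A) (comult A)"
    using A by (auto simp: precoalgebra_def)
  have "bilinear_map A A A (\<lambda>x y. scale A (counit A x) y)"
    "bilinear_map A A A (\<lambda>x y. scale A (counit A y) x)"
    by (auto intro!: bilinear_mapI linear_map_scale linear_map_scale_left linear_map_id v
        linear_map_comp [OF A(2)])
  then show ?thesis
    using assms v c by (simp add: coalgebra_def comult_assoc_sweedler tlift_comult)
qed

text \<open>A trilinear \<open>h\<close> factors through the universal trilinear map by a linear
  \<open>?f\<close> on A \<otimes> (A \<otimes> A). Applying \<open>?f\<close> to the
  coassociativity axiom gives the identity for \<open>h\<close>.\<close>

lemma sweedler_coassoc:
  assumes A: "coalgebra A" and U: "vspace U" and a: "a \<in> carrier A"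
    and h1: "\<And>y z. y \<in> carrier A \<Longrightarrow> z \<in> carrier A \<Longrightarrow> linear_map A U (\<lambda>x. h x y z)"
    and h2: "\<And>x z. x \<in> carrier A \<Longrightarrow> z \<in> carrier A \<Longrightarrow> linear_map A U (\<lambda>y. h x y z)"
    and h3: "\<And>x y. x \<in> carrier A \<Longrightarrow> y \<in> carrier A \<Longrightarrow> linear_map A U (\<lambda>z. h x y z)"
  shows "sweedler A a (\<lambda>w z. sweedler A w (\<lambda>x y. h x y z)) =
         sweedler A a (\<lambda>x w. sweedler A w (\<lambda>y z. h x y z))"
proof -
  have p: "precoalgebra A" and v: "vspace A"
    using A by (auto simp: coalgebra_def precoalgebra_def)
  have b: "bilinear_map A A U (h x)" if "x \<in> carrier A" for x
    using that by (intro bilinear_mapI h2 h3)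
  have g: "bilinear_map A (A \<otimes> A) U (\<lambda>x. tlift A A (h x))"
    by (intro bilinear_mapI linear_tlift linear_map_tlift v U b h1) auto
  let ?f = "tlift A (A \<otimes> A) (\<lambda>x. tlift A A (h x))"
  have f: "linear_map (A \<otimes> (A \<otimes> A)) U ?f" by (rule linear_tlift [OF v U g])
  have e: "?f (tens A (A \<otimes> A) x (tens A A y z)) = h x y z"
    if "x \<in> carrier A" "y \<in> carrier A" "z \<in> carrier A" for x y z
    using that by (simp add: tlift_tens [OF U g] tens_carrier tlift_tens [OF U b])
  have "?f (sweedler A a (\<lambda>x z. sweedler A x (\<lambda>u v. tens A (A \<otimes> A) u (tens A A v z)))) =
      sweedler A a (\<lambda>w z. sweedler A w (\<lambda>x y. h x y z))"
    by (simp add: linear_sweedler [OF f] vspace_tensor sweedler_closed tens_carrier e)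
  moreover have "?f (sweedler A a (\<lambda>u y. sweedler A y (\<lambda>v z. tens A (A \<otimes> A) u (tens A A v z)))) =
      sweedler A a (\<lambda>x w. sweedler A w (\<lambda>y z. h x y z))"
    by (simp add: linear_sweedler [OF f] vspace_tensor sweedler_closed tens_carrier e)
  moreover have "sweedler A a (\<lambda>x z. sweedler A x (\<lambda>u v. tens A (A \<otimes> A) u (tens A A v z))) =
      sweedler A a (\<lambda>u y. sweedler A y (\<lambda>v z. tens A (A \<otimes> A) u (tens A A v z)))"
    using A a by (simp add: coalgebra_def comult_assoc_sweedler [OF p, symmetric])
  ultimately show ?thesis by simp
qed

lemma sweedler_counit:
  assumes A: "coalgebra A" and h: "linear_map A U h" and a: "a \<in> carrier A"
  shows "sweedler A a (\<lambda>x y. scale U (counit A x) (h y)) = h a"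
    and "sweedler A a (\<lambda>x y. scale U (counit A y) (h x)) = h a"
proof -
  have p: "precoalgebra A" and v: "vspace A" and c: "linear_map A ground (counit A)"
    using A by (auto simp: coalgebra_def precoalgebra_def)
  have b: "bilinear_map A A A (\<lambda>x y. scale A (counit A x) y)"
    "bilinear_map A A A (\<lambda>x y. scale A (counit A y) x)"
    by (auto intro!: bilinear_mapI linear_map_scale linear_map_scale_left linear_map_id v
        linear_map_comp [OF c])
  have "sweedler A a (\<lambda>x y. scale A (counit A x) y) = a"
    "sweedler A a (\<lambda>x y. scale A (counit A y) x) = a"
    using A a by (simp_all add: coalgebra_def tlift_comult [OF p v b(1), symmetric]
        tlift_comult [OF p v b(2), symmetric])
  then have "h a = h (sweedler A a (\<lambda>x y. scale A (counit A x) y))"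
    "h a = h (sweedler A a (\<lambda>x y. scale A (counit A y) x))" by simp_all
  then show "sweedler A a (\<lambda>x y. scale U (counit A x) (h y)) = h a"
    and "sweedler A a (\<lambda>x y. scale U (counit A y) (h x)) = h a"
    by (simp_all add: linear_sweedler [OF h v] vspace_closed [OF v] linear_mapD(3) [OF h])
qed

text \<open>The linear map induced by \<open>h\<close> is applied to the equality of the coproduct
  with its flip.\<close>

lemma sweedler_commute:
  assumes "precoalgebra A" "cocommutative A" "vspace U" "a \<in> carrier A"
    and "\<And>y. y \<in> carrier A \<Longrightarrow> linear_map A U (\<lambda>x. h x y)"
    and "\<And>x. x \<in> carrier A \<Longrightarrow> linear_map A U (\<lambda>y. h x y)"
  shows "sweedler A a (\<lambda>x y. h y x) = sweedler A a h"
proof -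
  have h: "bilinear_map A A U h" using assms by (auto intro: bilinear_mapI)
  have v: "vspace A" using assms by (simp add: precoalgebra_def)
  have "comult A a = tswap A A (comult A a)" using assms by (simp add: cocommutative_def)
  also have "\<dots> = sweedler A a (\<lambda>v w. tens A A w v)"
    unfolding tswap_def
    by (intro tlift_comult [where U = "A \<otimes> A"] assms vspace_tensor bilinear_mapI linear_map_tens
        linear_map_id)
  finally have "tlift A A h (comult A a) = tlift A A h (sweedler A a (\<lambda>v w. tens A A w v))" by simp
  also have "\<dots> = sweedler A a (\<lambda>x y. h y x)"
    by (simp add: linear_sweedler [OF linear_tlift [OF v assms(3) h]] vspace_tensor tens_carrier
      tlift_tens [OF assms(3) h])
  finally show ?thesis by (simp only: tlift_comult [OF assms(1,3) h assms(4)])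
qed

text \<open>In the balanced fourfold coproduct the two middle legs belong to different halves.
  Rebracketing makes them the legs of one element, where cocommutativity exchanges them, and the
  bracketing is then restored. This is the permutation behind multiplicativity of the coproduct and
  behind both antipode identities.\<close>

lemma sweedler_middle:
  assumes A: "coalgebra A" and cc: "cocommutative A" and U: "vspace U" and a: "a \<in> carrier A"
    and h1: "\<And>x y z. x \<in> carrier A \<Longrightarrow> y \<in> carrier A \<Longrightarrow> z \<in> carrier A \<Longrightarrow> linear_map A U (\<lambda>w. h w x y z)"
    and h2: "\<And>x y z. x \<in> carrier A \<Longrightarrow> y \<in> carrier A \<Longrightarrow> z \<in> carrier A \<Longrightarrow> linear_map A U (\<lambda>w. h x w y z)"
    and h3: "\<And>x y z. x \<in> carrier A \<Longrightarrow> y \<in> carrier A \<Longrightarrow> z \<in> carrier A \<Longrightarrow> linear_map A U (\<lambda>w. h x y w z)"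
    and h4: "\<And>x y z. x \<in> carrier A \<Longrightarrow> y \<in> carrier A \<Longrightarrow> z \<in> carrier A \<Longrightarrow> linear_map A U (\<lambda>w. h x y z w)"
  shows "sweedler A a (\<lambda>s t. sweedler A s (\<lambda>p q. sweedler A t (\<lambda>u v. h p q u v))) =
         sweedler A a (\<lambda>s t. sweedler A s (\<lambda>p q. sweedler A t (\<lambda>u v. h p u q v)))"
proof -
  have P: "precoalgebra A" and V: "vspace A" using A by (auto simp: coalgebra_def precoalgebra_def)
  \<comment> \<open>The rebracketing is proved for an arbitrary summand \<open>k\<close> because it
    is used twice: forwards for \<open>h\<close>, and backwards for \<open>h\<close> with its middle
    arguments exchanged.\<close>
  have *: "sweedler A a (\<lambda>s t. sweedler A s (\<lambda>p q. sweedler A t (\<lambda>u v. k p q u v))) =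
      sweedler A a (\<lambda>p t. sweedler A t (\<lambda>s v. sweedler A s (\<lambda>q u. k p q u v)))"
    if k1: "\<And>x y z. x \<in> carrier A \<Longrightarrow> y \<in> carrier A \<Longrightarrow> z \<in> carrier A \<Longrightarrow> linear_map A U (\<lambda>w. k w x y z)"
    and k2: "\<And>x y z. x \<in> carrier A \<Longrightarrow> y \<in> carrier A \<Longrightarrow> z \<in> carrier A \<Longrightarrow> linear_map A U (\<lambda>w. k x w y z)"
    and k3: "\<And>x y z. x \<in> carrier A \<Longrightarrow> y \<in> carrier A \<Longrightarrow> z \<in> carrier A \<Longrightarrow> linear_map A U (\<lambda>w. k x y w z)"
    and k4: "\<And>x y z. x \<in> carrier A \<Longrightarrow> y \<in> carrier A \<Longrightarrow> z \<in> carrier A \<Longrightarrow> linear_map A U (\<lambda>w. k x y z w)"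
    for k
  proof -
    have "sweedler A a (\<lambda>s t. sweedler A s (\<lambda>p q. sweedler A t (\<lambda>u v. k p q u v))) =
        sweedler A a (\<lambda>p w. sweedler A w (\<lambda>q t. sweedler A t (\<lambda>u v. k p q u v)))"
      by (intro sweedler_coassoc [OF A U a] linear_map_sweedler_fun
          linear_map_sweedler [OF P] linear_map_id k1 k2 k3 k4 U V)
    also have "\<dots> = sweedler A a (\<lambda>p t. sweedler A t (\<lambda>s v. sweedler A s (\<lambda>q u. k p q u v)))"
      by (intro sweedler_cong refl sweedler_coassoc [OF A U, symmetric] k1 k2 k3 k4)
    finally show ?thesis .
  qed
  have "sweedler A a (\<lambda>s t. sweedler A s (\<lambda>p q. sweedler A t (\<lambda>u v. h p q u v))) =
      sweedler A a (\<lambda>p t. sweedler A t (\<lambda>s v. sweedler A s (\<lambda>q u. h p q u v)))"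
    by (intro * h1 h2 h3 h4)
  also have "\<dots> = sweedler A a (\<lambda>p t. sweedler A t (\<lambda>s v. sweedler A s (\<lambda>q u. h p u q v)))"
    by (intro sweedler_cong refl sweedler_commute [OF P cc U, symmetric] h2 h3)
  also have "\<dots> = sweedler A a (\<lambda>s t. sweedler A s (\<lambda>p q. sweedler A t (\<lambda>u v. h p u q v)))"
    by (intro * [symmetric] h1 h2 h3 h4)
  finally show ?thesis .
qed

section \<open>Bialgebra and Hopf axioms in Sweedler form\<close>

lemma bialgebraD:
  assumes "bialgebra A"
  shows "algebra A" "coalgebra A" "precoalgebra A" "vspace A" "one A \<in> carrier A"
    and "bilinear_map A A A (mult A)" and "linear_map A ground (counit A)"
    and "linear_map A (A \<otimes> A) (comult A)"
  using assms by (auto simp: bialgebra_def coalgebra_def algebra_def precoalgebra_def)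

lemma sweedler_one:
  assumes A: "bialgebra A" and U: "vspace U" and h: "bilinear_map A A U h"
  shows "sweedler A (one A) h = h (one A) (one A)"
  using A tlift_comult [OF bialgebraD(3) [OF A] U h bialgebraD(5) [OF A]]
    tlift_tens [OF U h bialgebraD(5) [OF A] bialgebraD(5) [OF A]]
  by (simp add: bialgebra_def)

lemma tensor_mult_comult:
  assumes A: "algebra A" "precoalgebra A" and xy: "x \<in> carrier A" "y \<in> carrier A"
  shows "tensor_mult A A (comult A x) (comult A y) =
    sweedler A x (\<lambda>x1 x2. sweedler A y (\<lambda>y1 y2. tens A A (mult A x1 y1) (mult A x2 y2)))"
proof -
  have v: "vspace A" and m: "bilinear_map A A A (mult A)"
    using A by (auto simp: algebra_def)
  note lin = linear_map_tens linear_map_id bilinear_map_linear [OF m] linear_map_sweedler_fun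
  note cl = v vspace_tensor bilinear_map_closed [OF m]
  have "tensor_mult A A (comult A x) (comult A y) =
      tlift A A (\<lambda>x1 x2. sweedler A y (\<lambda>y1 y2. tens A A (mult A x1 y1) (mult A x2 y2))) (comult A x)"
    unfolding tensor_mult_def
    by (intro tlift_cong tlift_comult [OF A(2), where U = "A \<otimes> A"] bilinear_mapI lin)
      (auto simp: cl xy)
  also have "\<dots> = sweedler A x (\<lambda>x1 x2. sweedler A y (\<lambda>y1 y2. tens A A (mult A x1 y1) (mult A x2 y2)))"
    by (intro tlift_comult [OF A(2), where U = "A \<otimes> A"] bilinear_mapI lin)
      (auto simp: cl xy)
  finally show ?thesis .
qed

lemma sweedler_mult:
  assumes A: "bialgebra A" and U: "vspace U" and xy: "x \<in> carrier A" "y \<in> carrier A"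
    and h: "bilinear_map A A U h"
  shows "sweedler A (mult A x y) h =
    sweedler A x (\<lambda>x1 x2. sweedler A y (\<lambda>y1 y2. h (mult A x1 y1) (mult A x2 y2)))"
proof -
  note D = bialgebraD [OF A]
  note cl = bilinear_map_closed [OF D(6)]
  have "sweedler A (mult A x y) h = tlift A A h (tensor_mult A A (comult A x) (comult A y))"
    using A xy by (simp add: tlift_comult [OF D(3) U h, symmetric] cl bialgebra_def)
  also have "\<dots> = sweedler A x (\<lambda>x1 x2. sweedler A y (\<lambda>y1 y2. h (mult A x1 y1) (mult A x2 y2)))"
    by (simp add: tensor_mult_comult D xy linear_sweedler [OF linear_tlift [OF D(4) U h]]
      vspace_tensor sweedler_closed tens_carrier cl tlift_tens [OF U h])
  finally show ?thesis .
qed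

lemma bialgebraI:
  assumes A: "algebra A" "coalgebra A"
    and "comult A (one A) = tens A A (one A) (one A)" "counit A (one A) = 1"
    and "\<And>x y. x \<in> carrier A \<Longrightarrow> y \<in> carrier A \<Longrightarrow> comult A (mult A x y) =
      sweedler A x (\<lambda>x1 x2. sweedler A y (\<lambda>y1 y2. tens A A (mult A x1 y1) (mult A x2 y2)))"
    and "\<And>x y. x \<in> carrier A \<Longrightarrow> y \<in> carrier A \<Longrightarrow> counit A (mult A x y) = counit A x * counit A y"
  shows "bialgebra A"
  using assms by (simp add: bialgebra_def tensor_mult_comult coalgebra_precoalgebra)

lemma hopf_algebraD:
  assumes "hopf_algebra A"
  shows "bialgebra A" "linear_map A A (antipode A)"
  using assms by (auto simp: hopf_algebra_def)

lemma bilinear_antipode_mult: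
  assumes "algebra A" "linear_map A A (antipode A)"
  shows "bilinear_map A A A (\<lambda>x y. mult A (antipode A x) y)"
    and "bilinear_map A A A (\<lambda>x y. mult A x (antipode A y))"
proof -
  have m: "bilinear_map A A A (mult A)" using assms by (simp add: algebra_def)
  show "bilinear_map A A A (\<lambda>x y. mult A (antipode A x) y)"
    and "bilinear_map A A A (\<lambda>x y. mult A x (antipode A y))"
    by (auto intro!: bilinear_mapI bilinear_map_linear [OF m] assms linear_map_id
        simp: linear_mapD(1) [OF assms(2)])
qed

lemma hopf_algebraI:
  assumes "bialgebra A" "linear_map A A (antipode A)"
    and "\<And>a. a \<in> carrier A \<Longrightarrow>
      sweedler A a (\<lambda>x y. mult A (antipode A x) y) = scale A (counit A a) (one A)"
    and "\<And>a. a \<in> carrier A \<Longrightarrow>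
      sweedler A a (\<lambda>x y. mult A x (antipode A y)) = scale A (counit A a) (one A)"
  shows "hopf_algebra A"
  using assms bialgebraD [OF assms(1)]
    bilinear_antipode_mult [OF bialgebraD(1) [OF assms(1)] assms(2)]
  by (simp add: hopf_algebra_def tlift_comult)

text \<open>The linear map \<open>h\<close> stands for the expression surrounding the contracted
  product, so the antipode axiom can be applied at any depth inside a larger summand. The argument
  \<open>h\<close> of \<open>sweedler_counit\<close> has the same purpose.\<close>

lemma sweedler_antipode:
  assumes A: "hopf_algebra A" and h: "linear_map A U h" and a: "a \<in> carrier A"
  shows "sweedler A a (\<lambda>x y. h (mult A (antipode A x) y)) = scale U (counit A a) (h (one A))"
    and "sweedler A a (\<lambda>x y. h (mult A x (antipode A y))) = scale U (counit A a) (h (one A))"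
proof -
  note D = bialgebraD [OF hopf_algebraD(1) [OF A]]
  note b = bilinear_antipode_mult [OF D(1) hopf_algebraD(2) [OF A]]
  have "sweedler A a (\<lambda>x y. mult A (antipode A x) y) = scale A (counit A a) (one A)"
    "sweedler A a (\<lambda>x y. mult A x (antipode A y)) = scale A (counit A a) (one A)"
    using A a by (simp_all add: hopf_algebra_def tlift_comult [OF D(3,4) b(1), symmetric]
        tlift_comult [OF D(3,4) b(2), symmetric])
  then have "h (sweedler A a (\<lambda>x y. mult A (antipode A x) y)) = scale U (counit A a) (h (one A))"
    "h (sweedler A a (\<lambda>x y. mult A x (antipode A y))) = scale U (counit A a) (h (one A))"
    by (simp_all add: linear_mapD(3) [OF h] D)
  then show "sweedler A a (\<lambda>x y. h (mult A (antipode A x) y)) = scale U (counit A a) (h (one A))"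
    and "sweedler A a (\<lambda>x y. h (mult A x (antipode A y))) = scale U (counit A a) (h (one A))"
    by (simp_all add: linear_sweedler [OF h D(4)] bilinear_map_closed [OF b(1)]
        bilinear_map_closed [OF b(2)])
qed

text \<open>Inserting a counit gives \<epsilon>(J a) = \<Sum> \<epsilon>(J x) \<epsilon>(y) over the
  legs \<open>x\<close>, \<open>y\<close> of \<open>a\<close>. By multiplicativity this is
  \<epsilon> of \<Sum> (J x) y, which the antipode axiom evaluates.\<close>

lemma counit_antipode:
  assumes A: "hopf_algebra A" and a: "a \<in> carrier A"
  shows "counit A (antipode A a) = counit A a"
proof -
  note D = bialgebraD [OF hopf_algebraD(1) [OF A]]
  note J = hopf_algebraD(2) [OF A]
  have "counit A (antipode A a) = sweedler A a (\<lambda>x y. scale ground (counit A y) (counit A (antipode A x)))"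
    by (rule sweedler_counit(2) [symmetric, OF D(2) _ a]) (intro linear_map_comp [OF D(7)] J)
  also have "\<dots> = sweedler A a (\<lambda>x y. counit A (mult A (antipode A x) y))"
    using hopf_algebraD(1) [OF A]
    by (simp add: bialgebra_def linear_mapD(1) [OF J] mult.commute)
  also have "\<dots> = counit A a"
    using sweedler_antipode(1) [OF A D(7) a] hopf_algebraD(1) [OF A]
    by (simp add: bialgebra_def)
  finally show ?thesis .
qed

text \<open>As functions of \<open>a\<close>, both sides are convolution inverses of \<open>\<Delta>\<close> read through \<open>h\<close>.\<close>

lemma comult_antipode:
  assumes A: "hopf_algebra A" and cc: "cocommutative A" and U: "vspace U" and a: "a \<in> carrier A"
    and h: "bilinear_map A A U h"
  shows "sweedler A (antipode A a) h = sweedler A a (\<lambda>x y. h (antipode A x) (antipode A y))"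
proof -
  let ?J = "antipode A" and ?m = "mult A"
  note bi = hopf_algebraD(1) [OF A]
  note D = bialgebraD [OF bi]
  note J = hopf_algebraD(2) [OF A]
  note lin = linear_map_id bilinear_map_linear [OF h] bilinear_map_linear [OF D(6)]
    linear_map_comp [OF J] linear_map_sweedler_fun linear_map_sweedler [OF D(3)] linear_map_scale
  note cl = linear_mapD(1) [OF J] bilinear_map_closed [OF D(6)] bilinear_map_closed [OF h]
    D sweedler_closed U
  have one: "?m (one A) x = x" "?m x (one A) = x" if "x \<in> carrier A" for x
    using D(1) that by (auto simp: algebra_def)
  have assoc: "?m x (?m y z) = ?m (?m x y) z"
    if "x \<in> carrier A" "y \<in> carrier A" "z \<in> carrier A" for x y z
    using D(1) that by (auto simp: algebra_def)
  \<comment> \<open>This says that (J \<otimes> J) \<circ> \<Delta> is a right convolution inverse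
    of \<Delta>, multiplied on the left by p \<otimes> q. Exchanging the middle legs puts
    \<open>y1\<close> next to \<open>v1\<close> and \<open>y2\<close> next to \<open>v2\<close>, and
    the antipode axiom then contracts the second pair and afterwards the first.\<close>
  have 1: "scale U (counit A z) (h p q) = sweedler A z (\<lambda>y v. sweedler A y (\<lambda>y1 y2. sweedler A v (\<lambda>v1 v2.
      h (?m p (?m y1 (?J v1))) (?m q (?m y2 (?J v2))))))"
    if z: "z \<in> carrier A" and pq: "p \<in> carrier A" "q \<in> carrier A" for z p q
  proof -
    have "sweedler A z (\<lambda>y v. sweedler A y (\<lambda>y1 y2. sweedler A v (\<lambda>v1 v2.
        h (?m p (?m y1 (?J v1))) (?m q (?m y2 (?J v2)))))) =
      sweedler A z (\<lambda>y v. sweedler A y (\<lambda>y1 v1. sweedler A v (\<lambda>y2 v2.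
        h (?m p (?m y1 (?J v1))) (?m q (?m y2 (?J v2))))))"
      by (intro sweedler_middle [OF D(2) cc U z] lin) (simp_all add: pq cl)
    also have "\<dots> = sweedler A z (\<lambda>y v. sweedler A y (\<lambda>y1 v1.
        scale U (counit A v) (h (?m p (?m y1 (?J v1))) (?m q (one A)))))"
      by (intro sweedler_cong' sweedler_antipode [OF A] lin) (simp_all add: pq cl)
    also have "\<dots> = sweedler A z (\<lambda>y v. scale U (counit A v) (sweedler A y (\<lambda>y1 v1.
        (h (?m p (?m y1 (?J v1))) (?m q (one A))))))"
      by (intro sweedler_cong' linear_sweedler [OF linear_map_scale [OF U linear_map_id] U, symmetric])
        (simp_all add: pq cl)
    also have "\<dots> = sweedler A z (\<lambda>y1 v1. (h (?m p (?m y1 (?J v1))) (?m q (one A))))"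
      by (intro sweedler_counit [OF D(2)] lin) (simp_all add: pq cl z)
    also have "\<dots> = scale U (counit A z) (h (?m p (one A)) (?m q (one A)))"
      by (intro sweedler_antipode [OF A] lin) (simp_all add: pq cl z)
    finally show ?thesis by (simp add: one pq)
  qed
  \<comment> \<open>Uniqueness of convolution inverses: a counit is inserted on the right of
    \<Delta>(J x) and expanded by \<open>1\<close>. After rebracketing, \<Delta>(J x) meets
    \<Delta>(y), and their product is the coproduct of (J x) y, which the antipode axiom contracts
    to a counit times \<Delta>(1).\<close>
  have "sweedler A (?J a) h = sweedler A a (\<lambda>x z. scale U (counit A z) (sweedler A (?J x) h))"
    by (intro sweedler_counit [OF D(2), symmetric] lin a) (simp_all add: cl)
  also have "\<dots> = sweedler A a (\<lambda>x z. sweedler A (?J x) (\<lambda>p q. scale U (counit A z) (h p q)))"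
    by (intro sweedler_cong' linear_sweedler [OF linear_map_scale [OF U linear_map_id] U])
      (simp_all add: cl)
  also have "\<dots> = sweedler A a (\<lambda>x z. sweedler A (?J x) (\<lambda>p q.
      sweedler A z (\<lambda>y v. sweedler A y (\<lambda>y1 y2. sweedler A v (\<lambda>v1 v2.
      h (?m p (?m y1 (?J v1))) (?m q (?m y2 (?J v2))))))))"
    by (intro sweedler_cong' 1)
  also have "\<dots> = sweedler A a (\<lambda>x z. sweedler A z (\<lambda>y v.
      sweedler A (?J x) (\<lambda>p q. sweedler A y (\<lambda>y1 y2. sweedler A v (\<lambda>v1 v2.
      h (?m (?m p y1) (?J v1)) (?m (?m q y2) (?J v2)))))))"
    by (rule sweedler_cong', subst sweedler_swap) (simp add: assoc cl)
  also have "\<dots> = sweedler A a (\<lambda>w v. sweedler A w (\<lambda>x y.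
      sweedler A (?J x) (\<lambda>p q. sweedler A y (\<lambda>y1 y2. sweedler A v (\<lambda>v1 v2.
      h (?m (?m p y1) (?J v1)) (?m (?m q y2) (?J v2)))))))"
    by (intro sweedler_coassoc [OF D(2) U a, symmetric] lin) (simp_all add: cl)
  also have "\<dots> = sweedler A a (\<lambda>w v. sweedler A w (\<lambda>x y.
      sweedler A (?m (?J x) y) (\<lambda>s t. sweedler A v (\<lambda>v1 v2. h (?m s (?J v1)) (?m t (?J v2))))))"
    by (intro sweedler_cong' sweedler_mult [OF bi U, symmetric] bilinear_mapI lin) (simp_all add: cl)
  also have "\<dots> = sweedler A a (\<lambda>w v. scale U (counit A w)
      (sweedler A (one A) (\<lambda>s t. sweedler A v (\<lambda>v1 v2. h (?m s (?J v1)) (?m t (?J v2))))))"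
    by (intro sweedler_cong' sweedler_antipode [OF A] lin) (simp_all add: cl)
  also have "\<dots> = sweedler A a (\<lambda>w v. scale U (counit A w) (sweedler A v (\<lambda>v1 v2. h (?J v1) (?J v2))))"
    by (intro sweedler_cong' arg_cong [of _ _ "scale U _"], subst sweedler_one [OF bi U])
      (auto intro!: bilinear_mapI lin simp: one cl)
  also have "\<dots> = sweedler A a (\<lambda>v1 v2. h (?J v1) (?J v2))"
    by (intro sweedler_counit [OF D(2)] lin a) (simp_all add: cl)
  finally show ?thesis .
qed

section \<open>The L-R-smash product\<close>

locale lr_smash_product =
  fixes B :: "('k::field, 'b::ab_group_add, 'm) bialg_scheme"
    and C :: "('k, 'c::ab_group_add, 'n) alg_scheme"
    and l :: "'b \<Rightarrow> 'c \<Rightarrow> 'c" and r :: "'c \<Rightarrow> 'b \<Rightarrow> 'c"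
  assumes B: "bialgebra B" and cc: "cocommutative B" and BC: "bimodule_algebra B C l r"
begin

lemmas BD = bialgebraD [OF B]

lemma CD: "algebra C" "vspace C" "one C \<in> carrier C"
  "bilinear_map C C C (mult C)" "bilinear_map B C C l" "bilinear_map C B C r"
  using BC by (auto simp: bimodule_algebra_def bimodule_def algebra_def)

lemmas vspaces = BD(4) CD(2) vspace_tensor vspace_ground

lemmas closed = BD(5) CD(3) bilinear_map_closed [OF BD(6)] bilinear_map_closed [OF CD(4)]
  bilinear_map_closed [OF CD(5)] bilinear_map_closed [OF CD(6)] tens_carrier
  vspace_closed(3) [OF BD(4)] vspace_closed(3) [OF CD(2)] sweedler_closed vspaces

text \<open>Introduction rules that reduce linearity of a composite expression to its constituents.
  Together with the membership facts in \<open>closed\<close> they settle the side conditions of the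
  Sweedler rules.\<close>

lemmas lin = linear_map_id linear_map_tens linear_map_sweedler_fun
  linear_map_sweedler [OF BD(3)] linear_map_comp [OF BD(7)]
  bilinear_map_linear [OF BD(6)] bilinear_map_linear [OF CD(4)]
  bilinear_map_linear [OF CD(5)] bilinear_map_linear [OF CD(6)]
  linear_map_scale linear_map_scale_left linear_map_times

lemma alg_simps:
  "a \<in> carrier B \<Longrightarrow> mult B (one B) a = a" "a \<in> carrier B \<Longrightarrow> mult B a (one B) = a"
  "f \<in> carrier C \<Longrightarrow> mult C (one C) f = f" "f \<in> carrier C \<Longrightarrow> mult C f (one C) = f"
  "f \<in> carrier C \<Longrightarrow> l (one B) f = f" "f \<in> carrier C \<Longrightarrow> r f (one B) = f"
  "a \<in> carrier B \<Longrightarrow> b \<in> carrier B \<Longrightarrow> c \<in> carrier B \<Longrightarrow>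
    mult B (mult B a b) c = mult B a (mult B b c)"
  "f \<in> carrier C \<Longrightarrow> g \<in> carrier C \<Longrightarrow> h \<in> carrier C \<Longrightarrow>
    mult C (mult C f g) h = mult C f (mult C g h)"
  using BD(1) BC
  by (auto simp: bimodule_algebra_def bimodule_def algebra_def)

lemma act_simps:
  assumes "a \<in> carrier B" "b \<in> carrier B" "f \<in> carrier C"
  shows "l (mult B a b) f = l a (l b f)" "r f (mult B a b) = r (r f a) b" "r (l a f) b = l a (r f b)"
  using BC assms by (auto simp: bimodule_algebra_def bimodule_def)

lemma act_one:
  assumes "a \<in> carrier B"
  shows "l a (one C) = scale C (counit B a) (one C)" "r (one C) a = scale C (counit B a) (one C)"
  using BC assms by (auto simp: bimodule_algebra_def)

lemma act_mult:
  assumes "a \<in> carrier B" "f \<in> carrier C" "g \<in> carrier C"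
  shows "l a (mult C f g) = sweedler B a (\<lambda>a1 a2. mult C (l a1 f) (l a2 g))"
    and "r (mult C f g) a = sweedler B a (\<lambda>a1 a2. mult C (r f a1) (r g a2))"
proof -
  have "bilinear_map B B C (\<lambda>a1 a2. mult C (l a1 f) (l a2 g))"
    "bilinear_map B B C (\<lambda>a1 a2. mult C (r f a1) (r g a2))"
    using assms by (auto intro!: bilinear_mapI lin simp: closed)
  then show "l a (mult C f g) = sweedler B a (\<lambda>a1 a2. mult C (l a1 f) (l a2 g))"
    "r (mult C f g) a = sweedler B a (\<lambda>a1 a2. mult C (r f a1) (r g a2))"
    using assms BC by (simp_all add: bimodule_algebra_def tlift_comult [OF BD(3) CD(2)])
qed

section \<open>Associativity and unit of the smash product\<close>

definition lr_term :: "'c \<Rightarrow> 'b \<Rightarrow> 'c \<Rightarrow> 'b \<Rightarrow> ('c, 'b, 'k) tens" where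
  "lr_term f a g b = sweedler B a (\<lambda>a1 a2. sweedler B b (\<lambda>b1 b2.
     tens C B (mult C (r f b1) (l a1 g)) (mult B a2 b2)))"

lemma lr_mult_eq:
  assumes "x \<in> carrier (C \<otimes> B)" "y \<in> carrier (C \<otimes> B)"
  shows "lr_mult B C l r x y = tlift C B (\<lambda>f a. tlift C B (lr_term f a) y) x"
  unfolding lr_mult_def
proof (intro tlift_cong)
  fix f a g b
  assume *: "f \<in> carrier C" "a \<in> carrier B" "g \<in> carrier C" "b \<in> carrier B"
  have 1: "tlift B B (\<lambda>b1 b2. tens C B (mult C (r f b1) (l a1 g)) (mult B a2 b2)) (comult B b) =
      sweedler B b (\<lambda>b1 b2. tens C B (mult C (r f b1) (l a1 g)) (mult B a2 b2))"
    if "a1 \<in> carrier B" "a2 \<in> carrier B" for a1 a2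
    using that * by (intro tlift_comult [OF BD(3), where U = "C \<otimes> B"] bilinear_mapI lin)
      (auto simp: closed)
  have "tlift B B (\<lambda>a1 a2. tlift B B (\<lambda>b1 b2.
      tens C B (mult C (r f b1) (l a1 g)) (mult B a2 b2)) (comult B b)) (comult B a) =
    tlift B B (\<lambda>a1 a2. sweedler B b (\<lambda>b1 b2.
      tens C B (mult C (r f b1) (l a1 g)) (mult B a2 b2))) (comult B a)"
    by (intro tlift_cong 1)
  also have "\<dots> = lr_term f a g b"
    unfolding lr_term_def using *
    by (intro tlift_comult [OF BD(3), where U = "C \<otimes> B"] bilinear_mapI lin)
      (auto simp: closed)
  finally show "tlift B B (\<lambda>a1 a2. tlift B B (\<lambda>b1 b2.
      tens C B (mult C (r f b1) (l a1 g)) (mult B a2 b2)) (comult B b)) (comult B a) = lr_term f a g b" .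
qed

lemma bilinear_lr_term:
  "f \<in> carrier C \<Longrightarrow> a \<in> carrier B \<Longrightarrow> bilinear_map C B (C \<otimes> B) (lr_term f a)"
  "g \<in> carrier C \<Longrightarrow> b \<in> carrier B \<Longrightarrow> bilinear_map C B (C \<otimes> B) (\<lambda>f a. lr_term f a g b)"
  unfolding lr_term_def by (intro bilinear_mapI lin; simp add: closed)+

lemma bilinear_lr_mult: "bilinear_map (C \<otimes> B) (C \<otimes> B) (C \<otimes> B) (lr_mult B C l r)"
proof -
  have "bilinear_map (C \<otimes> B) (C \<otimes> B) (C \<otimes> B) (\<lambda>x y. tlift C B (\<lambda>f a. tlift C B (lr_term f a) y) x)"
    by (intro bilinear_tlift_tlift bilinear_lr_term vspaces)
  then show ?thesis
    by (simp add: bilinear_map_def linear_map_def lr_mult_eq vspace_closed [OF vspace_tensor])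
qed

lemma lr_mult_tens:
  assumes "f \<in> carrier C" "a \<in> carrier B" "g \<in> carrier C" "b \<in> carrier B"
  shows "lr_mult B C l r (tens C B f a) (tens C B g b) = sweedler B a (\<lambda>a1 a2. sweedler B b (\<lambda>b1 b2.
     tens C B (mult C (r f b1) (l a1 g)) (mult B a2 b2)))"
proof -
  have "lr_mult B C l r (tens C B f a) (tens C B g b) =
      tlift C B (\<lambda>f a. tlift C B (lr_term f a) (tens C B g b)) (tens C B f a)"
    using assms by (simp add: lr_mult_eq tens_carrier)
  also have "\<dots> = tlift C B (lr_term f a) (tens C B g b)"
    by (rule bilinear_tlift_tlift [where U = "C \<otimes> B"]) (simp_all add: vspaces bilinear_lr_term assms tens_carrier)
  also have "\<dots> = lr_term f a g b"
    by (rule tlift_tens [where U = "C \<otimes> B"]) (simp_all add: vspaces bilinear_lr_term assms)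
  finally show ?thesis by (simp add: lr_term_def)
qed

lemmas lr_lin = lin bilinear_map_linear [OF bilinear_lr_mult]
lemmas lr_closed = closed bilinear_map_closed [OF bilinear_lr_mult]

text \<open>The common value of the two bracketings of (f \<otimes> a), (g \<otimes> b), (h
  \<otimes> c). The legs are numbered in the order in which the left bracketing produces
  them.\<close>

definition lr_triple :: "'c \<Rightarrow> 'b \<Rightarrow> 'c \<Rightarrow> 'b \<Rightarrow> 'c \<Rightarrow> 'b \<Rightarrow> ('c, 'b, 'k) tens" where
  "lr_triple f a g b h c = sweedler B a (\<lambda>a1 w. sweedler B w (\<lambda>a2 a3.
     sweedler B b (\<lambda>b1 w. sweedler B w (\<lambda>b2 b3.
     sweedler B c (\<lambda>c1 w. sweedler B w (\<lambda>c2 c3.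
       tens C B (mult C (r f (mult B b1 c1)) (mult C (l a1 (r g c2)) (l (mult B a2 b2) h)))
         (mult B a3 (mult B b3 c3))))))))"

text \<open>With this bracketing the legs of all three elements already appear in the order of
  \<open>lr_triple\<close>. Only \<open>c\<close> comes out with its left leg split, which
  coassociativity repairs.\<close>

lemma lr_triple_left:
  assumes fgh: "f \<in> carrier C" "g \<in> carrier C" "h \<in> carrier C"
    and abc: "a \<in> carrier B" "b \<in> carrier B" "c \<in> carrier B"
  shows "lr_mult B C l r (lr_mult B C l r (tens C B f a) (tens C B g b)) (tens C B h c) =
    lr_triple f a g b h c"
proof -
  have push: "linear_map (C \<otimes> B) (C \<otimes> B) (\<lambda>x. lr_mult B C l r x (tens C B h c))"
    using assms by (intro lr_lin) (auto simp: closed)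
  \<comment> \<open>The summand is kept opaque while sums are reordered, and is unfolded only where
    its linearity has to be checked.\<close>
  define E where "E a1 a2 a3 b1 b2 b3 c1 c2 c3 =
    tens C B (mult C (r f (mult B b1 c1)) (mult C (l a1 (r g c2)) (l (mult B a2 b2) h)))
         (mult B a3 (mult B b3 c3))" for a1 a2 a3 b1 b2 b3 c1 c2 c3
  have "lr_mult B C l r (lr_mult B C l r (tens C B f a) (tens C B g b)) (tens C B h c) =
    sweedler B a (\<lambda>a1 a'. sweedler B b (\<lambda>b1 b'. sweedler B (mult B a' b') (\<lambda>p q.
      sweedler B c (\<lambda>c' c3.
      tens C B (mult C (r (mult C (r f b1) (l a1 g)) c') (l p h)) (mult B q c3)))))"
    using assms
    by (simp add: lr_mult_tens closed linear_sweedler [OF push])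
  also have "\<dots> = sweedler B a (\<lambda>a1 a'. sweedler B b (\<lambda>b1 b'. sweedler B a' (\<lambda>a2 a3.
      sweedler B b' (\<lambda>b2 b3. sweedler B c (\<lambda>c' c3.
      tens C B (mult C (r (mult C (r f b1) (l a1 g)) c') (l (mult B a2 b2) h))
        (mult B (mult B a3 b3) c3))))))"
    using assms
    by (intro sweedler_cong' sweedler_mult [OF B, where U = "C \<otimes> B"] bilinear_mapI lin)
      (simp_all add: closed)
  also have "\<dots> = sweedler B a (\<lambda>a1 a'. sweedler B b (\<lambda>b1 b'. sweedler B a' (\<lambda>a2 a3.
      sweedler B b' (\<lambda>b2 b3. sweedler B c (\<lambda>c' c3. sweedler B c' (\<lambda>c1 c2.
      E a1 a2 a3 b1 b2 b3 c1 c2 c3))))))"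
  proof (intro sweedler_cong')
    fix a1 a' b1 b' a2 a3 b2 b3 c' c3
    assume c: "a1 \<in> carrier B" "a' \<in> carrier B" "b1 \<in> carrier B" "b' \<in> carrier B"
      "a2 \<in> carrier B" "a3 \<in> carrier B" "b2 \<in> carrier B" "b3 \<in> carrier B"
      "c' \<in> carrier B" "c3 \<in> carrier B"
    have push': "linear_map C (C \<otimes> B) (\<lambda>u. tens C B (mult C u (l (mult B a2 b2) h))
        (mult B (mult B a3 b3) c3))"
      using assms c by (intro lin) (auto simp: closed)
    show "tens C B (mult C (r (mult C (r f b1) (l a1 g)) c') (l (mult B a2 b2) h))
        (mult B (mult B a3 b3) c3) = sweedler B c' (\<lambda>c1 c2. E a1 a2 a3 b1 b2 b3 c1 c2 c3)"
      using assms c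
      by (simp add: act_mult closed linear_sweedler [OF push'])
        (simp add: E_def alg_simps act_simps closed)
  qed
  also have "\<dots> = sweedler B a (\<lambda>a1 a'. sweedler B a' (\<lambda>a2 a3. sweedler B b (\<lambda>b1 b'.
      sweedler B b' (\<lambda>b2 b3. sweedler B c (\<lambda>c' c3. sweedler B c' (\<lambda>c1 c2.
      E a1 a2 a3 b1 b2 b3 c1 c2 c3))))))"
    by (rule sweedler_cong', rule sweedler_swap)
  also have "\<dots> = sweedler B a (\<lambda>a1 a'. sweedler B a' (\<lambda>a2 a3. sweedler B b (\<lambda>b1 b'.
      sweedler B b' (\<lambda>b2 b3. sweedler B c (\<lambda>c1 c'. sweedler B c' (\<lambda>c2 c3.
      E a1 a2 a3 b1 b2 b3 c1 c2 c3))))))"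
    unfolding E_def using assms
    by (intro sweedler_cong' sweedler_coassoc [OF BD(2), where U = "C \<otimes> B"] lin) (auto simp: closed)
  finally show ?thesis unfolding lr_triple_def E_def .
qed

text \<open>Rebracketing makes the first two legs the halves of one element, where cocommutativity
  exchanges them.\<close>

lemma sweedler_triple_commute:
  assumes U: "vspace U" and a: "a \<in> carrier B"
    and h1: "\<And>y z. y \<in> carrier B \<Longrightarrow> z \<in> carrier B \<Longrightarrow> linear_map B U (\<lambda>x. h x y z)"
    and h2: "\<And>x z. x \<in> carrier B \<Longrightarrow> z \<in> carrier B \<Longrightarrow> linear_map B U (\<lambda>y. h x y z)"
    and h3: "\<And>x y. x \<in> carrier B \<Longrightarrow> y \<in> carrier B \<Longrightarrow> linear_map B U (\<lambda>z. h x y z)"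
  shows "sweedler B a (\<lambda>x w. sweedler B w (\<lambda>y z. h y x z)) =
    sweedler B a (\<lambda>x w. sweedler B w (\<lambda>y z. h x y z))"
proof -
  have "sweedler B a (\<lambda>x w. sweedler B w (\<lambda>y z. h y x z)) =
      sweedler B a (\<lambda>w z. sweedler B w (\<lambda>x y. h y x z))"
    by (intro sweedler_coassoc [OF BD(2) U a, symmetric] h1 h2 h3)
  also have "\<dots> = sweedler B a (\<lambda>w z. sweedler B w (\<lambda>x y. h x y z))"
    by (intro sweedler_cong' sweedler_commute [OF BD(3) cc U] h1 h2)
  also have "\<dots> = sweedler B a (\<lambda>x w. sweedler B w (\<lambda>y z. h x y z))"
    by (intro sweedler_coassoc [OF BD(2) U a] h1 h2 h3)
  finally show ?thesis .
qed

text \<open>The inner product is expanded first, so the legs of \<open>b\<close> and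
  \<open>c\<close> that act on \<open>h\<close> and \<open>g\<close> are split off before those that
  act on \<open>f\<close>: they arrive in the order 2, 1, 3. Associativity therefore rests on
  cocommutativity, and only \<open>a\<close> is settled by coassociativity alone.\<close>

lemma lr_triple_right:
  assumes fgh: "f \<in> carrier C" "g \<in> carrier C" "h \<in> carrier C"
    and abc: "a \<in> carrier B" "b \<in> carrier B" "c \<in> carrier B"
  shows "lr_mult B C l r (tens C B f a) (lr_mult B C l r (tens C B g b) (tens C B h c)) =
    lr_triple f a g b h c"
proof -
  have push: "linear_map (C \<otimes> B) (C \<otimes> B) (\<lambda>x. lr_mult B C l r (tens C B f a) x)"
    using assms by (intro lr_lin) (auto simp: closed)
  define E where "E a1 a2 a3 b1 b2 b3 c1 c2 c3 =
    tens C B (mult C (r f (mult B b1 c1)) (mult C (l a1 (r g c2)) (l (mult B a2 b2) h)))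
         (mult B a3 (mult B b3 c3))" for a1 a2 a3 b1 b2 b3 c1 c2 c3
  have "lr_mult B C l r (tens C B f a) (lr_mult B C l r (tens C B g b) (tens C B h c)) =
    sweedler B b (\<lambda>b2 b'. sweedler B c (\<lambda>c2 c'. sweedler B a (\<lambda>w a3. sweedler B (mult B b' c') (\<lambda>p q.
      tens C B (mult C (r f p) (l w (mult C (r g c2) (l b2 h)))) (mult B a3 q)))))"
    using assms
    by (simp add: lr_mult_tens closed linear_sweedler [OF push])
  also have "\<dots> = sweedler B b (\<lambda>b2 b'. sweedler B c (\<lambda>c2 c'. sweedler B a (\<lambda>w a3.
      sweedler B b' (\<lambda>b1 b3. sweedler B c' (\<lambda>c1 c3.
      tens C B (mult C (r f (mult B b1 c1)) (l w (mult C (r g c2) (l b2 h)))) (mult B a3 (mult B b3 c3)))))))"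
    using assms
    by (intro sweedler_cong' sweedler_mult [OF B, where U = "C \<otimes> B"] bilinear_mapI lin)
      (simp_all add: closed)
  also have "\<dots> = sweedler B b (\<lambda>b2 b'. sweedler B c (\<lambda>c2 c'. sweedler B a (\<lambda>w a3.
      sweedler B b' (\<lambda>b1 b3. sweedler B c' (\<lambda>c1 c3. sweedler B w (\<lambda>a1 a2.
      E a1 a2 a3 b1 b2 b3 c1 c2 c3))))))"
  proof (intro sweedler_cong')
    fix b2 b' c2 c' w a3 b1 b3 c1 c3
    assume c: "b2 \<in> carrier B" "b' \<in> carrier B" "c2 \<in> carrier B" "c' \<in> carrier B"
      "w \<in> carrier B" "a3 \<in> carrier B" "b1 \<in> carrier B" "b3 \<in> carrier B"
      "c1 \<in> carrier B" "c3 \<in> carrier B"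
    have push': "linear_map C (C \<otimes> B) (\<lambda>u. tens C B (mult C (r f (mult B b1 c1)) u)
        (mult B a3 (mult B b3 c3)))"
      using assms c by (intro lin) (auto simp: closed)
    show "tens C B (mult C (r f (mult B b1 c1)) (l w (mult C (r g c2) (l b2 h))))
        (mult B a3 (mult B b3 c3)) = sweedler B w (\<lambda>a1 a2. E a1 a2 a3 b1 b2 b3 c1 c2 c3)"
      using assms c
      by (simp add: act_mult closed linear_sweedler [OF push'])
        (simp add: E_def alg_simps act_simps closed)
  qed
  \<comment> \<open>Fixing the elements in the swap rule orients it: the sum over \<open>a\<close>
    only ever moves outwards, so rewriting terminates.\<close>
  also have "\<dots> = sweedler B a (\<lambda>w a3. sweedler B b (\<lambda>b2 b'. sweedler B c (\<lambda>c2 c'.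
      sweedler B b' (\<lambda>b1 b3. sweedler B c' (\<lambda>c1 c3. sweedler B w (\<lambda>a1 a2.
      E a1 a2 a3 b1 b2 b3 c1 c2 c3))))))"
    by (simp only: sweedler_swap [of B c B a] sweedler_swap [of B b B a])
  also have "\<dots> = sweedler B a (\<lambda>w a3. sweedler B b (\<lambda>b2 b'. sweedler B b' (\<lambda>b1 b3.
      sweedler B c (\<lambda>c2 c'. sweedler B c' (\<lambda>c1 c3. sweedler B w (\<lambda>a1 a2.
      E a1 a2 a3 b1 b2 b3 c1 c2 c3))))))"
    by (rule sweedler_cong', rule sweedler_cong', rule sweedler_swap)
  also have "\<dots> = sweedler B a (\<lambda>w a3. sweedler B b (\<lambda>b2 b'. sweedler B b' (\<lambda>b1 b3.
      sweedler B w (\<lambda>a1 a2. sweedler B c (\<lambda>c2 c'. sweedler B c' (\<lambda>c1 c3.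
      E a1 a2 a3 b1 b2 b3 c1 c2 c3))))))"
    by (rule sweedler_cong', rule sweedler_cong', rule sweedler_cong', rule sweedler_swap2)
  also have "\<dots> = sweedler B a (\<lambda>w a3. sweedler B w (\<lambda>a1 a2.
      sweedler B b (\<lambda>b2 b'. sweedler B b' (\<lambda>b1 b3.
      sweedler B c (\<lambda>c2 c'. sweedler B c' (\<lambda>c1 c3. E a1 a2 a3 b1 b2 b3 c1 c2 c3))))))"
    by (rule sweedler_cong', rule sweedler_swap2)
  \<comment> \<open>With the sums over \<open>a\<close>, \<open>b\<close>, \<open>c\<close>
    separated, the first two legs of \<open>b\<close>, and then those of \<open>c\<close>, are
    exchanged.\<close>
  also have "\<dots> = sweedler B a (\<lambda>w a3. sweedler B w (\<lambda>a1 a2.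
      sweedler B b (\<lambda>b1 b'. sweedler B b' (\<lambda>b2 b3.
      sweedler B c (\<lambda>c2 c'. sweedler B c' (\<lambda>c1 c3. E a1 a2 a3 b1 b2 b3 c1 c2 c3))))))"
    unfolding E_def using assms
    by (intro sweedler_cong' sweedler_triple_commute [where U = "C \<otimes> B"] lin) (auto simp: closed)
  also have "\<dots> = sweedler B a (\<lambda>w a3. sweedler B w (\<lambda>a1 a2.
      sweedler B b (\<lambda>b1 b'. sweedler B b' (\<lambda>b2 b3.
      sweedler B c (\<lambda>c1 c'. sweedler B c' (\<lambda>c2 c3. E a1 a2 a3 b1 b2 b3 c1 c2 c3))))))"
    unfolding E_def using assms
    by (intro sweedler_cong' sweedler_triple_commute [where U = "C \<otimes> B"] lin) (auto simp: closed)
  also have "\<dots> = sweedler B a (\<lambda>a1 w. sweedler B w (\<lambda>a2 a3.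
      sweedler B b (\<lambda>b1 b'. sweedler B b' (\<lambda>b2 b3.
      sweedler B c (\<lambda>c1 c'. sweedler B c' (\<lambda>c2 c3. E a1 a2 a3 b1 b2 b3 c1 c2 c3))))))"
    unfolding E_def using assms
    by (intro sweedler_coassoc [OF BD(2), where U = "C \<otimes> B"] lin) (auto simp: closed)
  finally show ?thesis unfolding lr_triple_def E_def .
qed

text \<open>Three applications of the extension principle: \<open>z\<close> is made general first,
  with elementary tensors in the other two places, and then \<open>x\<close> and \<open>y\<close>
  together.\<close>

lemma lr_mult_assoc:
  assumes x: "x \<in> carrier (C \<otimes> B)" and y: "y \<in> carrier (C \<otimes> B)" and z: "z \<in> carrier (C \<otimes> B)"
  shows "lr_mult B C l r (lr_mult B C l r x y) z = lr_mult B C l r x (lr_mult B C l r y z)"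
proof -
  note lin'' = linear_map_id bilinear_map_linear [OF bilinear_lr_mult]
  have *: "lr_mult B C l r (lr_mult B C l r (tens C B f a) (tens C B g b)) z =
      lr_mult B C l r (tens C B f a) (lr_mult B C l r (tens C B g b) z)"
    if "f \<in> carrier C" "a \<in> carrier B" "g \<in> carrier C" "b \<in> carrier B" for f a g b
  proof (rule tensor_ext [OF CD(2) _ _ _ z])
    show "linear_map (C \<otimes> B) (C \<otimes> B) (lr_mult B C l r (lr_mult B C l r (tens C B f a) (tens C B g b)))"
      "linear_map (C \<otimes> B) (C \<otimes> B) (\<lambda>z. lr_mult B C l r (tens C B f a) (lr_mult B C l r (tens C B g b) z))"
      using that by (auto intro!: lin'' simp: lr_closed)
  qed (simp add: that lr_triple_left lr_triple_right)
  show ?thesis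
  proof (rule tensor_ext2 [where f = "\<lambda>x y. lr_mult B C l r (lr_mult B C l r x y) z"
      and g = "\<lambda>x y. lr_mult B C l r x (lr_mult B C l r y z)", OF CD(2,2) _ _ * x y])
    show "bilinear_map (C \<otimes> B) (C \<otimes> B) (C \<otimes> B) (\<lambda>x y. lr_mult B C l r (lr_mult B C l r x y) z)"
      "bilinear_map (C \<otimes> B) (C \<otimes> B) (C \<otimes> B) (\<lambda>x y. lr_mult B C l r x (lr_mult B C l r y z))"
      using z by (auto intro!: bilinear_mapI lin'' simp: lr_closed)
  qed
qed

text \<open>The unit of \<open>B\<close> is grouplike, so one of the two Sweedler sums has a single
  term. The legs of the other element act on the unit of \<open>C\<close> through the counit, and
  the counit axiom collapses the remaining sum.\<close>

lemma lr_mult_one: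
  assumes x: "x \<in> carrier (C \<otimes> B)"
  shows "lr_mult B C l r (tens C B (one C) (one B)) x = x"
    and "lr_mult B C l r x (tens C B (one C) (one B)) = x"
proof -
  note lin'' = linear_map_id bilinear_map_linear [OF bilinear_lr_mult]
  have sc: "tens C B (scale C c f) a = scale (C \<otimes> B) c (tens C B f a)"
    if "f \<in> carrier C" "a \<in> carrier B" for c f a
    using bilinear_tens [of C B] that by (simp add: bilinear_map_def linear_map_def)
  have sc1: "mult C (scale C c (one C)) f = scale C c f" "mult C f (scale C c (one C)) = scale C c f"
    if "f \<in> carrier C" for c f
    using CD(3,4) that by (simp_all add: bilinear_map_def linear_map_def alg_simps)
  have "linear_map (C \<otimes> B) (C \<otimes> B) (lr_mult B C l r (tens C B (one C) (one B)))"
    "linear_map (C \<otimes> B) (C \<otimes> B) (\<lambda>x. lr_mult B C l r x (tens C B (one C) (one B)))"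
    by (auto intro!: lin'' simp: lr_closed)
  moreover have "lr_mult B C l r (tens C B (one C) (one B)) (tens C B f a) = tens C B f a"
    if fa: "f \<in> carrier C" "a \<in> carrier B" for f a
  proof -
    note [simp] = fa closed alg_simps act_one sc sc1
    have "lr_mult B C l r (tens C B (one C) (one B)) (tens C B f a) =
      sweedler B (one B) (\<lambda>a1 a2. sweedler B a (\<lambda>b1 b2.
        tens C B (mult C (r (one C) b1) (l a1 f)) (mult B a2 b2)))"
      by (simp add: lr_mult_tens)
    also have "\<dots> = sweedler B a (\<lambda>b1 b2. scale (C \<otimes> B) (counit B b1) (tens C B f b2))"
      by (subst sweedler_one [OF B, where U = "C \<otimes> B"]) (auto intro!: bilinear_mapI lin)
    also have "\<dots> = tens C B f a"
      using fa by (intro sweedler_counit [OF BD(2)] lin)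
    finally show ?thesis .
  qed
  moreover have "lr_mult B C l r (tens C B f a) (tens C B (one C) (one B)) = tens C B f a"
    if fa: "f \<in> carrier C" "a \<in> carrier B" for f a
  proof -
    note [simp] = fa closed alg_simps act_one sc sc1
    have "lr_mult B C l r (tens C B f a) (tens C B (one C) (one B)) =
      sweedler B a (\<lambda>a1 a2. sweedler B (one B) (\<lambda>b1 b2.
        tens C B (mult C (r f b1) (l a1 (one C))) (mult B a2 b2)))"
      by (simp add: lr_mult_tens)
    also have "\<dots> = sweedler B a (\<lambda>a1 a2. scale (C \<otimes> B) (counit B a1) (tens C B f a2))"
      by (intro sweedler_cong', subst sweedler_one [OF B, where U = "C \<otimes> B"])
        (auto intro!: bilinear_mapI lin)
    also have "\<dots> = tens C B f a"
      using fa by (intro sweedler_counit [OF BD(2)] lin)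
    finally show ?thesis .
  qed
  ultimately show "lr_mult B C l r (tens C B (one C) (one B)) x = x"
    and "lr_mult B C l r x (tens C B (one C) (one B)) = x"
    by (auto intro!: tensor_ext [OF CD(2) _ linear_map_id _ x])
qed

end

section \<open>The coproduct of the smash product\<close>

lemma lr_comult_tens:
  assumes B: "precoalgebra B" and C: "precoalgebra C"
  shows "linear_map (C \<otimes> B) ((C \<otimes> B) \<otimes> (C \<otimes> B)) (lr_comult B C)"
    and "f \<in> carrier C \<Longrightarrow> a \<in> carrier B \<Longrightarrow> lr_comult B C (tens C B f a) =
      sweedler C f (\<lambda>f1 f2. sweedler B a (\<lambda>a1 a2.
        tens (C \<otimes> B) (C \<otimes> B) (tens C B f1 a1) (tens C B f2 a2)))"
proof -
  have D: "vspace B" "linear_map B (B \<otimes> B) (comult B)" "vspace C" "linear_map C (C \<otimes> C) (comult C)"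
    using B C by (auto simp: precoalgebra_def)
  show "linear_map (C \<otimes> B) ((C \<otimes> B) \<otimes> (C \<otimes> B)) (lr_comult B C)"
    unfolding lr_comult_def
    by (intro linear_map_comp [OF flip23_tens(1)] linear_map_comp [OF linear_tmap] linear_map_id D)
  assume fa: "f \<in> carrier C" "a \<in> carrier B"
  then have "lr_comult B C (tens C B f a) = tlift C C (\<lambda>v1 v2. tlift B B (\<lambda>w1 w2.
       tens (C \<otimes> B) (C \<otimes> B) (tens C B v1 w1) (tens C B v2 w2)) (comult B a)) (comult C f)"
    by (simp add: lr_comult_def tmap_tens D flip23_tens linear_mapD(1) [OF D(2)] linear_mapD(1) [OF D(4)])
  also have "\<dots> = tlift C C (\<lambda>f1 f2. sweedler B a (\<lambda>a1 a2.
        tens (C \<otimes> B) (C \<otimes> B) (tens C B f1 a1) (tens C B f2 a2))) (comult C f)"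
    by (intro tlift_cong tlift_comult [OF B, where U = "(C \<otimes> B) \<otimes> (C \<otimes> B)"] vspace_tensor
        bilinear_mapI linear_map_tens linear_map_id fa tens_carrier)
  also have "\<dots> = sweedler C f (\<lambda>f1 f2. sweedler B a (\<lambda>a1 a2.
        tens (C \<otimes> B) (C \<otimes> B) (tens C B f1 a1) (tens C B f2 a2)))"
    by (intro tlift_comult [OF C, where U = "(C \<otimes> B) \<otimes> (C \<otimes> B)"] vspace_tensor
        bilinear_mapI linear_map_sweedler_fun linear_map_tens linear_map_id fa tens_carrier)
  finally show "lr_comult B C (tens C B f a) =
      sweedler C f (\<lambda>f1 f2. sweedler B a (\<lambda>a1 a2.
        tens (C \<otimes> B) (C \<otimes> B) (tens C B f1 a1) (tens C B f2 a2)))" .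
qed

text \<open>The record \<open>H\<close> is abstract, and its product is constrained on the carrier
  only, so that one proof covers both \<open>lr_smash\<close> and its variant with product
  \<open>transport_star\<close>; outside the carrier these products need not agree.\<close>

locale lr_smash_hopf = lr_smash_product B C l r
  for B :: "('k::field, 'b::ab_group_add, 'm) hopf_scheme"
    and C :: "('k, 'c::ab_group_add, 'n) hopf_scheme"
    and l :: "'b \<Rightarrow> 'c \<Rightarrow> 'c" and r :: "'c \<Rightarrow> 'b \<Rightarrow> 'c" +
  fixes H :: "('k, ('c, 'b, 'k) tens, 'o) hopf_scheme"
  assumes HB: "hopf_algebra B" and HC: "hopf_algebra C" and BBC: "bimodule_bialgebra B C l r"
    and carrier_H [simp]: "carrier H = carrier (C \<otimes> B)" and scale_H: "scale H = scale (C \<otimes> B)"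
    and mult_H: "x \<in> carrier (C \<otimes> B) \<Longrightarrow> y \<in> carrier (C \<otimes> B) \<Longrightarrow> mult H x y = lr_mult B C l r x y"
    and one_H: "one H = tens C B (one C) (one B)"
    and comult_H: "comult H = lr_comult B C" and counit_H: "counit H = lr_counit B C"
    and antipode_H: "antipode H = lr_antipode B C l r"
begin

abbreviation "K \<equiv> C \<otimes> B"

lemmas CBD = bialgebraD [OF hopf_algebraD(1) [OF HC]]
lemmas JB = hopf_algebraD(2) [OF HB]
lemmas JC = hopf_algebraD(2) [OF HC]

lemmas tensor_H = tensor_vsp_cong(1) [OF carrier_H scale_H carrier_H scale_H]
  tensor_vsp_cong(2) [OF carrier_H scale_H carrier_H scale_H]
  tensor_vsp_cong(2) [OF carrier_H scale_H refl refl, of "K \<otimes> K"]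
  tensor_vsp_cong(1) [OF carrier_H scale_H refl refl, of "K \<otimes> K"]

lemma linear_map_H: "linear_map H U = linear_map K U" "linear_map X H = linear_map X K"
  by (simp_all add: linear_map_def scale_H fun_eq_iff)

lemma vspace_H: "vspace H"
  using vspace_tensor [of C B] by (simp add: vspace_def scale_H)

lemma precoalgebra_H: "precoalgebra H"
  using lr_comult_tens(1) [OF BD(3) CBD(3)]
  by (simp add: precoalgebra_def vspace_H linear_map_H comult_H tensor_H)

lemmas linH = lr_lin linear_map_comp [OF JB]
  linear_map_comp [OF JC] linear_map_comp [OF CBD(7)] linear_map_sweedler [OF CBD(3)]
  linear_map_sweedler [OF precoalgebra_H, unfolded carrier_H linear_map_H]
lemmas closedH = lr_closed linear_mapD(1) [OF JB]
  linear_mapD(1) [OF JC] vspace_closed(3) [OF vspace_tensor]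

lemma sweedler_H:
  assumes U: "vspace U" and h: "bilinear_map K K U h" and fa: "f \<in> carrier C" "a \<in> carrier B"
  shows "sweedler H (tens C B f a) h =
    sweedler C f (\<lambda>f1 f2. sweedler B a (\<lambda>a1 a2. h (tens C B f1 a1) (tens C B f2 a2)))"
proof -
  have h': "bilinear_map H H U h" using h by (simp add: bilinear_map_def linear_map_H)
  have "sweedler H (tens C B f a) h = tlift H H h (comult H (tens C B f a))"
    using tlift_comult [OF precoalgebra_H U h'] fa by (simp add: tens_carrier)
  also have "\<dots> = tlift K K h (sweedler C f (\<lambda>f1 f2. sweedler B a (\<lambda>a1 a2.
        tens K K (tens C B f1 a1) (tens C B f2 a2))))"
    using fa by (simp add: tensor_vsp_cong(3) [OF carrier_H scale_H carrier_H scale_H]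
        comult_H lr_comult_tens(2) [OF BD(3) CBD(3)])
  also have "\<dots> = sweedler C f (\<lambda>f1 f2. sweedler B a (\<lambda>a1 a2. h (tens C B f1 a1) (tens C B f2 a2)))"
    by (simp add: linear_sweedler [OF linear_tlift [OF vspace_tensor U h]] closedH tlift_tens [OF U h])
  finally show ?thesis .
qed

text \<open>The module-coalgebra axioms read through an arbitrary bilinear \<open>h\<close>, so that
  an action inside a coproduct can be resolved within a larger sum.\<close>

lemma sweedler_act:
  assumes U: "vspace U" and a: "a \<in> carrier B" and f: "f \<in> carrier C" and h: "bilinear_map C C U h"
  shows "sweedler C (l a f) h = sweedler B a (\<lambda>a1 a2. sweedler C f (\<lambda>f1 f2. h (l a1 f1) (l a2 f2)))"
    and "sweedler C (r f a) h = sweedler B a (\<lambda>a1 a2. sweedler C f (\<lambda>f1 f2. h (r f1 a1) (r f2 a2)))"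
proof -
  have b: "bilinear_map C C (C \<otimes> C) (\<lambda>f1 f2. tens C C (l a1 f1) (l a2 f2))"
    "bilinear_map C C (C \<otimes> C) (\<lambda>f1 f2. tens C C (r f1 a1) (r f2 a2))"
    if "a1 \<in> carrier B" "a2 \<in> carrier B" for a1 a2
    using that by (auto intro!: bilinear_mapI lin simp: closed)
  have 1: "comult C (l a f) = sweedler B a (\<lambda>a1 a2. sweedler C f (\<lambda>f1 f2. tens C C (l a1 f1) (l a2 f2)))"
  proof -
    have "comult C (l a f) = tlift B B (\<lambda>a1 a2. sweedler C f (\<lambda>f1 f2. tens C C (l a1 f1) (l a2 f2))) (comult B a)"
      using BBC a f by (auto simp: bimodule_bialgebra_def intro!: tlift_cong tlift_comult CBD b vspaces)
    also have "\<dots> = sweedler B a (\<lambda>a1 a2. sweedler C f (\<lambda>f1 f2. tens C C (l a1 f1) (l a2 f2)))"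
      by (intro tlift_comult [OF BD(3), where U = "C \<otimes> C"] bilinear_mapI lin) (auto simp: closed a f)
    finally show ?thesis .
  qed
  have 2: "comult C (r f a) = sweedler B a (\<lambda>a1 a2. sweedler C f (\<lambda>f1 f2. tens C C (r f1 a1) (r f2 a2)))"
  proof -
    have "comult C (r f a) = tlift B B (\<lambda>a1 a2. sweedler C f (\<lambda>f1 f2. tens C C (r f1 a1) (r f2 a2))) (comult B a)"
      using BBC a f by (auto simp: bimodule_bialgebra_def intro!: tlift_cong tlift_comult CBD b vspaces)
    also have "\<dots> = sweedler B a (\<lambda>a1 a2. sweedler C f (\<lambda>f1 f2. tens C C (r f1 a1) (r f2 a2)))"
      by (intro tlift_comult [OF BD(3), where U = "C \<otimes> C"] bilinear_mapI lin) (auto simp: closed a f)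
    finally show ?thesis .
  qed
  show "sweedler C (l a f) h = sweedler B a (\<lambda>a1 a2. sweedler C f (\<lambda>f1 f2. h (l a1 f1) (l a2 f2)))"
    using a f by (simp add: tlift_comult [OF CBD(3) U h, symmetric] closed 1
      linear_sweedler [OF linear_tlift [OF CD(2) U h]] tlift_tens [OF U h])
  show "sweedler C (r f a) h = sweedler B a (\<lambda>a1 a2. sweedler C f (\<lambda>f1 f2. h (r f1 a1) (r f2 a2)))"
    using a f by (simp add: tlift_comult [OF CBD(3) U h, symmetric] closed 2
      linear_sweedler [OF linear_tlift [OF CD(2) U h]] tlift_tens [OF U h])
qed

lemma counit_act:
  assumes "a \<in> carrier B" "f \<in> carrier C"
  shows "counit C (l a f) = counit B a * counit C f" "counit C (r f a) = counit C f * counit B a"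
  using BBC assms by (auto simp: bimodule_bialgebra_def)

lemma linear_counit_H: "linear_map K ground (counit H)"
  and counit_H_tens: "f \<in> carrier C \<Longrightarrow> a \<in> carrier B \<Longrightarrow> counit H (tens C B f a) = counit C f * counit B a"
proof -
  have b: "bilinear_map C B ground (\<lambda>f a. counit C f * counit B a)"
    by (auto intro!: bilinear_mapI linH linear_map_comp [OF BD(7)])
  show "linear_map K ground (counit H)"
    unfolding counit_H lr_counit_def by (rule linear_tlift [OF CD(2) vspace_ground b])
  show "f \<in> carrier C \<Longrightarrow> a \<in> carrier B \<Longrightarrow> counit H (tens C B f a) = counit C f * counit B a"
    unfolding counit_H lr_counit_def by (rule tlift_tens [OF vspace_ground b])
qed

section \<open>Algebra and coalgebra structure of the smash product\<close>

lemma algebra_H: "algebra H"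
proof -
  have "bilinear_map H H H (mult H)"
    using bilinear_lr_mult
    by (auto simp: bilinear_map_def linear_map_def scale_H mult_H vspace_closed [OF vspace_tensor])
  then show ?thesis
    by (simp add: algebra_def vspace_H one_H mult_H lr_mult_assoc lr_mult_one closedH)
qed

text \<open>The coproduct is that of the tensor product coalgebra. On elementary tensors the sums
  over \<open>f\<close> and over \<open>a\<close> separate, and each axiom reduces to the same axiom
  for \<open>C\<close> and for \<open>B\<close>.\<close>

lemma coalgebra_H: "coalgebra H"
proof (rule coalgebraI [OF precoalgebra_H])
  show "linear_map H ground (counit H)" by (simp add: linear_map_H linear_counit_H)
  note lin' = linH linear_map_comp [OF linear_counit_H]
  {
    fix x assume "x \<in> carrier H"
    then have x: "x \<in> carrier K" by simp
    let ?U = "K \<otimes> (K \<otimes> K)"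
    have "sweedler H x (\<lambda>x z. sweedler H x (\<lambda>u v. tens K (K \<otimes> K) u (tens K K v z))) =
      sweedler H x (\<lambda>u y. sweedler H y (\<lambda>v z. tens K (K \<otimes> K) u (tens K K v z)))"
    proof (rule tensor_ext [OF CD(2) _ _ _ x, where U = ?U
        and f = "\<lambda>x. sweedler H x (\<lambda>x z. sweedler H x (\<lambda>u v. tens K (K \<otimes> K) u (tens K K v z)))"
        and g = "\<lambda>x. sweedler H x (\<lambda>u y. sweedler H y (\<lambda>v z. tens K (K \<otimes> K) u (tens K K v z)))"])
      show "linear_map K ?U (\<lambda>x. sweedler H x (\<lambda>x z. sweedler H x (\<lambda>u v. tens K (K \<otimes> K) u (tens K K v z))))"
        "linear_map K ?U (\<lambda>x. sweedler H x (\<lambda>u y. sweedler H y (\<lambda>v z. tens K (K \<otimes> K) u (tens K K v z))))"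
        by (intro lin'; simp add: closedH)+
      fix f a assume fa: "f \<in> carrier C" "a \<in> carrier B"
      define \<Phi> where "\<Phi> u v z = tens K (K \<otimes> K) u (tens K K v z)" for u v z
      have "sweedler H (tens C B f a) (\<lambda>x z. sweedler H x (\<lambda>u v. \<Phi> u v z)) =
        sweedler C f (\<lambda>f' f3. sweedler B a (\<lambda>a' a3. sweedler H (tens C B f' a') (\<lambda>u v. \<Phi> u v (tens C B f3 a3))))"
        unfolding \<Phi>_def by (intro sweedler_H [where U = ?U] bilinear_mapI lin') (auto simp: closedH fa)
      also have "\<dots> = sweedler C f (\<lambda>f' f3. sweedler B a (\<lambda>a' a3.
        sweedler C f' (\<lambda>f1 f2. sweedler B a' (\<lambda>a1 a2. \<Phi> (tens C B f1 a1) (tens C B f2 a2) (tens C B f3 a3)))))"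
        unfolding \<Phi>_def by (intro sweedler_cong' sweedler_H [where U = ?U] bilinear_mapI lin') (auto simp: closedH fa)
      \<comment> \<open>The sums are interleaved by the coproduct of \<open>H\<close>. The swap
        brings the two splittings of \<open>f\<close> together and those of \<open>a\<close>
        together, so that coassociativity applies in each factor by itself.\<close>
      also have "\<dots> = sweedler C f (\<lambda>f' f3. sweedler C f' (\<lambda>f1 f2. sweedler B a (\<lambda>a' a3.
        sweedler B a' (\<lambda>a1 a2. \<Phi> (tens C B f1 a1) (tens C B f2 a2) (tens C B f3 a3)))))"
        by (rule sweedler_cong', rule sweedler_swap)
      also have "\<dots> = sweedler C f (\<lambda>f' f3. sweedler C f' (\<lambda>f1 f2. sweedler B a (\<lambda>a1 a'.
        sweedler B a' (\<lambda>a2 a3. \<Phi> (tens C B f1 a1) (tens C B f2 a2) (tens C B f3 a3)))))"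
        unfolding \<Phi>_def by (intro sweedler_cong' sweedler_coassoc [OF BD(2), where U = ?U] lin') (auto simp: closedH fa)
      also have "\<dots> = sweedler C f (\<lambda>f1 f'. sweedler C f' (\<lambda>f2 f3. sweedler B a (\<lambda>a1 a'.
        sweedler B a' (\<lambda>a2 a3. \<Phi> (tens C B f1 a1) (tens C B f2 a2) (tens C B f3 a3)))))"
        unfolding \<Phi>_def by (intro sweedler_coassoc [OF CBD(2), where U = ?U] lin') (auto simp: closedH fa)
      also have "\<dots> = sweedler C f (\<lambda>f1 f'. sweedler B a (\<lambda>a1 a'. sweedler C f' (\<lambda>f2 f3.
        sweedler B a' (\<lambda>a2 a3. \<Phi> (tens C B f1 a1) (tens C B f2 a2) (tens C B f3 a3)))))"
        by (rule sweedler_cong', rule sweedler_swap)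
      also have "\<dots> = sweedler C f (\<lambda>f1 f'. sweedler B a (\<lambda>a1 a'. sweedler H (tens C B f' a') (\<lambda>v z. \<Phi> (tens C B f1 a1) v z)))"
        unfolding \<Phi>_def by (intro sweedler_cong' sweedler_H [where U = ?U, symmetric] bilinear_mapI lin') (auto simp: closedH fa)
      also have "\<dots> = sweedler H (tens C B f a) (\<lambda>u y. sweedler H y (\<lambda>v z. \<Phi> u v z))"
        unfolding \<Phi>_def by (intro sweedler_H [where U = ?U, symmetric] bilinear_mapI lin') (auto simp: closedH fa)
      finally show "sweedler H (tens C B f a) (\<lambda>x z. sweedler H x (\<lambda>u v. tens K (K \<otimes> K) u (tens K K v z))) =
        sweedler H (tens C B f a) (\<lambda>u y. sweedler H y (\<lambda>v z. tens K (K \<otimes> K) u (tens K K v z)))"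
        by (simp add: \<Phi>_def)
    qed
    then show "sweedler H x (\<lambda>x z. sweedler H x (\<lambda>u v. tens H (H \<otimes> H) u (tens H H v z))) =
      sweedler H x (\<lambda>u y. sweedler H y (\<lambda>v z. tens H (H \<otimes> H) u (tens H H v z)))"
      by (simp add: tensor_H)
  next
    fix x assume "x \<in> carrier H"
    then have x: "x \<in> carrier K" by simp
    show "sweedler H x (\<lambda>x y. scale H (counit H x) y) = x"
    proof (rule tensor_ext [OF CD(2) _ linear_map_id _ x, where
        f = "\<lambda>x. sweedler H x (\<lambda>x y. scale H (counit H x) y)"])
      show "linear_map K K (\<lambda>x. sweedler H x (\<lambda>x y. scale H (counit H x) y))"
        unfolding scale_H by (intro lin'; simp add: closedH)
      fix f a assume fa: "f \<in> carrier C" "a \<in> carrier B"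
      have "sweedler H (tens C B f a) (\<lambda>x y. scale H (counit H x) y) =
        sweedler C f (\<lambda>f1 f2. sweedler B a (\<lambda>a1 a2. scale K (counit H (tens C B f1 a1)) (tens C B f2 a2)))"
        unfolding scale_H by (intro sweedler_H [where U = K] bilinear_mapI lin') (auto simp: closedH fa)
      also have "\<dots> = sweedler C f (\<lambda>f1 f2. sweedler B a (\<lambda>a1 a2. scale K (counit B a1) (scale K (counit C f1) (tens C B f2 a2))))"
        by (simp add: counit_H_tens vspace_scale [OF vspace_tensor] mult.commute)
      also have "\<dots> = sweedler C f (\<lambda>f1 f2. scale K (counit C f1) (tens C B f2 a))"
        by (intro sweedler_cong' sweedler_counit [OF BD(2)] lin') (auto simp: closedH fa)
      also have "\<dots> = tens C B f a"
        by (intro sweedler_counit [OF CBD(2)] lin') (auto simp: closedH fa)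
      finally show "sweedler H (tens C B f a) (\<lambda>x y. scale H (counit H x) y) = tens C B f a" .
    qed
    show "sweedler H x (\<lambda>x y. scale H (counit H y) x) = x"
    proof (rule tensor_ext [OF CD(2) _ linear_map_id _ x, where
        f = "\<lambda>x. sweedler H x (\<lambda>x y. scale H (counit H y) x)"])
      show "linear_map K K (\<lambda>x. sweedler H x (\<lambda>x y. scale H (counit H y) x))"
        unfolding scale_H by (intro lin'; simp add: closedH)
      fix f a assume fa: "f \<in> carrier C" "a \<in> carrier B"
      have "sweedler H (tens C B f a) (\<lambda>x y. scale H (counit H y) x) =
        sweedler C f (\<lambda>f1 f2. sweedler B a (\<lambda>a1 a2. scale K (counit H (tens C B f2 a2)) (tens C B f1 a1)))"
        unfolding scale_H by (intro sweedler_H [where U = K] bilinear_mapI lin') (auto simp: closedH fa)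
      also have "\<dots> = sweedler C f (\<lambda>f1 f2. sweedler B a (\<lambda>a1 a2. scale K (counit B a2) (scale K (counit C f2) (tens C B f1 a1))))"
        by (simp add: counit_H_tens vspace_scale [OF vspace_tensor] mult.commute)
      also have "\<dots> = sweedler C f (\<lambda>f1 f2. scale K (counit C f2) (tens C B f1 a))"
        by (intro sweedler_cong' sweedler_counit [OF BD(2)] lin') (auto simp: closedH fa)
      also have "\<dots> = tens C B f a"
        by (intro sweedler_counit [OF CBD(2)] lin') (auto simp: closedH fa)
      finally show "sweedler H (tens C B f a) (\<lambda>x y. scale H (counit H y) x) = tens C B f a" .
    qed
  }
qed

section \<open>Compatibility of coproduct and product\<close>

text \<open>Both sides are sums over the legs of \<open>f\<close> and \<open>g\<close> and over four
  legs each of \<open>a\<close> and \<open>b\<close>. In the coproduct of the product, the first two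
  legs of \<open>a\<close> act and the last two multiply, one of each kind per tensor factor; in the
  product of the coproducts, the first two legs serve the first tensor factor and the last two the
  second. The two arrangements differ by exchanging the middle legs, and likewise for
  \<open>b\<close>.\<close>

lemma comult_H_mult_tens:
  assumes fg: "f \<in> carrier C" "g \<in> carrier C" and ab: "a \<in> carrier B" "b \<in> carrier B"
  shows "comult H (lr_mult B C l r (tens C B f a) (tens C B g b)) =
    sweedler H (tens C B f a) (\<lambda>x1 x2. sweedler H (tens C B g b) (\<lambda>y1 y2.
      tens K K (lr_mult B C l r x1 y1) (lr_mult B C l r x2 y2)))"
proof -
  let ?U = "K \<otimes> K"
  \<comment> \<open>One summand of the smash product: \<open>a1\<close> and \<open>b1\<close> are
    the acting legs, \<open>a2\<close> and \<open>b2\<close> the multiplying ones.\<close>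
  define Y where "Y a1 b1 g a2 b2 f = tens C B (mult C (r f b1) (l a1 g)) (mult B a2 b2)" for a1 b1 g a2 b2 f
  have Y: "tens C B (mult C (r f b1) (l a1 g)) (mult B a2 b2) = Y a1 b1 g a2 b2 f" for a1 b1 g a2 b2 f
    by (simp add: Y_def)
  have push: "linear_map K ?U (comult H)"
    using lr_comult_tens(1) [OF BD(3) CBD(3)] by (simp add: comult_H)
  have "comult H (lr_mult B C l r (tens C B f a) (tens C B g b)) =
    sweedler B a (\<lambda>a1 a2. sweedler B b (\<lambda>b1 b2.
      sweedler C (mult C (r f b1) (l a1 g)) (\<lambda>p q. sweedler B (mult B a2 b2) (\<lambda>s t.
        tens K K (tens C B p s) (tens C B q t)))))"
    using assms by (simp add: lr_mult_tens linear_sweedler [OF push] closedH)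
      (simp add: comult_H lr_comult_tens(2) [OF BD(3) CBD(3)] closedH)
  also have "\<dots> = sweedler B a (\<lambda>a1 a2. sweedler B b (\<lambda>b1 b2.
      sweedler C (r f b1) (\<lambda>p q. sweedler C (l a1 g) (\<lambda>p' q'. sweedler B (mult B a2 b2) (\<lambda>s t.
        tens K K (tens C B (mult C p p') s) (tens C B (mult C q q') t))))))"
    by (intro sweedler_cong' sweedler_mult [OF hopf_algebraD(1) [OF HC], where U = ?U] bilinear_mapI linH)
      (auto simp: closedH assms)
  also have "\<dots> = sweedler B a (\<lambda>a1 a2. sweedler B b (\<lambda>b1 b2.
      sweedler B b1 (\<lambda>b11 b12. sweedler C f (\<lambda>f1 f2.
      sweedler C (l a1 g) (\<lambda>p' q'. sweedler B (mult B a2 b2) (\<lambda>s t.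
        tens K K (tens C B (mult C (r f1 b11) p') s) (tens C B (mult C (r f2 b12) q') t)))))))"
    by (intro sweedler_cong' sweedler_act [where U = ?U] bilinear_mapI linH)
      (auto simp: closedH assms)
  also have "\<dots> = sweedler B a (\<lambda>a1 a2. sweedler B b (\<lambda>b1 b2.
      sweedler B b1 (\<lambda>b11 b12. sweedler C f (\<lambda>f1 f2.
      sweedler B a1 (\<lambda>a11 a12. sweedler C g (\<lambda>g1 g2. sweedler B (mult B a2 b2) (\<lambda>s t.
        tens K K (tens C B (mult C (r f1 b11) (l a11 g1)) s) (tens C B (mult C (r f2 b12) (l a12 g2)) t))))))))"
    by (intro sweedler_cong' sweedler_act [where U = ?U] bilinear_mapI linH)
      (auto simp: closedH assms)
  also have "\<dots> = sweedler B a (\<lambda>a1 a2. sweedler B b (\<lambda>b1 b2.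
      sweedler B b1 (\<lambda>b11 b12. sweedler C f (\<lambda>f1 f2.
      sweedler B a1 (\<lambda>a11 a12. sweedler C g (\<lambda>g1 g2. sweedler B a2 (\<lambda>a21 a22. sweedler B b2 (\<lambda>b21 b22.
        tens K K (Y a11 b11 g1 a21 b21 f1) (Y a12 b12 g2 a22 b22 f2)))))))))"
    unfolding Y_def
    by (intro sweedler_cong' sweedler_mult [OF B, where U = ?U] bilinear_mapI linH)
      (auto simp: closedH assms)
  \<comment> \<open>The swap rule is restricted to moving a sum over \<open>C\<close> outwards past
    a sum over \<open>B\<close>, which keeps rewriting terminating and leaves \<open>f\<close>
    before \<open>g\<close>.\<close>
  also have "\<dots> = sweedler C f (\<lambda>f1 f2. sweedler C g (\<lambda>g1 g2.
      sweedler B a (\<lambda>a1 a2. sweedler B b (\<lambda>b1 b2. sweedler B b1 (\<lambda>b11 b12.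
      sweedler B a1 (\<lambda>a11 a12. sweedler B a2 (\<lambda>a21 a22. sweedler B b2 (\<lambda>b21 b22.
        tens K K (Y a11 b11 g1 a21 b21 f1) (Y a12 b12 g2 a22 b22 f2)))))))))"
    by (simp only: sweedler_swap [of B _ C])
  also have "\<dots> = sweedler C f (\<lambda>f1 f2. sweedler C g (\<lambda>g1 g2.
      sweedler B a (\<lambda>a1 a2. sweedler B a1 (\<lambda>a11 a12. sweedler B b (\<lambda>b1 b2. sweedler B b1 (\<lambda>b11 b12.
      sweedler B a2 (\<lambda>a21 a22. sweedler B b2 (\<lambda>b21 b22.
        tens K K (Y a11 b11 g1 a21 b21 f1) (Y a12 b12 g2 a22 b22 f2)))))))))"
    by (rule sweedler_cong', rule sweedler_cong', rule sweedler_cong', rule sweedler_swap2')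
  also have "\<dots> = sweedler C f (\<lambda>f1 f2. sweedler C g (\<lambda>g1 g2.
      sweedler B a (\<lambda>a1 a2. sweedler B a1 (\<lambda>a11 a12. sweedler B a2 (\<lambda>a21 a22.
      sweedler B b (\<lambda>b1 b2. sweedler B b1 (\<lambda>b11 b12. sweedler B b2 (\<lambda>b21 b22.
        tens K K (Y a11 b11 g1 a21 b21 f1) (Y a12 b12 g2 a22 b22 f2)))))))))"
    by (rule sweedler_cong', rule sweedler_cong', rule sweedler_cong', rule sweedler_cong', rule sweedler_swap2')
  \<comment> \<open>Here cocommutativity exchanges \<open>a12\<close> with \<open>a21\<close>; the
    next step does the same for \<open>b12\<close> and \<open>b21\<close>.\<close>
  also have "\<dots> = sweedler C f (\<lambda>f1 f2. sweedler C g (\<lambda>g1 g2.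
      sweedler B a (\<lambda>a1 a2. sweedler B a1 (\<lambda>a11 a12. sweedler B a2 (\<lambda>a21 a22.
      sweedler B b (\<lambda>b1 b2. sweedler B b1 (\<lambda>b11 b12. sweedler B b2 (\<lambda>b21 b22.
        tens K K (Y a11 b11 g1 a12 b21 f1) (Y a21 b12 g2 a22 b22 f2)))))))))"
    unfolding Y_def
    by (intro sweedler_cong' sweedler_middle [OF BD(2) cc, where U = ?U] linH) (auto simp: closedH assms)
  also have "\<dots> = sweedler C f (\<lambda>f1 f2. sweedler C g (\<lambda>g1 g2.
      sweedler B a (\<lambda>a1 a2. sweedler B a1 (\<lambda>a11 a12. sweedler B a2 (\<lambda>a21 a22.
      sweedler B b (\<lambda>b1 b2. sweedler B b1 (\<lambda>b11 b12. sweedler B b2 (\<lambda>b21 b22.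
        tens K K (Y a11 b11 g1 a12 b12 f1) (Y a21 b21 g2 a22 b22 f2)))))))))"
    unfolding Y_def
    by (intro sweedler_cong' sweedler_middle [OF BD(2) cc, where U = ?U] linH) (auto simp: closedH assms)
  also have "\<dots> = sweedler C f (\<lambda>f1 f2. sweedler C g (\<lambda>g1 g2.
      sweedler B a (\<lambda>a1 a2. sweedler B a1 (\<lambda>a11 a12. sweedler B b (\<lambda>b1 b2. sweedler B b1 (\<lambda>b11 b12.
      sweedler B a2 (\<lambda>a21 a22. sweedler B b2 (\<lambda>b21 b22.
        tens K K (Y a11 b11 g1 a12 b12 f1) (Y a21 b21 g2 a22 b22 f2)))))))))"
    by (rule sweedler_cong', rule sweedler_cong', rule sweedler_cong', rule sweedler_cong',
        rule sweedler_swap2' [symmetric])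
  also have "\<dots> = sweedler C f (\<lambda>f1 f2. sweedler C g (\<lambda>g1 g2.
      sweedler B a (\<lambda>a1 a2. sweedler B b (\<lambda>b1 b2. sweedler B a1 (\<lambda>a11 a12. sweedler B b1 (\<lambda>b11 b12.
      sweedler B a2 (\<lambda>a21 a22. sweedler B b2 (\<lambda>b21 b22.
        tens K K (Y a11 b11 g1 a12 b12 f1) (Y a21 b21 g2 a22 b22 f2)))))))))"
    by (rule sweedler_cong', rule sweedler_cong', rule sweedler_cong', rule sweedler_swap)
  also have "\<dots> = sweedler C f (\<lambda>f1 f2. sweedler B a (\<lambda>a1 a2. sweedler C g (\<lambda>g1 g2. sweedler B b (\<lambda>b1 b2.
      sweedler B a1 (\<lambda>a11 a12. sweedler B b1 (\<lambda>b11 b12.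
      sweedler B a2 (\<lambda>a21 a22. sweedler B b2 (\<lambda>b21 b22.
        tens K K (Y a11 b11 g1 a12 b12 f1) (Y a21 b21 g2 a22 b22 f2)))))))))"
    by (rule sweedler_cong', rule sweedler_swap)
  also have "\<dots> = sweedler C f (\<lambda>f1 f2. sweedler B a (\<lambda>a1 a2. sweedler C g (\<lambda>g1 g2. sweedler B b (\<lambda>b1 b2.
      tens K K (lr_mult B C l r (tens C B f1 a1) (tens C B g1 b1)) (lr_mult B C l r (tens C B f2 a2) (tens C B g2 b2))))))"
  proof (intro sweedler_cong')
    fix f1 f2 a1 a2 g1 g2 b1 b2
    assume c: "f1 \<in> carrier C" "f2 \<in> carrier C" "a1 \<in> carrier B" "a2 \<in> carrier B"
      "g1 \<in> carrier C" "g2 \<in> carrier C" "b1 \<in> carrier B" "b2 \<in> carrier B"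
    have push1: "linear_map K ?U (\<lambda>x. tens K K x y)" if "y \<in> carrier K" for y
      using that by (intro lin)
    have push2: "linear_map K ?U (\<lambda>y. tens K K x y)" if "x \<in> carrier K" for x
      using that by (intro lin)
    have cl: "Y a b f' a' b' f \<in> carrier K"
      if "f \<in> carrier C" "f' \<in> carrier C" "a \<in> carrier B" "a' \<in> carrier B" "b \<in> carrier B" "b' \<in> carrier B"
      for a b f' a' b' f
      using that by (simp add: Y_def closed)
    \<comment> \<open>The two tensor factors are expanded one after the other. Holding the second
      fixed as \<open>z\<close> places the sums over the legs of \<open>a1\<close> and
      \<open>b1\<close> outside those of \<open>a2\<close> and \<open>b2\<close>, as the nesting on
      the other side demands.\<close>
    have e: "tens K K (lr_mult B C l r (tens C B f1 a1) (tens C B g1 b1)) z =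
      sweedler B a1 (\<lambda>a11 a12. sweedler B b1 (\<lambda>b11 b12. tens K K (Y a11 b11 g1 a12 b12 f1) z))"
      if "z \<in> carrier K" for z
      using c that by (simp add: lr_mult_tens Y cl vspaces sweedler_closed linear_sweedler [OF push1])
    show "sweedler B a1 (\<lambda>a11 a12. sweedler B b1 (\<lambda>b11 b12.
        sweedler B a2 (\<lambda>a21 a22. sweedler B b2 (\<lambda>b21 b22.
        tens K K (Y a11 b11 g1 a12 b12 f1) (Y a21 b21 g2 a22 b22 f2))))) =
      tens K K (lr_mult B C l r (tens C B f1 a1) (tens C B g1 b1)) (lr_mult B C l r (tens C B f2 a2) (tens C B g2 b2))"
      using c by (subst e) (simp_all add: lr_mult_tens Y cl vspaces sweedler_closed linear_sweedler [OF push2])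
  qed
  also have "\<dots> = sweedler C f (\<lambda>f1 f2. sweedler B a (\<lambda>a1 a2. sweedler H (tens C B g b) (\<lambda>y1 y2.
      tens K K (lr_mult B C l r (tens C B f1 a1) y1) (lr_mult B C l r (tens C B f2 a2) y2))))"
    by (intro sweedler_cong' sweedler_H [where U = ?U, symmetric] bilinear_mapI linH) (auto simp: closedH assms)
  also have "\<dots> = sweedler H (tens C B f a) (\<lambda>x1 x2. sweedler H (tens C B g b) (\<lambda>y1 y2.
      tens K K (lr_mult B C l r x1 y1) (lr_mult B C l r x2 y2)))"
    by (intro sweedler_H [where U = ?U, symmetric] bilinear_mapI linH) (auto simp: closedH assms)
  finally show ?thesis .
qed

lemma bialgebra_H: "bialgebra H"
proof (rule bialgebraI [OF algebra_H coalgebra_H])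
  note linK = linear_map_id linear_map_tens bilinear_map_linear [OF bilinear_lr_mult]
    linear_map_sweedler_fun linear_map_sweedler [OF precoalgebra_H, unfolded carrier_H linear_map_H]
    linear_map_times linear_map_comp [OF linear_counit_H]
    linear_map_comp [OF lr_comult_tens(1) [OF BD(3) CBD(3)]]
  show "comult H (one H) = tens H H (one H) (one H)"
  proof -
    have "comult H (one H) = sweedler C (one C) (\<lambda>f1 f2. sweedler B (one B) (\<lambda>a1 a2.
        tens K K (tens C B f1 a1) (tens C B f2 a2)))"
      by (simp add: comult_H one_H lr_comult_tens(2) [OF BD(3) CBD(3)] closedH)
    also have "\<dots> = sweedler B (one B) (\<lambda>a1 a2. tens K K (tens C B (one C) a1) (tens C B (one C) a2))"
      by (intro sweedler_one [OF hopf_algebraD(1) [OF HC], where U = "K \<otimes> K"] bilinear_mapI linH)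
        (auto simp: closedH)
    also have "\<dots> = tens K K (tens C B (one C) (one B)) (tens C B (one C) (one B))"
      by (intro sweedler_one [OF B, where U = "K \<otimes> K"] bilinear_mapI linH)
        (auto simp: closedH)
    finally show ?thesis by (simp add: one_H tensor_H)
  qed
  show "counit H (one H) = 1"
    using B hopf_algebraD(1) [OF HC] by (simp add: one_H counit_H_tens closedH bialgebra_def)
  fix x y assume "x \<in> carrier H" "y \<in> carrier H"
  then have xy: "x \<in> carrier K" "y \<in> carrier K" by simp_all
  have "comult H (lr_mult B C l r x y) =
    sweedler H x (\<lambda>x1 x2. sweedler H y (\<lambda>y1 y2. tens K K (lr_mult B C l r x1 y1) (lr_mult B C l r x2 y2)))"
    unfolding comult_H
    by (rule tensor_ext2 [where U = "K \<otimes> K" and f = "\<lambda>x y. lr_comult B C (lr_mult B C l r x y)" and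
      g = "\<lambda>x y. sweedler H x (\<lambda>x1 x2. sweedler H y (\<lambda>y1 y2. tens K K (lr_mult B C l r x1 y1) (lr_mult B C l r x2 y2)))",
      OF CD(2,2) _ _ comult_H_mult_tens [unfolded comult_H] xy])
     (auto intro!: bilinear_mapI linK simp: closedH)
  \<comment> \<open>The congruence rule supplies memberships in \<open>carrier H\<close>, so
    \<open>mult_H\<close> is used in that form.\<close>
  then show "comult H (mult H x y) =
      sweedler H x (\<lambda>x1 x2. sweedler H y (\<lambda>y1 y2. tens H H (mult H x1 y1) (mult H x2 y2)))"
    using \<open>x \<in> carrier H\<close> \<open>y \<in> carrier H\<close>
    by (simp add: mult_H [folded carrier_H] tensor_H del: carrier_H)
  have 1: "counit H (lr_mult B C l r (tens C B f a) (tens C B g b)) = counit H (tens C B f a) * counit H (tens C B g b)"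
    if fg: "f \<in> carrier C" "a \<in> carrier B" "g \<in> carrier C" "b \<in> carrier B" for f a g b
  proof -
    have e: "counit C (mult C f g) = counit C f * counit C g" if "f \<in> carrier C" "g \<in> carrier C" for f g
      using hopf_algebraD(1) [OF HC] that by (simp add: bialgebra_def)
    have e': "counit B (mult B f g) = counit B f * counit B g" if "f \<in> carrier B" "g \<in> carrier B" for f g
      using B that by (simp add: bialgebra_def)
    \<comment> \<open>Acting legs contribute only their counits, so the double sum collapses by one
      counit contraction for \<open>b\<close> and one for \<open>a\<close>.\<close>
    have "counit H (lr_mult B C l r (tens C B f a) (tens C B g b)) =
      sweedler B a (\<lambda>a1 a2. sweedler B b (\<lambda>b1 b2. scale ground (counit B b1)
        (counit C f * (counit B a1 * counit C g) * (counit B a2 * counit B b2))))"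
      using fg by (simp add: lr_mult_tens linear_sweedler [OF linear_counit_H] closedH counit_H_tens
        e e' counit_act mult_ac)
    also have "\<dots> = sweedler B a (\<lambda>a1 a2.
        (counit C f * (counit B a1 * counit C g) * (counit B a2 * counit B b)))"
      by (intro sweedler_cong' sweedler_counit [OF BD(2)] linear_map_times BD fg)
    also have "\<dots> = sweedler B a (\<lambda>a1 a2. scale ground (counit B a1)
        (counit C f * counit C g * counit B b * counit B a2))"
      by (simp add: mult_ac)
    also have "\<dots> = counit C f * counit C g * counit B b * counit B a"
      by (intro sweedler_counit [OF BD(2)] linear_map_times BD fg)
    finally show ?thesis using fg by (simp add: counit_H_tens mult_ac)
  qed
  have "counit H (lr_mult B C l r x y) = counit H x * counit H y"
    by (rule tensor_ext2 [where U = ground and f = "\<lambda>x y. counit H (lr_mult B C l r x y)" and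
      g = "\<lambda>x y. counit H x * counit H y", OF CD(2,2) _ _ 1 xy])
     (auto intro!: bilinear_mapI linK simp: closedH)
  then show "counit H (mult H x y) = counit H x * counit H y" using xy by (simp add: mult_H)
qed

section \<open>The antipode of the smash product\<close>

lemma antipode_H_tens:
  shows "linear_map K K (antipode H)"
    and "f \<in> carrier C \<Longrightarrow> a \<in> carrier B \<Longrightarrow> antipode H (tens C B f a) =
      sweedler B a (\<lambda>a1 a'. sweedler B a' (\<lambda>a2 a3.
        tens C B (r (l (antipode B a1) (antipode C f)) (antipode B a2)) (antipode B a3)))"
proof -
  let ?h = "\<lambda>f a. sweedler B a (\<lambda>a1 a'. sweedler B a' (\<lambda>a2 a3.
        tens C B (r (l (antipode B a1) (antipode C f)) (antipode B a2)) (antipode B a3)))"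
  have h: "tlift B B (\<lambda>a1 a'. tlift B B (\<lambda>a2 a3.
       tens C B (r (l (antipode B a1) (antipode C f)) (antipode B a2)) (antipode B a3))
       (comult B a')) (comult B a) = ?h f a" if "f \<in> carrier C" "a \<in> carrier B" for f a
  proof -
    have "tlift B B (\<lambda>a1 a'. tlift B B (\<lambda>a2 a3.
       tens C B (r (l (antipode B a1) (antipode C f)) (antipode B a2)) (antipode B a3))
       (comult B a')) (comult B a) =
      tlift B B (\<lambda>a1 a'. sweedler B a' (\<lambda>a2 a3.
       tens C B (r (l (antipode B a1) (antipode C f)) (antipode B a2)) (antipode B a3))) (comult B a)"
      by (intro tlift_cong tlift_comult [OF BD(3), where U = K] bilinear_mapI linH)
        (simp_all add: closedH that)
    also have "\<dots> = ?h f a"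
      by (intro tlift_comult [OF BD(3), where U = K] bilinear_mapI linH)
        (simp_all add: closedH that)
    finally show ?thesis .
  qed
  have e: "antipode H x = tlift C B ?h x" for x
    unfolding antipode_H lr_antipode_def by (intro tlift_cong h)
  have b: "bilinear_map C B K ?h"
    by (intro bilinear_mapI linH) (simp_all add: closedH)
  show "linear_map K K (antipode H)"
    unfolding e by (rule linear_tlift [OF CD(2) vspace_tensor b])
  show "f \<in> carrier C \<Longrightarrow> a \<in> carrier B \<Longrightarrow> antipode H (tens C B f a) = ?h f a"
    unfolding e by (rule tlift_tens [OF vspace_tensor b])
qed

text \<open>Writing J for both antipodes, the expanded summand is ((J p \<rightharpoonup> J f1)
  \<leftharpoonup> (J u) y1) (J v1 \<rightharpoonup> f2) \<otimes> (J v2) y2 in six legs of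
  \<open>a\<close>. Contracting \<open>u\<close> against \<open>y1\<close> and \<open>v2\<close>
  against \<open>y2\<close> leaves (J a \<rightharpoonup> (J f1) f2) \<otimes> 1, and the antipode
  axiom of \<open>C\<close> applies to the legs of \<open>f\<close>.\<close>

lemma antipode_H_left:
  assumes f: "f \<in> carrier C" and a: "a \<in> carrier B"
  shows "sweedler H (tens C B f a) (\<lambda>x y. lr_mult B C l r (antipode H x) y) =
    scale K (counit H (tens C B f a)) (tens C B (one C) (one B))"
proof -
  let ?J = "antipode B"
  \<comment> \<open>The slots \<open>m\<close> and \<open>n\<close> hold the two products in
    \<open>B\<close> that will be contracted.\<close>
  define G where "G f1 f2 p m v n = tens C B (mult C (r (l (?J p) (antipode C f1)) m) (l (?J v) f2)) n"
    for f1 f2 p m v n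
  note linJ = linH linear_map_comp [OF antipode_H_tens(1)]
  have 1: "sweedler B a (\<lambda>s t. lr_mult B C l r (antipode H (tens C B f1 s)) (tens C B f2 t)) =
      tens C B (l (?J a) (mult C (antipode C f1) f2)) (one B)"
    if fs: "f1 \<in> carrier C" "f2 \<in> carrier C" for f1 f2
  proof -
    have push: "linear_map K K (\<lambda>x. lr_mult B C l r x (tens C B f2 t))" if "t \<in> carrier B" for t
      using that fs by (intro linH) (simp_all add: closedH)
    have "sweedler B a (\<lambda>s t. lr_mult B C l r (antipode H (tens C B f1 s)) (tens C B f2 t)) =
      sweedler B a (\<lambda>s t. sweedler B s (\<lambda>p q. sweedler B q (\<lambda>u v.
        sweedler B (?J v) (\<lambda>v1 v2. sweedler B t (\<lambda>y1 y2.
        tens C B (mult C (r (r (l (?J p) (antipode C f1)) (?J u)) y1) (l v1 f2)) (mult B v2 y2))))))"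
      using fs by (simp add: antipode_H_tens linear_sweedler [OF push] lr_mult_tens closedH)
    also have "\<dots> = sweedler B a (\<lambda>s t. sweedler B s (\<lambda>p q. sweedler B q (\<lambda>u v.
        sweedler B v (\<lambda>v1 v2. sweedler B t (\<lambda>y1 y2.
        tens C B (mult C (r (r (l (?J p) (antipode C f1)) (?J u)) y1) (l (?J v1) f2)) (mult B (?J v2) y2))))))"
      by (intro sweedler_cong' comult_antipode [OF HB cc, where U = K] bilinear_mapI linH)
        (simp_all add: closedH fs)
    also have "\<dots> = sweedler B a (\<lambda>s t. sweedler B s (\<lambda>p q. sweedler B q (\<lambda>u v.
        sweedler B v (\<lambda>v1 v2. sweedler B t (\<lambda>y1 y2. G f1 f2 p (mult B (?J u) y1) v1 (mult B (?J v2) y2))))))"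
      by (simp add: G_def act_simps closedH fs)
    \<comment> \<open>Only \<open>p\<close> and \<open>v1\<close> survive the contractions. They are
      first made adjacent and then gathered as the legs of one element \<open>e\<close> split off in
      front.\<close>
    also have "\<dots> = sweedler B a (\<lambda>s t. sweedler B s (\<lambda>p q. sweedler B q (\<lambda>v1 w.
        sweedler B w (\<lambda>u v2. sweedler B t (\<lambda>y1 y2. G f1 f2 p (mult B (?J u) y1) v1 (mult B (?J v2) y2))))))"
      unfolding G_def
      by (intro sweedler_cong' sweedler_triple_commute [where U = K] linH) (simp_all add: closedH fs)
    also have "\<dots> = sweedler B a (\<lambda>s t. sweedler B s (\<lambda>e w. sweedler B e (\<lambda>p v1.
        sweedler B w (\<lambda>u v2. sweedler B t (\<lambda>y1 y2. G f1 f2 p (mult B (?J u) y1) v1 (mult B (?J v2) y2))))))"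
      unfolding G_def
      by (intro sweedler_cong' sweedler_coassoc [OF BD(2), where U = K, symmetric] linH)
        (simp_all add: closedH fs)
    also have "\<dots> = sweedler B a (\<lambda>e z. sweedler B z (\<lambda>w t. sweedler B e (\<lambda>p v1.
        sweedler B w (\<lambda>u v2. sweedler B t (\<lambda>y1 y2. G f1 f2 p (mult B (?J u) y1) v1 (mult B (?J v2) y2))))))"
      unfolding G_def
      by (intro sweedler_coassoc [OF BD(2), where U = K] linH) (simp_all add: closedH fs a)
    also have "\<dots> = sweedler B a (\<lambda>e z. sweedler B e (\<lambda>p v1. sweedler B z (\<lambda>w t.
        sweedler B w (\<lambda>u v2. sweedler B t (\<lambda>y1 y2. G f1 f2 p (mult B (?J u) y1) v1 (mult B (?J v2) y2))))))"
      by (rule sweedler_cong', rule sweedler_swap)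
    \<comment> \<open>The other four legs are in the order \<open>u\<close>, \<open>v2\<close>,
      \<open>y1\<close>, \<open>y2\<close>. Exchanging the middle two creates both pairs for the
      antipode axiom; each contraction leaves a counit that collapses one splitting.\<close>
    also have "\<dots> = sweedler B a (\<lambda>e z. sweedler B e (\<lambda>p v1. sweedler B z (\<lambda>w t.
        sweedler B w (\<lambda>u y1. sweedler B t (\<lambda>v2 y2. G f1 f2 p (mult B (?J u) y1) v1 (mult B (?J v2) y2))))))"
      unfolding G_def
      by (intro sweedler_cong' sweedler_middle [OF BD(2) cc, where U = K] linH) (simp_all add: closedH fs)
    also have "\<dots> = sweedler B a (\<lambda>e z. sweedler B e (\<lambda>p v1. sweedler B z (\<lambda>w t.
        scale K (counit B w) (sweedler B t (\<lambda>v2 y2. G f1 f2 p (one B) v1 (mult B (?J v2) y2))))))"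
      unfolding G_def
      by (intro sweedler_cong' sweedler_antipode [OF HB] linH) (simp_all add: closedH fs)
    also have "\<dots> = sweedler B a (\<lambda>e z. sweedler B e (\<lambda>p v1.
        sweedler B z (\<lambda>v2 y2. G f1 f2 p (one B) v1 (mult B (?J v2) y2))))"
      unfolding G_def
      by (intro sweedler_cong' sweedler_counit [OF BD(2)] linH) (simp_all add: closedH fs)
    also have "\<dots> = sweedler B a (\<lambda>e z. sweedler B e (\<lambda>p v1.
        scale K (counit B z) (G f1 f2 p (one B) v1 (one B))))"
      unfolding G_def
      by (intro sweedler_cong' sweedler_antipode [OF HB] linH) (simp_all add: closedH fs)
    also have "\<dots> = sweedler B a (\<lambda>e z.
        scale K (counit B z) (sweedler B e (\<lambda>p v1. G f1 f2 p (one B) v1 (one B))))"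
      by (intro sweedler_cong' linear_sweedler [OF linear_map_scale [OF vspace_tensor linear_map_id] vspace_tensor, symmetric])
        (simp add: G_def closedH fs)
    also have "\<dots> = sweedler B a (\<lambda>p v1. G f1 f2 p (one B) v1 (one B))"
      unfolding G_def
      by (intro sweedler_counit [OF BD(2)] linH) (simp_all add: closedH fs a)
    also have "\<dots> = sweedler B a (\<lambda>p v1. tens C B (mult C (l (?J p) (antipode C f1)) (l (?J v1) f2)) (one B))"
      by (simp add: G_def alg_simps closedH fs)
    \<comment> \<open>The antipode of \<open>B\<close> is a coalgebra map here, so its values at
      \<open>p\<close> and \<open>v1\<close> are legs of \<open>?J a\<close>, and the module-algebra
      law folds them into a single action.\<close>
    also have "\<dots> = sweedler B (?J a) (\<lambda>p v1. tens C B (mult C (l p (antipode C f1)) (l v1 f2)) (one B))"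
      by (intro comult_antipode [OF HB cc, where U = K, symmetric] bilinear_mapI linH)
        (simp_all add: closedH fs a)
    also have "\<dots> = tens C B (l (?J a) (mult C (antipode C f1) f2)) (one B)"
    proof -
      have "linear_map C K (\<lambda>g. tens C B g (one B))" by (intro lin) (simp add: closed)
      then show ?thesis by (simp add: act_mult closedH fs a linear_sweedler [of C K "\<lambda>g. tens C B g (one B)"])
    qed
    finally show ?thesis .
  qed
  have "sweedler H (tens C B f a) (\<lambda>x y. lr_mult B C l r (antipode H x) y) =
    sweedler C f (\<lambda>f1 f2. sweedler B a (\<lambda>s t. lr_mult B C l r (antipode H (tens C B f1 s)) (tens C B f2 t)))"
    by (intro sweedler_H [where U = K] bilinear_mapI linJ)
      (simp_all add: closedH linear_mapD(1) [OF antipode_H_tens(1)] f a)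
  also have "\<dots> = sweedler C f (\<lambda>f1 f2. tens C B (l (?J a) (mult C (antipode C f1) f2)) (one B))"
    by (intro sweedler_cong' 1)
  also have "\<dots> = scale K (counit C f) (tens C B (l (?J a) (one C)) (one B))"
    by (intro sweedler_antipode [OF HC] linH) (simp_all add: closedH f a)
  also have "\<dots> = scale K (counit H (tens C B f a)) (tens C B (one C) (one B))"
    using linear_mapD(3) [OF bilinear_map_linear(1) [OF bilinear_tens [of C B] linear_map_id [of C] BD(5)] CD(3)]
    by (simp add: act_one counit_antipode [OF HB] counit_H_tens f a closedH vspace_scale [OF vspace_tensor])
  finally show ?thesis .
qed

text \<open>The mirror computation, again with J for both antipodes: the summand is (f1
  \<leftharpoonup> J v1) ((s1 (J p) \<rightharpoonup> J f2) \<leftharpoonup> J u) \<otimes> s2 (J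
  v2). Contracting \<open>s1\<close> against \<open>p\<close> and \<open>s2\<close> against
  \<open>v2\<close> leaves (f1 (J f2) \<leftharpoonup> J a) \<otimes> 1.\<close>

lemma antipode_H_right:
  assumes f: "f \<in> carrier C" and a: "a \<in> carrier B"
  shows "sweedler H (tens C B f a) (\<lambda>x y. lr_mult B C l r x (antipode H y)) =
    scale K (counit H (tens C B f a)) (tens C B (one C) (one B))"
proof -
  let ?J = "antipode B"
  define G where "G f1 f2 m u v n = tens C B (mult C (r f1 (?J v)) (r (l m (antipode C f2)) (?J u))) n"
    for f1 f2 m u v n
  note linJ = linH linear_map_comp [OF antipode_H_tens(1)]
  have 1: "sweedler B a (\<lambda>s t. lr_mult B C l r (tens C B f1 s) (antipode H (tens C B f2 t))) =
      tens C B (r (mult C f1 (antipode C f2)) (?J a)) (one B)"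
    if fs: "f1 \<in> carrier C" "f2 \<in> carrier C" for f1 f2
  proof -
    have push: "linear_map K K (\<lambda>x. lr_mult B C l r (tens C B f1 s) x)" if "s \<in> carrier B" for s
      using that fs by (intro linH) (simp_all add: closedH)
    have "sweedler B a (\<lambda>s t. lr_mult B C l r (tens C B f1 s) (antipode H (tens C B f2 t))) =
      sweedler B a (\<lambda>s t. sweedler B t (\<lambda>p q. sweedler B q (\<lambda>u v.
        sweedler B s (\<lambda>s1 s2. sweedler B (?J v) (\<lambda>v1 v2.
        tens C B (mult C (r f1 v1) (l s1 (r (l (?J p) (antipode C f2)) (?J u)))) (mult B s2 v2))))))"
      using fs by (simp add: antipode_H_tens linear_sweedler [OF push] lr_mult_tens closedH)
    also have "\<dots> = sweedler B a (\<lambda>s t. sweedler B t (\<lambda>p q. sweedler B q (\<lambda>u v.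
        sweedler B s (\<lambda>s1 s2. sweedler B v (\<lambda>v1 v2.
        tens C B (mult C (r f1 (?J v1)) (l s1 (r (l (?J p) (antipode C f2)) (?J u)))) (mult B s2 (?J v2)))))))"
      by (intro sweedler_cong' comult_antipode [OF HB cc, where U = K] bilinear_mapI linH)
        (simp_all add: closedH fs)
    also have "\<dots> = sweedler B a (\<lambda>s t. sweedler B t (\<lambda>p q. sweedler B q (\<lambda>u v.
        sweedler B s (\<lambda>s1 s2. sweedler B v (\<lambda>v1 v2. G f1 f2 (mult B s1 (?J p)) u v1 (mult B s2 (?J v2)))))))"
      by (simp add: G_def act_simps closedH fs)
    also have "\<dots> = sweedler B a (\<lambda>s t. sweedler B t (\<lambda>p q. sweedler B q (\<lambda>u v.
        sweedler B v (\<lambda>v1 v2. sweedler B s (\<lambda>s1 s2. G f1 f2 (mult B s1 (?J p)) u v1 (mult B s2 (?J v2)))))))"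
      by (intro sweedler_cong' sweedler_swap)
    \<comment> \<open>The surviving legs \<open>u\<close> and \<open>v1\<close> are gathered under
      \<open>e\<close>, which two leg exchanges then carry in front of \<open>p\<close> and of
      \<open>s\<close>.\<close>
    also have "\<dots> = sweedler B a (\<lambda>s t. sweedler B t (\<lambda>p q. sweedler B q (\<lambda>e v2.
        sweedler B e (\<lambda>u v1. sweedler B s (\<lambda>s1 s2. G f1 f2 (mult B s1 (?J p)) u v1 (mult B s2 (?J v2)))))))"
      unfolding G_def
      by (intro sweedler_cong' sweedler_coassoc [OF BD(2), where U = K, symmetric] linH)
        (simp_all add: closedH fs)
    also have "\<dots> = sweedler B a (\<lambda>s t. sweedler B t (\<lambda>e w. sweedler B w (\<lambda>p v2.
        sweedler B e (\<lambda>u v1. sweedler B s (\<lambda>s1 s2. G f1 f2 (mult B s1 (?J p)) u v1 (mult B s2 (?J v2)))))))"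
      unfolding G_def
      by (intro sweedler_cong' sweedler_triple_commute [where U = K] linH) (simp_all add: closedH fs)
    also have "\<dots> = sweedler B a (\<lambda>e z. sweedler B z (\<lambda>s w. sweedler B w (\<lambda>p v2.
        sweedler B e (\<lambda>u v1. sweedler B s (\<lambda>s1 s2. G f1 f2 (mult B s1 (?J p)) u v1 (mult B s2 (?J v2)))))))"
      unfolding G_def
      by (intro sweedler_triple_commute [where U = K] linH) (simp_all add: closedH fs a)
    also have "\<dots> = sweedler B a (\<lambda>e z. sweedler B e (\<lambda>u v1. sweedler B z (\<lambda>s w. sweedler B s (\<lambda>s1 s2.
        sweedler B w (\<lambda>p v2. G f1 f2 (mult B s1 (?J p)) u v1 (mult B s2 (?J v2)))))))"
      by (rule sweedler_cong', rule trans [OF sweedler_swap2], rule sweedler_cong', rule sweedler_cong',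
        rule sweedler_swap)
    also have "\<dots> = sweedler B a (\<lambda>e z. sweedler B e (\<lambda>u v1. sweedler B z (\<lambda>s w. sweedler B s (\<lambda>s1 p.
        sweedler B w (\<lambda>s2 v2. G f1 f2 (mult B s1 (?J p)) u v1 (mult B s2 (?J v2)))))))"
      unfolding G_def
      by (intro sweedler_cong' sweedler_middle [OF BD(2) cc, where U = K] linH) (simp_all add: closedH fs)
    also have "\<dots> = sweedler B a (\<lambda>e z. sweedler B e (\<lambda>u v1. sweedler B z (\<lambda>s w. scale K (counit B s)
        (sweedler B w (\<lambda>s2 v2. G f1 f2 (one B) u v1 (mult B s2 (?J v2)))))))"
      unfolding G_def
      by (intro sweedler_cong' sweedler_antipode [OF HB] linH) (simp_all add: closedH fs)
    also have "\<dots> = sweedler B a (\<lambda>e z. sweedler B e (\<lambda>u v1.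
        sweedler B z (\<lambda>s2 v2. G f1 f2 (one B) u v1 (mult B s2 (?J v2)))))"
      unfolding G_def
      by (intro sweedler_cong' sweedler_counit [OF BD(2)] linH) (simp_all add: closedH fs)
    also have "\<dots> = sweedler B a (\<lambda>e z. sweedler B e (\<lambda>u v1.
        scale K (counit B z) (G f1 f2 (one B) u v1 (one B))))"
      unfolding G_def
      by (intro sweedler_cong' sweedler_antipode [OF HB] linH) (simp_all add: closedH fs)
    also have "\<dots> = sweedler B a (\<lambda>e z.
        scale K (counit B z) (sweedler B e (\<lambda>u v1. G f1 f2 (one B) u v1 (one B))))"
      by (intro sweedler_cong' linear_sweedler [OF linear_map_scale [OF vspace_tensor linear_map_id] vspace_tensor, symmetric])
        (simp add: G_def closedH fs)
    also have "\<dots> = sweedler B a (\<lambda>u v1. G f1 f2 (one B) u v1 (one B))"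
      unfolding G_def
      by (intro sweedler_counit [OF BD(2)] linH) (simp_all add: closedH fs a)
    \<comment> \<open>The module-algebra law wants the leg acting on \<open>f1\<close> first, but
      the legs stand in the order \<open>u\<close>, \<open>v1\<close>; one more use of
      cocommutativity exchanges them.\<close>
    also have "\<dots> = sweedler B a (\<lambda>v1 u. G f1 f2 (one B) u v1 (one B))"
      unfolding G_def
      by (intro sweedler_commute [OF BD(3) cc, where U = K, symmetric] linH) (simp_all add: closedH fs a)
    also have "\<dots> = sweedler B a (\<lambda>v u. tens C B (mult C (r f1 (?J v)) (r (antipode C f2) (?J u))) (one B))"
      by (simp add: G_def alg_simps closedH fs)
    also have "\<dots> = sweedler B (?J a) (\<lambda>v u. tens C B (mult C (r f1 v) (r (antipode C f2) u)) (one B))"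
      by (intro comult_antipode [OF HB cc, where U = K, symmetric] bilinear_mapI linH)
        (simp_all add: closedH fs a)
    also have "\<dots> = tens C B (r (mult C f1 (antipode C f2)) (?J a)) (one B)"
    proof -
      have "linear_map C K (\<lambda>g. tens C B g (one B))" by (intro lin) (simp add: closed)
      then show ?thesis by (simp add: act_mult closedH fs a linear_sweedler [of C K "\<lambda>g. tens C B g (one B)"])
    qed
    finally show ?thesis .
  qed
  have "sweedler H (tens C B f a) (\<lambda>x y. lr_mult B C l r x (antipode H y)) =
    sweedler C f (\<lambda>f1 f2. sweedler B a (\<lambda>s t. lr_mult B C l r (tens C B f1 s) (antipode H (tens C B f2 t))))"
    by (intro sweedler_H [where U = K] bilinear_mapI linJ)
      (simp_all add: closedH linear_mapD(1) [OF antipode_H_tens(1)] f a)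
  also have "\<dots> = sweedler C f (\<lambda>f1 f2. tens C B (r (mult C f1 (antipode C f2)) (?J a)) (one B))"
    by (intro sweedler_cong' 1)
  also have "\<dots> = scale K (counit C f) (tens C B (r (one C) (?J a)) (one B))"
    by (intro sweedler_antipode [OF HC] linH) (simp_all add: closedH f a)
  also have "\<dots> = scale K (counit H (tens C B f a)) (tens C B (one C) (one B))"
    using linear_mapD(3) [OF bilinear_map_linear(1) [OF bilinear_tens [of C B] linear_map_id [of C] BD(5)] CD(3)]
    by (simp add: act_one counit_antipode [OF HB] counit_H_tens f a closedH vspace_scale [OF vspace_tensor])
  finally show ?thesis .
qed

theorem hopf_algebra_H: "hopf_algebra H"
proof (rule hopf_algebraI [OF bialgebra_H])
  note linK = linear_map_id linear_map_tens bilinear_map_linear [OF bilinear_lr_mult]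
    linear_map_comp [OF antipode_H_tens(1)] linear_map_scale_left linear_counit_H
    linear_map_sweedler [OF precoalgebra_H, unfolded carrier_H linear_map_H]
  note J = linear_mapD(1) [OF antipode_H_tens(1)]
  show "linear_map H H (antipode H)" by (simp add: linear_map_H antipode_H_tens(1))
  fix x assume "x \<in> carrier H"
  then have x: "x \<in> carrier K" by simp
  have "sweedler H x (\<lambda>x y. lr_mult B C l r (antipode H x) y) = scale K (counit H x) (tens C B (one C) (one B))"
    by (rule tensor_ext [where U = K and f = "\<lambda>x. sweedler H x (\<lambda>x y. lr_mult B C l r (antipode H x) y)" and
      g = "\<lambda>x. scale K (counit H x) (tens C B (one C) (one B))", OF CD(2) _ _ antipode_H_left x])
     (intro linK; simp add: closedH J)+
  then show "sweedler H x (\<lambda>x y. mult H (antipode H x) y) = scale H (counit H x) (one H)"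
    by (simp add: mult_H [folded carrier_H] J [folded carrier_H] scale_H one_H del: carrier_H)
  have "sweedler H x (\<lambda>x y. lr_mult B C l r x (antipode H y)) = scale K (counit H x) (tens C B (one C) (one B))"
    by (rule tensor_ext [where U = K and f = "\<lambda>x. sweedler H x (\<lambda>x y. lr_mult B C l r x (antipode H y))" and
      g = "\<lambda>x. scale K (counit H x) (tens C B (one C) (one B))", OF CD(2) _ _ antipode_H_right x])
     (intro linK; simp add: closedH J)+
  then show "sweedler H x (\<lambda>x y. mult H x (antipode H y)) = scale H (counit H x) (one H)"
    by (simp add: mult_H [folded carrier_H] J [folded carrier_H] scale_H one_H del: carrier_H)
qed

end

section \<open>Transport\<close>

locale lr_smash_transport = lr_smash_product B C l r
  for B :: "('k::field, 'b::ab_group_add, 'm) hopf_scheme"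
    and C :: "('k, 'c::ab_group_add) hopf"
    and l :: "'b \<Rightarrow> 'c \<Rightarrow> 'c" and r :: "'c \<Rightarrow> 'b \<Rightarrow> 'c" +
  fixes T :: "'c \<Rightarrow> 'c"
  assumes T: "linear_automorphism C T"
begin

abbreviation "T' \<equiv> inv_on C T"
abbreviation "D \<equiv> transport C T"
abbreviation "l' \<equiv> transport_left C T l"
abbreviation "r' \<equiv> transport_right C T r"

lemma T_inverse: "x \<in> carrier C \<Longrightarrow> T (T' x) = x" "x \<in> carrier C \<Longrightarrow> T' (T x) = x"
  using T by (auto simp: linear_automorphism_def bij_betw_inv_into_left bij_betw_inv_into_right)

lemma linear_T: "linear_map C C T" "linear_map C C T'"
proof -
  show t: "linear_map C C T" using T by (simp add: linear_automorphism_def)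
  have c: "T' x \<in> carrier C" if "x \<in> carrier C" for x
    using T that by (auto simp: linear_automorphism_def bij_betw_def intro: inv_into_into)
  have "T' (x + y) = T' x + T' y" if "x \<in> carrier C" "y \<in> carrier C" for x y
    using that c linear_mapD(2) [OF t, of "T' x" "T' y"]
      T_inverse(2) [of "T' x + T' y"] by (simp add: T_inverse(1) vspace_closed [OF CD(2)])
  moreover have "T' (scale C k x) = scale C k (T' x)" if "x \<in> carrier C" for k x
    using that c linear_mapD(3) [OF t, of "T' x" k]
      T_inverse(2) [of "scale C k (T' x)"] by (simp add: T_inverse(1) vspace_closed [OF CD(2)])
  ultimately show "linear_map C C T'" by (simp add: linear_map_def c)
qed

lemma T_closed: "x \<in> carrier C \<Longrightarrow> T x \<in> carrier C" "x \<in> carrier C \<Longrightarrow> T' x \<in> carrier C"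
  using linear_T by (auto simp: linear_map_def)

lemma transport_simps [simp]:
  "carrier D = carrier C" "scale D = scale C" "mult D f g = T' (mult C (T f) (T g))"
  "one D = T' (one C)" "comult D f = tmap C C C C T' T' (comult C (T f))"
  "counit D f = counit C (T f)" "antipode D f = T' (antipode C (T f))"
  "l' a f = T' (l a (T f))" "r' f a = T' (r (T f) a)"
  by (simp_all add: transport_def transport_left_def transport_right_def)

lemmas tensor_D = tensor_vsp_cong [OF transport_simps(1,2) refl refl]
  tensor_vsp_cong [OF refl refl transport_simps(1,2)]

lemma linear_map_D: "linear_map D U = linear_map C U" "linear_map X D = linear_map X C"
  by (simp_all add: linear_map_def fun_eq_iff)

lemma bilinear_map_D: "bilinear_map D V U = bilinear_map C V U"
  "bilinear_map V D U = bilinear_map V C U" "bilinear_map V W D = bilinear_map V W C"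
  by (simp_all add: bilinear_map_def linear_map_D fun_eq_iff)

lemma vspace_D: "vspace D"
  using CD(2) by (simp add: vspace_def)

lemmas linT = lin linear_map_comp [OF linear_T(1)] linear_map_comp [OF linear_T(2)]
lemmas closedT = closed T_closed T_inverse

lemma bimodule_algebra_transport: "bimodule_algebra B D l' r'"
proof -
  have eta: "mult D = (\<lambda>f g. T' (mult C (T f) (T g)))" "l' = (\<lambda>a f. T' (l a (T f)))"
    "r' = (\<lambda>f a. T' (r (T f) a))"
    by (simp_all add: fun_eq_iff)
  have "bilinear_map D D D (mult D)" "bilinear_map B D D l'" "bilinear_map D B D r'"
    unfolding bilinear_map_D eta by (auto intro!: bilinear_mapI linT simp: closedT)
  then have "algebra D" "bimodule B D l' r'"
    by (simp_all add: algebra_def bimodule_def vspace_D closedT alg_simps act_simps)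
  moreover have "l' a (mult D f g) = tlift B B (\<lambda>a1 a2. mult D (l' a1 f) (l' a2 g)) (comult B a)"
    "r' (mult D f g) a = tlift B B (\<lambda>a1 a2. mult D (r' f a1) (r' g a2)) (comult B a)"
    if c: "a \<in> carrier B" "f \<in> carrier D" "g \<in> carrier D" for a f g
  proof -
    have b: "bilinear_map B B C (\<lambda>a1 a2. mult D (l' a1 f) (l' a2 g))"
      "bilinear_map B B C (\<lambda>a1 a2. mult D (r' f a1) (r' g a2))"
      using c by (auto intro!: bilinear_mapI linT simp: closedT)
    show "l' a (mult D f g) = tlift B B (\<lambda>a1 a2. mult D (l' a1 f) (l' a2 g)) (comult B a)"
      using c unfolding tlift_comult [OF BD(3) CD(2) b(1) c(1)]
      by (simp add: closedT act_mult linear_sweedler [OF linear_T(2) CD(2)])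
    show "r' (mult D f g) a = tlift B B (\<lambda>a1 a2. mult D (r' f a1) (r' g a2)) (comult B a)"
      using c unfolding tlift_comult [OF BD(3) CD(2) b(2) c(1)]
      by (simp add: closedT act_mult linear_sweedler [OF linear_T(2) CD(2)])
  qed
  moreover have "l' a (one D) = scale D (counit B a) (one D)" "r' (one D) a = scale D (counit B a) (one D)"
    if "a \<in> carrier B" for a
    using that by (simp_all add: closedT act_one linear_mapD(3) [OF linear_T(2)])
  ultimately show ?thesis by (simp add: bimodule_algebra_def del: transport_simps(3-))
qed

text \<open>All facts about the smash product become available for the transported data, in
  particular its formula on elementary tensors and its bilinearity.\<close>

sublocale D: lr_smash_product B D l' r'
  by unfold_locales (rule B cc bimodule_algebra_transport)+

section \<open>The automorphism T \<otimes> id and the transported product\<close>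

abbreviation "TT \<equiv> extend_id B C T"
abbreviation "TT' \<equiv> tmap C B C B T' id"

lemma linear_id: "linear_map V V id"
  by (simp add: linear_map_def)

lemma TT_tens:
  assumes "f \<in> carrier C" "a \<in> carrier B"
  shows "TT (tens C B f a) = tens C B (T f) a" "TT' (tens C B f a) = tens C B (T' f) a"
  using assms by (simp_all add: extend_id_def tmap_tens linear_T linear_id)

lemma linear_TT: "linear_map (C \<otimes> B) (C \<otimes> B) TT" "linear_map (C \<otimes> B) (C \<otimes> B) TT'"
  unfolding extend_id_def by (intro linear_tmap linear_T linear_id CD)+

lemma TT_inverse:
  assumes "x \<in> carrier (C \<otimes> B)"
  shows "TT (TT' x) = x" "TT' (TT x) = x"
proof -
  show "TT (TT' x) = x"
    by (rule tensor_ext [OF CD(2) linear_map_comp [OF linear_TT(1,2)] linear_map_id _ assms])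
      (simp add: TT_tens closedT)
  show "TT' (TT x) = x"
    by (rule tensor_ext [OF CD(2) linear_map_comp [OF linear_TT(2,1)] linear_map_id _ assms])
      (simp add: TT_tens closedT)
qed

text \<open>The set-theoretic inverse \<open>inv_on\<close> has no evident value on elementary
  tensors, while \<open>TT'\<close> is an induced map and does; calculations are done with
  \<open>TT'\<close> and transferred by this lemma.\<close>

lemma inv_TT:
  assumes x: "x \<in> carrier (C \<otimes> B)"
  shows "inv_on (C \<otimes> B) TT x = TT' x"
proof -
  have "inj_on TT (carrier (C \<otimes> B))" by (rule inj_on_inverseI [of _ TT']) (rule TT_inverse)
  from inv_into_f_f [OF this linear_mapD(1) [OF linear_TT(2) x]]
  show ?thesis by (simp add: TT_inverse x)
qed

lemma linear_inv_TT: "linear_map (C \<otimes> B) (C \<otimes> B) (inv_on (C \<otimes> B) TT)"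
  by (rule linear_map_cong [OF linear_TT(2) vspace_tensor inv_TT])

text \<open>The legs come from \<open>B\<close>, which \<open>T\<close> leaves alone, so on
  elementary tensors both sides run over the same Sweedler sums. In each term the inverse applied
  after an action meets the \<open>T\<close> applied before the product, and the two cancel.\<close>

lemma transport_star_eq:
  assumes x: "x \<in> carrier (C \<otimes> B)" and y: "y \<in> carrier (C \<otimes> B)"
  shows "transport_star B C l r T x y = lr_mult B D l' r' x y"
proof -
  note linK = linear_map_id linear_map_comp [OF linear_TT(1)] linear_map_comp [OF linear_TT(2)]
    bilinear_map_linear [OF bilinear_lr_mult]
  note K = linear_mapD(1) [OF linear_TT(1)] linear_mapD(1) [OF linear_TT(2)]
    bilinear_map_closed [OF bilinear_lr_mult]
  have "TT' (lr_mult B C l r (TT (tens C B f a)) (TT (tens C B g b))) =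
      lr_mult B D l' r' (tens C B f a) (tens C B g b)"
    if "f \<in> carrier C" "a \<in> carrier B" "g \<in> carrier C" "b \<in> carrier B" for f a g b
    using that D.lr_mult_tens [of f a g b]
    by (simp add: tensor_D TT_tens lr_mult_tens linear_sweedler [OF linear_TT(2)] closedT)
  then have "TT' (lr_mult B C l r (TT x) (TT y)) = lr_mult B D l' r' x y"
    using D.bilinear_lr_mult
    by (intro tensor_ext2 [where U = "C \<otimes> B" and f = "\<lambda>x y. TT' (lr_mult B C l r (TT x) (TT y))"
        and g = "\<lambda>x y. lr_mult B D l' r' x y", OF CD(2,2) _ _ _ x y])
     (auto simp: tensor_D K intro!: bilinear_mapI linK)
  then show ?thesis by (simp add: transport_star_def inv_TT K x y)
qed

end

section \<open>Transport of the Hopf and bimodule bialgebra structure\<close>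

locale lr_smash_transport_hopf = lr_smash_transport B C l r T
  for B :: "('k::field, 'b::ab_group_add) hopf"
    and C :: "('k, 'c::ab_group_add) hopf"
    and l :: "'b \<Rightarrow> 'c \<Rightarrow> 'c" and r :: "'c \<Rightarrow> 'b \<Rightarrow> 'c" and T :: "'c \<Rightarrow> 'c" +
  assumes HB: "hopf_algebra B" and HC: "hopf_algebra C" and BBC: "bimodule_bialgebra B C l r"
begin

sublocale CH: lr_smash_hopf B C l r "lr_smash B C l r"
  by unfold_locales (simp_all add: lr_smash_def HB HC BBC)

abbreviation "TTC \<equiv> tmap C C C C T' T'"

lemma linear_TTC: "linear_map (C \<otimes> C) (C \<otimes> C) TTC"
  by (intro linear_tmap CD linear_T)

lemma TTC_tens: "f \<in> carrier C \<Longrightarrow> g \<in> carrier C \<Longrightarrow> TTC (tens C C f g) = tens C C (T' f) (T' g)"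
  by (intro tmap_tens linear_T)

lemma comult_C_sweedler: "f \<in> carrier C \<Longrightarrow> comult C f = sweedler C f (tens C C)"
  by (rule comult_sweedler [OF CH.CBD(3)])

lemma comult_D: "f \<in> carrier C \<Longrightarrow> comult D f = sweedler C (T f) (\<lambda>x y. tens C C (T' x) (T' y))"
  by (simp add: comult_C_sweedler T_closed linear_sweedler [OF linear_TTC] closed TTC_tens)

lemma precoalgebra_D: "precoalgebra D"
proof -
  have "linear_map C (C \<otimes> C) (\<lambda>f. TTC (comult C (T f)))"
    by (intro linear_map_comp [OF linear_TTC] linear_map_comp [OF CH.CBD(8)] linear_T)
  then show ?thesis
    by (simp add: precoalgebra_def vspace_D linear_map_D tensor_D linear_map_def)
qed

text \<open>The conjugation rule: a sum over the coproduct of \<open>C\<^sub>T\<close> is a sum over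
  the coproduct of \<open>C\<close> with the inverse of \<open>T\<close> on each leg. It carries
  each axiom involving the transported coproduct back to its counterpart for
  \<open>C\<close>.\<close>

lemma sweedler_D:
  assumes U: "vspace U" and h: "bilinear_map C C U h" and f: "f \<in> carrier C"
  shows "sweedler D f h = sweedler C (T f) (\<lambda>x y. h (T' x) (T' y))"
proof -
  have "sweedler D f h = tlift D D h (comult D f)"
    using h f by (intro tlift_comult [OF precoalgebra_D U, symmetric])
      (simp_all add: bilinear_map_D)
  also have "\<dots> = sweedler C (T f) (\<lambda>x y. h (T' x) (T' y))"
    using f by (simp add: comult_D tensor_D linear_sweedler [OF linear_tlift [OF CD(2) U h]]
      closedT tlift_tens [OF U h] del: transport_simps)
  finally show ?thesis .
qed

lemmas linD = linT linear_map_comp [OF CH.JC] linear_map_comp [OF CH.CBD(7)]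
  linear_map_sweedler [OF CH.CBD(3)]
  linear_map_sweedler [OF precoalgebra_D, unfolded transport_simps linear_map_D]
lemmas closedD = closedT linear_mapD(1) [OF CH.JC] linear_mapD(1) [OF CH.JB]

lemma coalgebra_D: "coalgebra D"
proof (rule coalgebraI [OF precoalgebra_D])
  have "linear_map C ground (\<lambda>f. counit C (T f))"
    by (intro linear_map_comp [OF CH.CBD(7)] linear_T)
  then show "linear_map D ground (counit D)"
    by (simp add: linear_map_def)
next
  fix f assume "f \<in> carrier D"
  then have f: "f \<in> carrier C" by simp
  let ?U = "C \<otimes> (C \<otimes> C)"
  have "sweedler D f (\<lambda>x z. sweedler D x (\<lambda>u v. tens C (C \<otimes> C) u (tens C C v z))) =
    sweedler C (T f) (\<lambda>x z. sweedler D (T' x) (\<lambda>u v. tens C (C \<otimes> C) u (tens C C v (T' z))))"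
    by (intro sweedler_D [where U = ?U] bilinear_mapI linD) (simp_all add: closedD f)
  also have "\<dots> = sweedler C (T f) (\<lambda>x z. sweedler C (T (T' x)) (\<lambda>u v. tens C (C \<otimes> C) (T' u) (tens C C (T' v) (T' z))))"
    by (intro sweedler_cong' sweedler_D [where U = ?U] bilinear_mapI linD) (simp_all add: closedD f)
  also have "\<dots> = sweedler C (T f) (\<lambda>x z. sweedler C x (\<lambda>u v. tens C (C \<otimes> C) (T' u) (tens C C (T' v) (T' z))))"
    by (simp add: closedD)
  also have "\<dots> = sweedler C (T f) (\<lambda>u x. sweedler C x (\<lambda>v z. tens C (C \<otimes> C) (T' u) (tens C C (T' v) (T' z))))"
    by (intro sweedler_coassoc [OF CH.CBD(2), where U = ?U] linD) (simp_all add: closedD f)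
  also have "\<dots> = sweedler C (T f) (\<lambda>u x. sweedler C (T (T' x)) (\<lambda>v z. tens C (C \<otimes> C) (T' u) (tens C C (T' v) (T' z))))"
    by (simp add: closedD)
  also have "\<dots> = sweedler C (T f) (\<lambda>u x. sweedler D (T' x) (\<lambda>v z. tens C (C \<otimes> C) (T' u) (tens C C v z)))"
    by (intro sweedler_cong' sweedler_D [where U = ?U, symmetric] bilinear_mapI linD) (simp_all add: closedD f)
  also have "\<dots> = sweedler D f (\<lambda>u x. sweedler D x (\<lambda>v z. tens C (C \<otimes> C) u (tens C C v z)))"
    by (intro sweedler_D [where U = ?U, symmetric] bilinear_mapI linD) (simp_all add: closedD f)
  finally show "sweedler D f (\<lambda>x z. sweedler D x (\<lambda>u v. tens D (D \<otimes> D) u (tens D D v z))) =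
    sweedler D f (\<lambda>u y. sweedler D y (\<lambda>v z. tens D (D \<otimes> D) u (tens D D v z)))"
    by (simp add: tensor_D)
  have "sweedler D f (\<lambda>x y. scale C (counit C (T x)) y) =
    sweedler C (T f) (\<lambda>x y. scale C (counit C (T (T' x))) (T' y))"
    by (intro sweedler_D [where U = C] bilinear_mapI linD) (simp_all add: closedD f)
  also have "\<dots> = sweedler C (T f) (\<lambda>x y. scale C (counit C x) (T' y))"
    by (simp add: closedD)
  also have "\<dots> = T' (T f)"
    by (intro sweedler_counit [OF CH.CBD(2)] linear_T T_closed f)
  finally show "sweedler D f (\<lambda>x y. scale D (counit D x) y) = f"
    using f by (simp add: closedD)
  have "sweedler D f (\<lambda>x y. scale C (counit C (T y)) x) =
    sweedler C (T f) (\<lambda>x y. scale C (counit C (T (T' y))) (T' x))"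
    by (intro sweedler_D [where U = C] bilinear_mapI linD) (simp_all add: closedD f)
  also have "\<dots> = sweedler C (T f) (\<lambda>x y. scale C (counit C y) (T' x))"
    by (simp add: closedD)
  also have "\<dots> = T' (T f)"
    by (intro sweedler_counit [OF CH.CBD(2)] linear_T T_closed f)
  finally show "sweedler D f (\<lambda>x y. scale D (counit D y) x) = f"
    using f by (simp add: closedD)
qed

lemma bialgebra_D: "bialgebra D"
proof (rule bialgebraI [OF D.CD(1) coalgebra_D])
  note biC = hopf_algebraD(1) [OF HC]
  show "comult D (one D) = tens D D (one D) (one D)"
    using biC by (simp add: closedD tensor_D bialgebra_def TTC_tens)
  show "counit D (one D) = 1"
    using biC by (simp add: closedD bialgebra_def)
  fix x y assume "x \<in> carrier D" "y \<in> carrier D"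
  then have xy: "x \<in> carrier C" "y \<in> carrier C" by simp_all
  show "counit D (mult D x y) = counit D x * counit D y"
    using biC xy by (simp add: closedD bialgebra_def)
  have "comult D (mult D x y) = sweedler C (mult C (T x) (T y)) (\<lambda>x y. tens C C (T' x) (T' y))"
    using xy comult_D [of "mult D x y"] by (simp add: closedD del: transport_simps(5))
  also have "\<dots> = sweedler C (T x) (\<lambda>x1 x2. sweedler C (T y) (\<lambda>y1 y2.
      tens C C (T' (mult C x1 y1)) (T' (mult C x2 y2))))"
    by (intro sweedler_mult [OF biC, where U = "C \<otimes> C"] bilinear_mapI linD) (simp_all add: closedD xy)
  \<comment> \<open>Redundant factors \<open>T (T' _)\<close> are inserted so that the legs occur
    only under \<open>T'\<close>, the shape in which \<open>sweedler_D\<close> can be read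
    backwards.\<close>
  also have "\<dots> = sweedler C (T x) (\<lambda>x1 x2. sweedler C (T y) (\<lambda>y1 y2.
      tens C C (T' (mult C (T (T' x1)) (T (T' y1)))) (T' (mult C (T (T' x2)) (T (T' y2))))))"
    by (simp add: closedD)
  also have "\<dots> = sweedler C (T x) (\<lambda>x1 x2. sweedler D y (\<lambda>y1 y2.
      tens C C (T' (mult C (T (T' x1)) (T y1))) (T' (mult C (T (T' x2)) (T y2)))))"
    by (intro sweedler_cong' sweedler_D [where U = "C \<otimes> C", symmetric] bilinear_mapI linD)
      (simp_all add: closedD xy)
  also have "\<dots> = sweedler D x (\<lambda>x1 x2. sweedler D y (\<lambda>y1 y2.
      tens C C (T' (mult C (T x1) (T y1))) (T' (mult C (T x2) (T y2)))))"
    by (intro sweedler_D [where U = "C \<otimes> C", symmetric] bilinear_mapI linD)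
      (simp_all add: closedD xy)
  finally show "comult D (mult D x y) =
      sweedler D x (\<lambda>x1 x2. sweedler D y (\<lambda>y1 y2. tens D D (mult D x1 y1) (mult D x2 y2)))"
    by (simp add: tensor_D)
qed

lemma hopf_algebra_D: "hopf_algebra D"
proof (rule hopf_algebraI [OF bialgebra_D])
  have "linear_map C C (\<lambda>f. T' (antipode C (T f)))"
    by (intro linD)
  then show "linear_map D D (antipode D)"
    by (simp add: linear_map_def)
  fix f assume "f \<in> carrier D"
  then have f: "f \<in> carrier C" by simp
  have "sweedler D f (\<lambda>x y. mult D (antipode D x) y) =
    sweedler D f (\<lambda>x y. T' (mult C (antipode C (T x)) (T y)))"
    by (intro sweedler_cong') (simp add: closedD)
  also have "\<dots> = sweedler C (T f) (\<lambda>x y. T' (mult C (antipode C (T (T' x))) (T (T' y))))"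
    by (intro sweedler_D [where U = C] bilinear_mapI linD) (simp_all add: closedD f)
  also have "\<dots> = sweedler C (T f) (\<lambda>x y. T' (mult C (antipode C x) y))"
    by (simp add: closedD)
  also have "\<dots> = scale C (counit C (T f)) (T' (one C))"
    by (intro sweedler_antipode [OF HC] linear_T T_closed f)
  finally show "sweedler D f (\<lambda>x y. mult D (antipode D x) y) = scale D (counit D f) (one D)"
    by simp
  have "sweedler D f (\<lambda>x y. mult D x (antipode D y)) =
    sweedler D f (\<lambda>x y. T' (mult C (T x) (antipode C (T y))))"
    by (intro sweedler_cong') (simp add: closedD)
  also have "\<dots> = sweedler C (T f) (\<lambda>x y. T' (mult C (T (T' x)) (antipode C (T (T' y)))))"
    by (intro sweedler_D [where U = C] bilinear_mapI linD) (simp_all add: closedD f)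
  also have "\<dots> = sweedler C (T f) (\<lambda>x y. T' (mult C x (antipode C y)))"
    by (simp add: closedD)
  also have "\<dots> = scale C (counit C (T f)) (T' (one C))"
    by (intro sweedler_antipode [OF HC] linear_T T_closed f)
  finally show "sweedler D f (\<lambda>x y. mult D x (antipode D y)) = scale D (counit D f) (one D)"
    by simp
qed

lemma bimodule_bialgebra_D: "bimodule_bialgebra B D l' r'"
proof -
  have "comult D (l' a f) = tlift B B (\<lambda>a1 a2. tlift D D (\<lambda>f1 f2.
          tens D D (l' a1 f1) (l' a2 f2)) (comult D f)) (comult B a)"
    "comult D (r' f a) = tlift B B (\<lambda>a1 a2. tlift D D (\<lambda>f1 f2.
          tens D D (r' f1 a1) (r' f2 a2)) (comult D f)) (comult B a)"
    if a: "a \<in> carrier B" and f: "f \<in> carrier C" for a f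
  proof -
    have "comult D (l' a f) = sweedler C (l a (T f)) (\<lambda>x y. tens C C (T' x) (T' y))"
      using a f comult_D [of "l' a f"] by (simp add: closedD del: transport_simps(5))
    also have "\<dots> = sweedler B a (\<lambda>a1 a2. sweedler C (T f) (\<lambda>f1 f2. tens C C (T' (l a1 f1)) (T' (l a2 f2))))"
      by (intro CH.sweedler_act [where U = "C \<otimes> C"] bilinear_mapI linD) (simp_all add: closedD a f)
    also have "\<dots> = sweedler B a (\<lambda>a1 a2. sweedler C (T f) (\<lambda>f1 f2. tens C C (T' (l a1 (T (T' f1)))) (T' (l a2 (T (T' f2))))))"
      by (simp add: closedD)
    also have "\<dots> = sweedler B a (\<lambda>a1 a2. sweedler D f (\<lambda>f1 f2. tens C C (T' (l a1 (T f1))) (T' (l a2 (T f2)))))"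
      by (intro sweedler_cong' sweedler_D [where U = "C \<otimes> C", symmetric] bilinear_mapI linD) (simp_all add: closedD a f)
    also have "\<dots> = tlift B B (\<lambda>a1 a2. sweedler D f (\<lambda>f1 f2. tens C C (T' (l a1 (T f1))) (T' (l a2 (T f2))))) (comult B a)"
      by (intro tlift_comult [OF BD(3), where U = "C \<otimes> C", symmetric] bilinear_mapI linD) (simp_all add: closedD a f)
    also have "\<dots> = tlift B B (\<lambda>a1 a2. tlift D D (\<lambda>f1 f2. tens C C (T' (l a1 (T f1))) (T' (l a2 (T f2)))) (comult D f)) (comult B a)"
      by (intro tlift_cong tlift_comult [OF precoalgebra_D, where U = "C \<otimes> C", symmetric],
          unfold bilinear_map_D transport_simps(1), intro vspaces, intro bilinear_mapI linD) (simp_all add: closedD a f)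
    finally show "comult D (l' a f) = tlift B B (\<lambda>a1 a2. tlift D D (\<lambda>f1 f2.
          tens D D (l' a1 f1) (l' a2 f2)) (comult D f)) (comult B a)"
      by (simp add: tensor_D)
    have "comult D (r' f a) = sweedler C (r (T f) a) (\<lambda>x y. tens C C (T' x) (T' y))"
      using a f comult_D [of "r' f a"] by (simp add: closedD del: transport_simps(5))
    also have "\<dots> = sweedler B a (\<lambda>a1 a2. sweedler C (T f) (\<lambda>f1 f2. tens C C (T' (r f1 a1)) (T' (r f2 a2))))"
      by (intro CH.sweedler_act [where U = "C \<otimes> C"] bilinear_mapI linD) (simp_all add: closedD a f)
    also have "\<dots> = sweedler B a (\<lambda>a1 a2. sweedler C (T f) (\<lambda>f1 f2. tens C C (T' (r (T (T' f1)) a1)) (T' (r (T (T' f2)) a2))))"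
      by (simp add: closedD)
    also have "\<dots> = sweedler B a (\<lambda>a1 a2. sweedler D f (\<lambda>f1 f2. tens C C (T' (r (T f1) a1)) (T' (r (T f2) a2))))"
      by (intro sweedler_cong' sweedler_D [where U = "C \<otimes> C", symmetric] bilinear_mapI linD) (simp_all add: closedD a f)
    also have "\<dots> = tlift B B (\<lambda>a1 a2. sweedler D f (\<lambda>f1 f2. tens C C (T' (r (T f1) a1)) (T' (r (T f2) a2)))) (comult B a)"
      by (intro tlift_comult [OF BD(3), where U = "C \<otimes> C", symmetric] bilinear_mapI linD) (simp_all add: closedD a f)
    also have "\<dots> = tlift B B (\<lambda>a1 a2. tlift D D (\<lambda>f1 f2. tens C C (T' (r (T f1) a1)) (T' (r (T f2) a2))) (comult D f)) (comult B a)"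
      by (intro tlift_cong tlift_comult [OF precoalgebra_D, where U = "C \<otimes> C", symmetric],
          unfold bilinear_map_D transport_simps(1), intro vspaces, intro bilinear_mapI linD) (simp_all add: closedD a f)
    finally show "comult D (r' f a) = tlift B B (\<lambda>a1 a2. tlift D D (\<lambda>f1 f2.
          tens D D (r' f1 a1) (r' f2 a2)) (comult D f)) (comult B a)"
      by (simp add: tensor_D)
  qed
  moreover have "counit D (l' a f) = counit B a * counit D f" "counit D (r' f a) = counit D f * counit B a"
    if "a \<in> carrier B" "f \<in> carrier C" for a f
    using that by (simp_all add: closedD CH.counit_act)
  ultimately show ?thesis
    by (simp add: bimodule_bialgebra_def bialgebra_D bimodule_algebra_transport del: transport_simps(3-))
qed

text \<open>The general Hopf theorem is applied to the record that carries
  \<open>transport_star\<close> as its product; the required agreement with \<open>lr_mult\<close>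
  on the carrier is \<open>transport_star_eq\<close>.\<close>

sublocale DH: lr_smash_hopf B D l' r' "(lr_smash B D l' r')\<lparr>mult := transport_star B C l r T\<rparr>"
  by unfold_locales
    (simp_all add: lr_smash_def HB hopf_algebra_D bimodule_bialgebra_D tensor_D transport_star_eq
      del: transport_simps(3-))

section \<open>Coproduct and antipode of the transported smash product\<close>

abbreviation "K \<equiv> C \<otimes> B"

lemma lr_comult_transport:
  assumes x: "x \<in> carrier K"
  shows "lr_comult B D x = tmap K K K K (inv_on K TT) (inv_on K TT) (lr_comult B C (TT x))"
proof (rule tensor_ext [where U = "K \<otimes> K" and f = "lr_comult B D" and
    g = "\<lambda>x. tmap K K K K (inv_on K TT) (inv_on K TT) (lr_comult B C (TT x))", OF CD(2) _ _ _ x])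
  have lt: "linear_map (K \<otimes> K) (K \<otimes> K) (tmap K K K K (inv_on K TT) (inv_on K TT))"
    by (intro linear_tmap vspaces linear_inv_TT)
  show "linear_map K (K \<otimes> K) (lr_comult B D)"
    using lr_comult_tens(1) [OF BD(3) precoalgebra_D] by (simp add: tensor_D)
  show "linear_map K (K \<otimes> K) (\<lambda>x. tmap K K K K (inv_on K TT) (inv_on K TT) (lr_comult B C (TT x)))"
    by (intro linear_map_comp [OF lt] linear_map_comp [OF lr_comult_tens(1) [OF BD(3) CH.CBD(3)]] linear_TT)
  fix f a assume fa: "f \<in> carrier C" "a \<in> carrier B"
  have "lr_comult B D (tens C B f a) = sweedler D f (\<lambda>f1 f2. sweedler B a (\<lambda>a1 a2.
      tens K K (tens C B f1 a1) (tens C B f2 a2)))"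
    using lr_comult_tens(2) [OF BD(3) precoalgebra_D, of f a] fa by (simp add: tensor_D)
  also have "\<dots> = sweedler C (T f) (\<lambda>f1 f2. sweedler B a (\<lambda>a1 a2.
      tens K K (tens C B (T' f1) a1) (tens C B (T' f2) a2)))"
    by (intro sweedler_D [where U = "K \<otimes> K"] bilinear_mapI linD) (simp_all add: closedD fa)
  also have "\<dots> = tmap K K K K (inv_on K TT) (inv_on K TT) (lr_comult B C (TT (tens C B f a)))"
    using fa by (simp add: TT_tens closedD lr_comult_tens(2) [OF BD(3) CH.CBD(3)] linear_sweedler [OF lt]
      tmap_tens [OF linear_inv_TT linear_inv_TT] inv_TT)
  finally show "lr_comult B D (tens C B f a) =
    tmap K K K K (inv_on K TT) (inv_on K TT) (lr_comult B C (TT (tens C B f a)))" .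
qed

text \<open>The three legs of \<open>a\<close> are the same on both sides. Along the chain of
  antipode, left action and right action on \<open>C\<close>, each inner \<open>T'\<close> meets the
  following \<open>T\<close>, so only the outermost pair remains.\<close>

lemma lr_antipode_transport:
  assumes x: "x \<in> carrier K"
  shows "lr_antipode B D l' r' x = inv_on K TT (lr_antipode B C l r (TT x))"
proof (rule tensor_ext [where U = K and f = "lr_antipode B D l' r'" and
    g = "\<lambda>x. inv_on K TT (lr_antipode B C l r (TT x))", OF CD(2) _ _ _ x])
  note J = CH.antipode_H_tens [unfolded CH.antipode_H]
  note J' = DH.antipode_H_tens [unfolded DH.antipode_H]
  show "linear_map K K (lr_antipode B D l' r')"
    using J'(1) by (simp add: tensor_D)
  show "linear_map K K (\<lambda>x. inv_on K TT (lr_antipode B C l r (TT x)))"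
    by (intro linear_map_comp [OF linear_inv_TT] linear_map_comp [OF J(1)] linear_TT)
  fix f a assume fa: "f \<in> carrier C" "a \<in> carrier B"
  show "lr_antipode B D l' r' (tens C B f a) = inv_on K TT (lr_antipode B C l r (TT (tens C B f a)))"
    using fa J'(2) [of f a]
    by (simp add: tensor_D TT_tens J(2) linear_sweedler [OF linear_TT(2)] inv_TT closedD)
qed

end

theorem proposition3p1:
  fixes B :: "('k::real_normed_field, 'b::ab_group_add) hopf"
    and C :: "('k, 'c::ab_group_add) hopf"
    and l :: "'b \<Rightarrow> 'c \<Rightarrow> 'c"
    and r :: "'c \<Rightarrow> 'b \<Rightarrow> 'c"
    and T :: "'c \<Rightarrow> 'c"
  defines "C\<^sub>T \<equiv> transport C T"
    and "l\<^sub>T \<equiv> transport_left C T l"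
    and "r\<^sub>T \<equiv> transport_right C T r"
    and "TT \<equiv> extend_id B C T"
  assumes "bialgebra B" and "cocommutative B"
    and "bimodule_algebra B C l r"
    and "linear_automorphism C T"
  shows
    "bimodule_algebra B C\<^sub>T l\<^sub>T r\<^sub>T \<and>
     (\<forall>x\<in>carrier (C \<otimes> B). \<forall>y\<in>carrier (C \<otimes> B).
        transport_star B C l r T x y = lr_mult B C\<^sub>T l\<^sub>T r\<^sub>T x y) \<and>
     (hopf_algebra B \<and> hopf_algebra C \<and> bimodule_bialgebra B C l r \<longrightarrow>
        hopf_algebra C\<^sub>T \<and> bimodule_bialgebra B C\<^sub>T l\<^sub>T r\<^sub>T \<and>
        hopf_algebra ((lr_smash B C\<^sub>T l\<^sub>T r\<^sub>T)\<lparr>mult := transport_star B C l r T\<rparr>) \<and>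
        (\<forall>x\<in>carrier (C \<otimes> B).
           lr_comult B C\<^sub>T x =
             tmap (C \<otimes> B) (C \<otimes> B) (C \<otimes> B) (C \<otimes> B)
               (inv_on (C \<otimes> B) TT) (inv_on (C \<otimes> B) TT)
               (flip23 C B (tmap C B (C \<otimes> C) (B \<otimes> B) (comult C) (comult B) (TT x)))) \<and>
        (\<forall>x\<in>carrier (C \<otimes> B).
           lr_antipode B C\<^sub>T l\<^sub>T r\<^sub>T x =
             inv_on (C \<otimes> B) TT (lr_antipode B C l r (TT x))))"
proof -
  interpret lr_smash_transport B C l r T
    by unfold_locales (rule assms)+
  show ?thesis
    unfolding C\<^sub>T_def l\<^sub>T_def r\<^sub>T_def TT_def
  proof (intro conjI impI ballI; (elim conjE)?)
    show "bimodule_algebra B D l' r'" by (rule bimodule_algebra_transport)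
    show "transport_star B C l r T x y = lr_mult B D l' r' x y"
      if "x \<in> carrier (C \<otimes> B)" "y \<in> carrier (C \<otimes> B)" for x y
      using that by (rule transport_star_eq)
    \<comment> \<open>The Hopf hypotheses are premises of an implication, so the stronger locale can
      be interpreted only here; the preceding claims live in the bialgebra setting.\<close>
    assume "hopf_algebra B" "hopf_algebra C" "bimodule_bialgebra B C l r"
    then interpret lr_smash_transport_hopf B C l r T
      by unfold_locales
    show "hopf_algebra D" "bimodule_bialgebra B D l' r'"
      by (rule hopf_algebra_D bimodule_bialgebra_D)+
    show "hopf_algebra ((lr_smash B D l' r')\<lparr>mult := transport_star B C l r T\<rparr>)"
      by (rule DH.hopf_algebra_H)
    show "lr_comult B D x = tmap (C \<otimes> B) (C \<otimes> B) (C \<otimes> B) (C \<otimes> B)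
        (inv_on (C \<otimes> B) (extend_id B C T)) (inv_on (C \<otimes> B) (extend_id B C T))
        (flip23 C B (tmap C B (C \<otimes> C) (B \<otimes> B) (comult C) (comult B) (extend_id B C T x)))"
      if "x \<in> carrier (C \<otimes> B)" for x
      using lr_comult_transport [OF that] unfolding lr_comult_def [of B C] .
    show "lr_antipode B D l' r' x = inv_on (C \<otimes> B) (extend_id B C T) (lr_antipode B C l r (extend_id B C T x))"
      if "x \<in> carrier (C \<otimes> B)" for x
      using that by (rule lr_antipode_transport)
  qed
qed

end
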